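(* Let $A\in\mathbb{R}^{m\times n}$, $b\in\mathbb{R}^m$, and let $p:\mathbb{R}^n\to(-\infty,+\infty]$ be a (closed) gauge function. Define $\Phi(x):=\frac12\|Ax-b\|^2$ for $x\in\mathbb{R}^n$ and $$H(x,\lambda):=x-\mathrm{Prox}_p\big(x-\lambda^{-1}\nabla\Phi(x)\big),\quad (x,\lambda)\in\mathbb{R}^n\times(0,+\infty).$$ For $(x,\lambda)\in\mathbb{R}^n\times(0,+\infty)$ let $\partial_xH(x,\lambda)$ denote the canonical projection of the Clarke generalized Jacobian $\partial H(x,\lambda)$ onto $\mathbb{R}^n$. Then: (i) if the metric projector $\Pi_{\partial p(0)}(\cdot)$ is strongly semismooth and $\partial_xH(\bar x,\bar\lambda)$ is nondegenerate at some $(\bar x,\bar\lambda)$ satisfying $H(\bar x,\bar\lambda)=0$, then $y(\cdot)$ and $\varphi(\cdot)$ are strongly semismooth at $\bar\lambda$; (ii) if $p(\cdot)$ is further assumed to be polyhedral, then the function $y(\cdot)$ is piecewise affine and $\varphi(\cdot)$ is strongly semismooth on $(0,+\infty)$.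
   Context: A gauge function is a nonnegative, positively homogeneous convex function $p$ with $p(0)=0$; $p$ is proper and closed; it is polyhedral if its epigraph is polyhedral. $\mathrm{Prox}_p(z):=\arg\min_x\{p(x)+\frac12\|x-z\|^2\}$. The set $\partial_xH(x,\lambda)$ consists of all $n\times n$ matrices $M$ such that $[M\ \ w]\in\partial H(x,\lambda)$ for some $w\in\mathbb{R}^n$; it is nondegenerate if all its elements are nonsingular. For $\lambda>0$ let $\Omega(\lambda)$ be the solution set of $\min_{x\in\mathbb{R}^n}\{\tfrac12\|Ax-b\|^2+\lambda p(x)\}$. Standing assumption: for every $\lambda>0$ there is $(y,u,x)$ with $x\in\partial p^*(u)$, $y-b+Ax=0$, $A^Ty-\lambda u=0$ ($p^*$ the Fenchel conjugate). Consequently $\Omega(\lambda)\ne\emptyset$ and $y(\lambda):=b-Ax(\lambda)$ is the same for all $x(\lambda)\in\Omega(\lambda)$. Define $\varphi(\lambda):=\|Ax(\lambda)-b\|=\|y(\lambda)\|$. A locally Lipschitz function $F$ on an open set is strongly semismooth at $x$ if it is directionally differentiable at $x$ and $F(x+\Delta x)-F(x)-V\Delta x=O(\|\Delta x\|^{2})$ for any $V\in\partial F(x+\Delta x)$ as $\Delta x\to0$; it is strongly semismooth (on its domain) if this holds at every point. *)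

theory Defs
  imports "HOL-Analysis.Analysis"
begin

section \<open>Extended-real-valued convex functions\<close>

definition ext_epigraph :: "('a \<Rightarrow> ereal) \<Rightarrow> ('a \<times> real) set"
  where "ext_epigraph p = {(x, r). p x \<le> ereal r}"

definition proper_fun :: "('a \<Rightarrow> ereal) \<Rightarrow> bool"
  where "proper_fun p \<longleftrightarrow> (\<forall>x. p x \<noteq> - \<infinity>) \<and> (\<exists>x. p x \<noteq> \<infinity>)"

definition convex_fun :: "('a::real_vector \<Rightarrow> ereal) \<Rightarrow> bool"
  where "convex_fun p \<longleftrightarrow> convex (ext_epigraph p)"

definition closed_fun :: "('a::topological_space \<Rightarrow> ereal) \<Rightarrow> bool"
  where "closed_fun p \<longleftrightarrow> closed (ext_epigraph p)"

definition polyhedral_fun :: "('a::euclidean_space \<Rightarrow> ereal) \<Rightarrow> bool"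
  where "polyhedral_fun p \<longleftrightarrow> polyhedron (ext_epigraph p)"

definition gauge_function :: "('a::real_vector \<Rightarrow> ereal) \<Rightarrow> bool"
  where "gauge_function p \<longleftrightarrow>
    (\<forall>x. 0 \<le> p x) \<and>
    (\<forall>x. \<forall>t>0. p (t *\<^sub>R x) = ereal t * p x) \<and>
    convex_fun p \<and> p 0 = 0"

definition fenchel_conjugate :: "('a::real_inner \<Rightarrow> ereal) \<Rightarrow> 'a \<Rightarrow> ereal"
  where "fenchel_conjugate p u = (SUP x. ereal (x \<bullet> u) - p x)"

text \<open>For a proper \<open>g\<close> this set is empty at every point where \<open>g\<close> is infinite.\<close>

definition subdifferential :: "('a::real_inner \<Rightarrow> ereal) \<Rightarrow> 'a \<Rightarrow> 'a set"
  where "subdifferential g u = {x. \<forall>v. g u + ereal (x \<bullet> (v - u)) \<le> g v}"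

definition prox :: "('a::real_inner \<Rightarrow> ereal) \<Rightarrow> 'a \<Rightarrow> 'a"
  where "prox p z = arg_min (\<lambda>x. p x + ereal (1 / 2 * (norm (x - z))\<^sup>2)) (\<lambda>_. True)"


section \<open>Nonsmooth analysis\<close>

definition locally_lipschitz_on :: "'a::metric_space set \<Rightarrow> ('a \<Rightarrow> 'b::metric_space) \<Rightarrow> bool"
  where "locally_lipschitz_on U F \<longleftrightarrow>
    (\<forall>x\<in>U. \<exists>e>0. \<exists>L. L-lipschitz_on (ball x e \<inter> U) F)"

text \<open>
  Clarke's generalized Jacobian: the convex hull of all limits of derivatives
  at differentiability points tending to \<open>x\<close>. Matrices are represented as
  bounded linear maps. Only the values of \<open>F\<close> near \<open>x\<close> matter, so a function
  on an open set \<open>U \<ni> x\<close> may be extended arbitrarily outside \<open>U\<close>.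
\<close>

definition clarke_jacobian ::
    "('a::euclidean_space \<Rightarrow> 'b::euclidean_space) \<Rightarrow> 'a \<Rightarrow> ('a \<Rightarrow>\<^sub>L 'b) set"
  where "clarke_jacobian F x = convex hull
    {V. \<exists>X D. (\<forall>k::nat. (F has_derivative blinfun_apply (D k)) (at (X k)))
            \<and> X \<longlonglongrightarrow> x \<and> D \<longlonglongrightarrow> V}"

definition directionally_differentiable_at ::
    "('a::real_normed_vector \<Rightarrow> 'b::real_normed_vector) \<Rightarrow> 'a \<Rightarrow> bool"
  where "directionally_differentiable_at F x \<longleftrightarrow>
    (\<forall>h. \<exists>l. ((\<lambda>t. (F (x + t *\<^sub>R h) - F x) /\<^sub>R t) \<longlongrightarrow> l) (at_right 0))"

text \<open>The set \<open>U\<close> is the open domain on which \<open>F\<close> is regarded as defined.\<close>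

definition strongly_semismooth_at ::
    "'a::euclidean_space set \<Rightarrow> ('a \<Rightarrow> 'b::euclidean_space) \<Rightarrow> 'a \<Rightarrow> bool"
  where "strongly_semismooth_at U F x \<longleftrightarrow>
    open U \<and> x \<in> U \<and> locally_lipschitz_on U F \<and>
    directionally_differentiable_at F x \<and>
    (\<exists>C. \<forall>\<^sub>F d in at 0. \<forall>V\<in>clarke_jacobian F (x + d).
       norm (F (x + d) - F x - blinfun_apply V d) \<le> C * (norm d)\<^sup>2)"

definition strongly_semismooth_on ::
    "'a::euclidean_space set \<Rightarrow> ('a \<Rightarrow> 'b::euclidean_space) \<Rightarrow> bool"
  where "strongly_semismooth_on U F \<longleftrightarrow> (\<forall>x\<in>U. strongly_semismooth_at U F x)"

text \<open>Piecewise affine: a continuous selection of finitely many affine maps.\<close>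

definition piecewise_affine_on ::
    "'a::euclidean_space set \<Rightarrow> ('a \<Rightarrow> 'b::euclidean_space) \<Rightarrow> bool"
  where "piecewise_affine_on U F \<longleftrightarrow>
    continuous_on U F \<and>
    (\<exists>G. finite G \<and> (\<forall>g\<in>G. \<exists>L c. linear L \<and> g = (\<lambda>x. L x + c))
         \<and> (\<forall>x\<in>U. \<exists>g\<in>G. F x = g x))"

definition gradient :: "('a::real_inner \<Rightarrow> real) \<Rightarrow> 'a \<Rightarrow> 'a"
  where "gradient f x = (THE g. GDERIV f x :> g)"

text \<open>
  The canonical projection: all \<open>M\<close> such that \<open>[M w]\<close> is in the
  generalized Jacobian for some column \<open>w\<close>.
\<close>

definition clarke_jacobian_fst ::
    "((real^'n) \<times> real \<Rightarrow> real^'n) \<Rightarrow> (real^'n) \<times> real \<Rightarrow> (real^'n^'n) set"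
  where "clarke_jacobian_fst H z =
    {M. \<exists>w. \<exists>V\<in>clarke_jacobian H z. \<forall>h t. blinfun_apply V (h, t) = M *v h + t *\<^sub>R w}"

definition nondegenerate :: "(real^'n^'n) set \<Rightarrow> bool"
  where "nondegenerate S \<longleftrightarrow> (\<forall>M\<in>S. invertible M)"


section \<open>The regularized least-squares problem\<close>

definition least_squares :: "real^'n^'m \<Rightarrow> real^'m \<Rightarrow> real^'n \<Rightarrow> real"
  where "least_squares A b x = 1 / 2 * (norm (A *v x - b))\<^sup>2"

definition solution_set ::
    "real^'n^'m \<Rightarrow> real^'m \<Rightarrow> (real^'n \<Rightarrow> ereal) \<Rightarrow> real \<Rightarrow> (real^'n) set"
  where "solution_set A b p l =
    {x. is_arg_min (\<lambda>x. ereal (least_squares A b x) + ereal l * p x) (\<lambda>_. True) x}"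

definition standing_assumption ::
    "real^'n^'m \<Rightarrow> real^'m \<Rightarrow> (real^'n \<Rightarrow> ereal) \<Rightarrow> bool"
  where "standing_assumption A b p \<longleftrightarrow>
    (\<forall>l>0. \<exists>y u x. x \<in> subdifferential (fenchel_conjugate p) u
        \<and> y - b + A *v x = 0 \<and> transpose A *v y - l *\<^sub>R u = 0)"

text \<open>
  \<open>y(\<lambda>) = b - A x(\<lambda>)\<close>, where \<open>x(\<lambda>)\<close> is any solution; the choice is
  immaterial by the lemma below.
\<close>

definition y_sol :: "real^'n^'m \<Rightarrow> real^'m \<Rightarrow> (real^'n \<Rightarrow> ereal) \<Rightarrow> real \<Rightarrow> real^'m"
  where "y_sol A b p l = b - A *v (SOME x. x \<in> solution_set A b p l)"

definition phi_sol :: "real^'n^'m \<Rightarrow> real^'m \<Rightarrow> (real^'n \<Rightarrow> ereal) \<Rightarrow> real \<Rightarrow> real"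
  where "phi_sol A b p l = norm (y_sol A b p l)"

definition prox_residual ::
    "real^'n^'m \<Rightarrow> real^'m \<Rightarrow> (real^'n \<Rightarrow> ereal) \<Rightarrow> (real^'n) \<times> real \<Rightarrow> real^'n"
  where "prox_residual A b p =
    (\<lambda>(x, l). x - prox p (x - inverse l *\<^sub>R gradient (least_squares A b) x))"

lemma y_sol_eq:
  fixes A :: "real^'n^'m"
  assumes g: "gauge_function p" and l: "l > 0" and x: "x \<in> solution_set A b p l"
  shows "y_sol A b p l = b - A *v x"
proof -
  define x' where "x' = (SOME x. x \<in> solution_set A b p l)"
  have x': "x' \<in> solution_set A b p l"
    unfolding x'_def using x by (rule someI)
  let ?q = "least_squares A b"
  have nonneg: "\<And>z. 0 \<le> p z" and p0: "p 0 = 0" and cv: "convex (ext_epigraph p)"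
    using g by (auto simp: gauge_function_def convex_fun_def)
  have min: "ereal (?q u) + ereal l * p u \<le> ereal (?q z) + ereal l * p z"
    if "u \<in> solution_set A b p l" for u z
    using that by (auto simp: solution_set_def is_arg_min_linorder)
  have fin: "\<exists>r. p u = ereal r" if "u \<in> solution_set A b p l" for u
    using min[OF that, of 0] p0 nonneg[of u] l by (cases "p u") auto
  obtain r r' where r: "p x = ereal r" and r': "p x' = ereal r'"
    using fin[OF x] fin[OF x'] by blast
  have eq: "?q x + l * r = ?q x' + l * r'"
    using min[OF x, of x'] min[OF x', of x] r r' by simp
  define z where "z = (1/2) *\<^sub>R x + (1/2) *\<^sub>R x'"
  have "(1/2) *\<^sub>R (x, r) + (1/2) *\<^sub>R (x', r') \<in> ext_epigraph p"
    by (rule convexD[OF cv]) (auto simp: ext_epigraph_def r r')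
  then have pz: "p z \<le> ereal ((r + r') / 2)"
    by (simp add: ext_epigraph_def z_def add_divide_distrib)
  then obtain s where s: "p z = ereal s" "s \<le> (r + r') / 2"
    using nonneg[of z] by (cases "p z") auto
  have le: "?q x + l * r \<le> ?q z + l * s"
    using min[OF x, of z] r s by simp
  have "l * s \<le> l * ((r + r') / 2)"
    using l s(2) by (intro mult_left_mono) auto
  then have "l * s \<le> (l * r + l * r') / 2"
    by (simp add: algebra_simps)
  moreover have "?q z = (?q x + ?q x') / 2 - 1 / 8 * (norm (A *v x - A *v x'))\<^sup>2"
  proof -
    have half: "(norm ((1/2) *\<^sub>R (u + v)))\<^sup>2 =
        ((norm u)\<^sup>2 + (norm v)\<^sup>2) / 2 - 1 / 4 * (norm (u - v))\<^sup>2" for u v :: "real^'m"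
      by (simp add: power2_norm_eq_inner inner_add_left inner_add_right inner_diff_left
          inner_diff_right inner_commute field_simps)
    have "A *v z - b = (1/2) *\<^sub>R ((A *v x - b) + (A *v x' - b))"
      by (simp add: z_def matrix_vector_right_distrib matrix_vector_mult_scaleR vec_eq_iff field_simps)
    then have "(norm (A *v z - b))\<^sup>2 = ((norm (A *v x - b))\<^sup>2 + (norm (A *v x' - b))\<^sup>2) / 2
        - 1 / 4 * (norm (A *v x - A *v x'))\<^sup>2"
      using half[of "A *v x - b" "A *v x' - b"] by simp
    then show ?thesis
      unfolding least_squares_def by simp
  qed
  ultimately have "(norm (A *v x - A *v x'))\<^sup>2 \<le> 0"
    using le eq by argo
  then show ?thesis by (simp add: y_sol_def x'_def)
qed

end

theory Submission
  imports Defs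
begin

text \<open>
  Write \<open>C = \<partial>p(0)\<close>. A closed gauge is the support function of \<open>C\<close>, so its conjugate is the
  indicator of \<open>C\<close>, \<open>Prox\<^sub>p z = z - \<Pi>\<^sub>C z\<close>, and
  \<open>H(x, \<lambda>) = \<Pi>\<^sub>C(x + u) - u\<close> with \<open>u = \<lambda>\<^sup>-\<^sup>1 A\<^sup>T (b - A x)\<close>. Zeros of \<open>H\<close>
  are exactly the solutions of the optimality conditions \<open>u \<in> C\<close>, \<open>x \<in> N\<^sub>C(u)\<close>; moreover
  \<open>y(\<lambda>) = \<lambda> \<Pi>\<^sub>D(b / \<lambda>)\<close> with \<open>D = {w. A\<^sup>T w \<in> C}\<close>. Hence \<open>y\<close> is locally Lipschitz, and it
  vanishes either nowhere or identically, which reduces every claim on \<open>\<phi> = \<parallel>y\<parallel>\<close> to one on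
  \<open>y\<close>.

  Strong semismoothness is handled through one-sided directional derivatives: a map \<open>G\<close> is
  called radially semismooth at \<open>q\<^sub>0\<close> when \<open>G(q) - G(q\<^sub>0) - \<sigma> G'(q; \<sigma>(q - q\<^sub>0)) = O(\<parallel>q - q\<^sub>0\<parallel>\<^sup>2)\<close>
  for \<open>\<sigma> = 1\<close> and \<open>\<sigma> = -1\<close>. This notion composes well, and for directionally
  differentiable Lipschitz maps it implies strong semismoothness, because the generalized
  Jacobian is generated by derivatives. The converse needs derivatives to exist near every
  point. Rademacher's theorem is avoided: directional differentiability makes the partial
  derivatives pointwise limits of continuous functions, so by the Baire category theorem they
  have common points of continuity on a dense set, and at such points the map is
  differentiable. Semismoothness then also makes every directional derivative a limit of
  derivatives at nearby points (\<open>dirderiv_approx_by_derivative\<close>).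

  For part (i), this approximation together with a one-sided mean value inequality and the
  compactness of the convex set \<open>\<partial>\<^sub>xH\<close> turns nondegeneracy into the bound
  \<open>c \<parallel>x - x'\<parallel> \<le> \<parallel>H(x, \<lambda>) - H(x', \<lambda>)\<parallel>\<close> near the given zero
  (\<open>nondegenerate_imp_partially_injective\<close>). This makes the zero locally unique; by convexity
  the solutions at nearby parameters converge to it, and the bound shows that they form a
  Lipschitz, directionally differentiable and radially semismooth curve \<open>x(\<lambda>)\<close>. Then
  \<open>y = b - A x\<close> inherits these properties.

  For part (ii), \<open>D\<close> is a polyhedron. On the parameters with a given set of active
  constraints, \<open>y(\<lambda>)\<close> solves a linear system that is jointly affine in \<open>(\<lambda>, y)\<close> and
  determines \<open>y\<close>. So \<open>y\<close> is a continuous selection of finitely many affine functions of one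
  variable, hence near each point a broken line, which is radially semismooth.
\<close>


section \<open>One-sided directional derivatives\<close>

text \<open>\<open>has_dirderiv G q k l\<close>: the one-sided directional derivative \<open>G'(q; k)\<close> exists and equals \<open>l\<close>.\<close>

definition has_dirderiv ::
    "('a::real_normed_vector \<Rightarrow> 'b::real_normed_vector) \<Rightarrow> 'a \<Rightarrow> 'a \<Rightarrow> 'b \<Rightarrow> bool"
  where "has_dirderiv G q k l \<longleftrightarrow>
    ((\<lambda>t. (G (q + t *\<^sub>R k) - G q) /\<^sub>R t) \<longlongrightarrow> l) (at_right 0)"

lemma directionally_differentiable_iff:
  "directionally_differentiable_at G q \<longleftrightarrow> (\<forall>k. \<exists>l. has_dirderiv G q k l)"
  by (simp add: directionally_differentiable_at_def has_dirderiv_def)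

lemma has_dirderiv_unique:
  "has_dirderiv G q k l \<Longrightarrow> has_dirderiv G q k l' \<Longrightarrow> l = l'"
  unfolding has_dirderiv_def using tendsto_unique trivial_limit_at_right_real by blast

lemma has_dirderiv_iff_remainder:
  "has_dirderiv G q k l \<longleftrightarrow>
    (\<forall>e>0. \<forall>\<^sub>F t in at_right 0. norm (G (q + t *\<^sub>R k) - G q - t *\<^sub>R l) \<le> e * t)"
proof -
  have eq: "dist ((G (q + t *\<^sub>R k) - G q) /\<^sub>R t) l = norm (G (q + t *\<^sub>R k) - G q - t *\<^sub>R l) / t"
    if "t > 0" for t
  proof -
    have "(G (q + t *\<^sub>R k) - G q) /\<^sub>R t - l = (G (q + t *\<^sub>R k) - G q - t *\<^sub>R l) /\<^sub>R t"
      using that by (simp add: scaleR_diff_right)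
    then show ?thesis using that by (simp add: dist_norm divide_inverse_commute)
  qed
  show ?thesis
  proof
    assume "has_dirderiv G q k l"
    then have *: "\<forall>e>0. \<forall>\<^sub>F t in at_right 0. dist ((G (q + t *\<^sub>R k) - G q) /\<^sub>R t) l < e"
      unfolding has_dirderiv_def tendsto_iff .
    show "\<forall>e>0. \<forall>\<^sub>F t in at_right 0. norm (G (q + t *\<^sub>R k) - G q - t *\<^sub>R l) \<le> e * t"
    proof (intro allI impI)
      fix e :: real assume "e > 0"
      with * have "\<forall>\<^sub>F t in at_right 0. dist ((G (q + t *\<^sub>R k) - G q) /\<^sub>R t) l < e" by blast
      then show "\<forall>\<^sub>F t in at_right 0. norm (G (q + t *\<^sub>R k) - G q - t *\<^sub>R l) \<le> e * t"
        using eventually_at_right_less[of "0::real"]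
        by eventually_elim (simp add: eq divide_less_eq)
    qed
  next
    assume *: "\<forall>e>0. \<forall>\<^sub>F t in at_right 0. norm (G (q + t *\<^sub>R k) - G q - t *\<^sub>R l) \<le> e * t"
    show "has_dirderiv G q k l" unfolding has_dirderiv_def tendsto_iff
    proof (intro allI impI)
      fix e :: real assume "e > 0"
      then have "\<forall>\<^sub>F t in at_right 0. norm (G (q + t *\<^sub>R k) - G q - t *\<^sub>R l) \<le> (e/2) * t"
        using * half_gt_zero by blast
      then show "\<forall>\<^sub>F t in at_right 0. dist ((G (q + t *\<^sub>R k) - G q) /\<^sub>R t) l < e"
        using eventually_at_right_less[of "0::real"]
      proof eventually_elim
        case (elim t)
        have "e / 2 * t < e * t" using elim(2) \<open>e > 0\<close> by simp
        then show ?case using elim by (simp add: eq divide_less_eq)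
      qed
    qed
  qed
qed

lemma eventually_ray_in_open:
  fixes q k :: "'a::real_normed_vector"
  assumes "open S" "q \<in> S"
  shows "\<forall>\<^sub>F t in at_right 0. q + t *\<^sub>R k \<in> S"
proof -
  have "((\<lambda>t. q + t *\<^sub>R k) \<longlongrightarrow> q + 0 *\<^sub>R k) (at_right 0)" by (intro tendsto_intros)
  then show ?thesis using topological_tendstoD[OF _ assms(1)] assms(2) by simp
qed

lemma at_right_scale:
  fixes c :: real
  assumes "c > 0"
  shows "filterlim (\<lambda>t. t * c) (at_right 0) (at_right 0)"
proof -
  have "filtermap (\<lambda>t. c * t) (at_right 0) = at_right (c * 0)"
    by (rule filtermap_times_pos_at_right[OF assms])
  then show ?thesis by (simp add: filterlim_def mult.commute)
qed

lemma has_dirderiv_scale: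
  assumes "has_dirderiv G q k l" "c \<ge> 0"
  shows "has_dirderiv G q (c *\<^sub>R k) (c *\<^sub>R l)"
proof (cases "c = 0")
  case True then show ?thesis by (simp add: has_dirderiv_def)
next
  case False
  then have c: "c > 0" using assms(2) by simp
  have "((\<lambda>t. (G (q + (t * c) *\<^sub>R k) - G q) /\<^sub>R (t * c)) \<longlongrightarrow> l) (at_right 0)"
    using filterlim_compose[OF assms(1)[unfolded has_dirderiv_def] at_right_scale[OF c]] .
  then have "((\<lambda>t. c *\<^sub>R ((G (q + (t * c) *\<^sub>R k) - G q) /\<^sub>R (t * c))) \<longlongrightarrow> c *\<^sub>R l) (at_right 0)"
    by (intro tendsto_intros)
  moreover have "(\<lambda>t. c *\<^sub>R ((G (q + (t * c) *\<^sub>R k) - G q) /\<^sub>R (t * c)))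
      = (\<lambda>t. (G (q + t *\<^sub>R (c *\<^sub>R k)) - G q) /\<^sub>R t)"
    using c by (auto simp: fun_eq_iff)
  ultimately show ?thesis by (simp add: has_dirderiv_def)
qed

lemma has_dirderiv_cong:
  assumes "open S" "q \<in> S" "\<And>x. x \<in> S \<Longrightarrow> G x = G' x"
  shows "has_dirderiv G q k l \<longleftrightarrow> has_dirderiv G' q k l"
proof -
  have "\<forall>\<^sub>F t in at_right 0.
      (G (q + t *\<^sub>R k) - G q) /\<^sub>R t = (G' (q + t *\<^sub>R k) - G' q) /\<^sub>R t"
    using eventually_ray_in_open[OF assms(1,2), of k] by eventually_elim (use assms in simp)
  then show ?thesis unfolding has_dirderiv_def by (rule tendsto_cong)
qed

lemma has_dirderiv_add:
  assumes "has_dirderiv F q k l" "has_dirderiv G q k m"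
  shows "has_dirderiv (\<lambda>x. F x + G x) q k (l + m)"
  using tendsto_add[OF assms[unfolded has_dirderiv_def]]
  by (simp add: has_dirderiv_def algebra_simps)

lemma has_dirderiv_linear:
  assumes "bounded_linear f" "has_dirderiv G q k l"
  shows "has_dirderiv (\<lambda>x. f (G x)) q k (f l)"
proof -
  interpret f: bounded_linear f by fact
  show ?thesis using f.tendsto[OF assms(2)[unfolded has_dirderiv_def]]
    by (simp add: has_dirderiv_def f.diff f.scaleR)
qed

lemma has_dirderiv_const: "has_dirderiv (\<lambda>_. c) q k 0"
  by (simp add: has_dirderiv_def)

lemma has_derivative_imp_has_dirderiv:
  assumes "(G has_derivative D) (at q)"
  shows "has_dirderiv G q k (D k)"
  unfolding has_dirderiv_iff_remainder
proof (intro allI impI)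
  fix e :: real assume "e > 0"
  interpret D: bounded_linear D using assms by (rule has_derivative_bounded_linear)
  define N where "N = norm k + 1"
  have N: "N > 0" "norm k \<le> N" by (auto simp: N_def add_nonneg_pos)
  obtain d where d: "d > 0"
    "\<And>y. norm (y - q) < d \<Longrightarrow> norm (G y - G q - D (y - q)) \<le> e / N * norm (y - q)"
    using assms[unfolded has_derivative_at_alt] \<open>e > 0\<close> N by (meson divide_pos_pos)
  have "\<forall>\<^sub>F t in at_right 0. t \<in> {0<..<d / N}"
    by (rule eventually_at_right_real) (use d N in simp)
  then show "\<forall>\<^sub>F t in at_right 0. norm (G (q + t *\<^sub>R k) - G q - t *\<^sub>R D k) \<le> e * t"
  proof eventually_elim
    case (elim t)
    then have t: "0 < t" "t * N < d" using N by (auto simp: field_simps)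
    have "norm (t *\<^sub>R k) \<le> t * N" using t N by (simp add: mult_left_mono)
    then have "norm (G (q + t *\<^sub>R k) - G q - D (t *\<^sub>R k)) \<le> e / N * norm (t *\<^sub>R k)"
      using d(2)[of "q + t *\<^sub>R k"] le_less_trans[OF \<open>norm (t *\<^sub>R k) \<le> t * N\<close> t(2)] by simp
    also have "\<dots> \<le> e / N * (t * N)"
      using \<open>norm (t *\<^sub>R k) \<le> t * N\<close> \<open>e > 0\<close> N by (intro mult_left_mono) auto
    finally show ?case using N by (simp add: D.scaleR)
  qed
qed

text \<open>Chain rule for one-sided directional derivatives: a Lipschitz outer function need
  not be differentiable.\<close>

lemma has_dirderiv_compose:
  fixes G :: "'b::real_normed_vector \<Rightarrow> 'c::real_normed_vector"
    and \<gamma> :: "'a::real_normed_vector \<Rightarrow> 'b"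
  assumes S: "open S" "\<gamma> s \<in> S" and L: "L-lipschitz_on S G"
    and G: "has_dirderiv G (\<gamma> s) k l" and \<gamma>: "has_dirderiv \<gamma> s \<kappa> k"
  shows "has_dirderiv (\<lambda>x. G (\<gamma> x)) s \<kappa> l"
  unfolding has_dirderiv_iff_remainder
proof (intro allI impI)
  fix e :: real assume "e > 0"
  have L0: "L \<ge> 0" using L by (rule lipschitz_on_nonneg)
  define e' where "e' = e / (2 * (L + 1))"
  have e': "e' > 0" "L * e' \<le> e / 2" using \<open>e > 0\<close> L0 by (auto simp: e'_def field_simps)
  have 1: "\<forall>\<^sub>F t in at_right 0. \<gamma> s + t *\<^sub>R k \<in> S" by (rule eventually_ray_in_open[OF S])
  have "((\<lambda>t. \<gamma> s + t *\<^sub>R ((\<gamma> (s + t *\<^sub>R \<kappa>) - \<gamma> s) /\<^sub>R t)) \<longlongrightarrow> \<gamma> s + 0 *\<^sub>R k) (at_right 0)"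
    using \<gamma>[unfolded has_dirderiv_def] by (intro tendsto_intros)
  then have "\<forall>\<^sub>F t in at_right 0. \<gamma> s + t *\<^sub>R ((\<gamma> (s + t *\<^sub>R \<kappa>) - \<gamma> s) /\<^sub>R t) \<in> S"
    using topological_tendstoD[OF _ S(1)] S(2) by simp
  then have 2: "\<forall>\<^sub>F t in at_right 0. \<gamma> (s + t *\<^sub>R \<kappa>) \<in> S"
    using eventually_at_right_less[of "0::real"] by eventually_elim simp
  have 3: "\<forall>\<^sub>F t in at_right 0. norm (\<gamma> (s + t *\<^sub>R \<kappa>) - \<gamma> s - t *\<^sub>R k) \<le> e' * t"
    using \<gamma> e' unfolding has_dirderiv_iff_remainder by blast
  have 4: "\<forall>\<^sub>F t in at_right 0. norm (G (\<gamma> s + t *\<^sub>R k) - G (\<gamma> s) - t *\<^sub>R l) \<le> e / 2 * t"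
    using G \<open>e > 0\<close> half_gt_zero unfolding has_dirderiv_iff_remainder by blast
  show "\<forall>\<^sub>F t in at_right 0. norm (G (\<gamma> (s + t *\<^sub>R \<kappa>)) - G (\<gamma> s) - t *\<^sub>R l) \<le> e * t"
    using 1 2 3 4 eventually_at_right_less[of "0::real"]
  proof eventually_elim
    case (elim t)
    have "norm (G (\<gamma> (s + t *\<^sub>R \<kappa>)) - G (\<gamma> s + t *\<^sub>R k))
        \<le> L * norm (\<gamma> (s + t *\<^sub>R \<kappa>) - (\<gamma> s + t *\<^sub>R k))"
      using lipschitz_on_normD[OF L] elim by blast
    also have "\<dots> \<le> L * (e' * t)"
      using elim(3) L0 by (intro mult_left_mono) (auto simp: algebra_simps)
    also have "\<dots> \<le> e / 2 * t"
      using mult_right_mono[OF e'(2), of t] elim(5) by (simp add: mult.assoc)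
    finally have "norm (G (\<gamma> (s + t *\<^sub>R \<kappa>)) - G (\<gamma> s + t *\<^sub>R k)) \<le> e / 2 * t" .
    then have "norm ((G (\<gamma> (s + t *\<^sub>R \<kappa>)) - G (\<gamma> s + t *\<^sub>R k)) +
        (G (\<gamma> s + t *\<^sub>R k) - G (\<gamma> s) - t *\<^sub>R l)) \<le> e / 2 * t + e / 2 * t"
      using elim(4) by (rule norm_triangle_mono)
    then show ?case by (simp add: algebra_simps)
  qed
qed

lemma has_dirderiv_diff_le:
  assumes S: "open S" "q \<in> S" and L: "L-lipschitz_on S G"
    and G: "has_dirderiv G q k l" and G': "has_dirderiv G q k' l'"
  shows "norm (l - l') \<le> L * norm (k - k')"
proof -
  from eventually_ray_in_open[OF S, of k] eventually_ray_in_open[OF S, of k']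
  have ev: "\<forall>\<^sub>F t in at_right 0. norm ((G (q + t *\<^sub>R k) - G q) /\<^sub>R t - (G (q + t *\<^sub>R k') - G q) /\<^sub>R t)
      \<le> L * norm (k - k')"
    using eventually_at_right_less[of "0::real"]
  proof eventually_elim
    case (elim t)
    have "(G (q + t *\<^sub>R k) - G q) /\<^sub>R t - (G (q + t *\<^sub>R k') - G q) /\<^sub>R t
        = (G (q + t *\<^sub>R k) - G (q + t *\<^sub>R k')) /\<^sub>R t"
      by (simp add: algebra_simps)
    moreover have "norm (G (q + t *\<^sub>R k) - G (q + t *\<^sub>R k')) \<le> L * norm (t *\<^sub>R (k - k'))"
      using lipschitz_on_normD[OF L elim(1,2)] by (simp add: algebra_simps)
    ultimately show ?case using elim(3)
      by (simp add: divide_inverse_commute[symmetric] pos_divide_le_eq ac_simps)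
  qed
  show ?thesis
    by (rule tendsto_upperbound[OF tendsto_norm[OF tendsto_diff[OF
          G[unfolded has_dirderiv_def] G'[unfolded has_dirderiv_def]]] ev]) simp
qed

lemma has_dirderiv_norm_le:
  assumes "open S" "q \<in> S" "L-lipschitz_on S G" "has_dirderiv G q k l"
  shows "norm l \<le> L * norm k"
  using has_dirderiv_diff_le[OF assms, of 0 0] by (simp add: has_dirderiv_def)


lemma right_derivative_mean_value_ge:
  fixes f :: "real \<Rightarrow> real"
  assumes ab: "a \<le> b" and cont: "continuous_on {a..b} f"
    and deriv: "\<And>t. a \<le> t \<Longrightarrow> t < b \<Longrightarrow> \<exists>l\<ge>c. has_dirderiv f t 1 l"
  shows "c * (b - a) \<le> f b - f a"
proof (rule ccontr)
  assume neg: "\<not> ?thesis"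
  then have "a < b" using ab by (cases "a = b") auto
  define e where "e = (c * (b - a) - (f b - f a)) / (2 * (b - a))"
  have e: "e > 0" using neg \<open>a < b\<close> by (simp add: e_def)
  define g where "g t = f t - (c - e) * t" for t
  have "(c - e) * (b - a) > f b - f a"
  proof -
    have "x / (2 * w) * w = x / 2" if "w > 0" for x w :: real using that by simp
    from this[of "b - a"] have "e * (b - a) = (c * (b - a) - (f b - f a)) / 2"
      using \<open>a < b\<close> unfolding e_def by simp
    then show ?thesis using neg by (simp add: left_diff_distrib)
  qed
  then have gb: "g b < g a" by (simp add: g_def algebra_simps)
  have cg: "continuous_on {a..b} g" unfolding g_def by (intro continuous_intros cont)
  \<comment> \<open>At the last point \<open>t0\<close> where \<open>g\<close> is at least \<open>g a\<close>, the right derivative of \<open>g\<close> is at most \<open>0\<close>;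
    but right derivatives of \<open>g\<close> are at least \<open>e\<close>.\<close>
  let ?T = "{a..b} \<inter> g -` {g a..}"
  have "compact ?T"
    using continuous_closed_preimage[OF cg closed_atLeastAtMost closed_atLeast, of "g a"]
    by (metis Int_lower1 bounded_closed_interval bounded_subset compact_eq_bounded_closed)
  moreover have "a \<in> ?T" using ab by simp
  ultimately obtain t0 where t0: "t0 \<in> ?T" "\<And>t. t \<in> ?T \<Longrightarrow> t \<le> t0"
    using compact_attains_sup[of ?T] by (metis empty_iff)
  then have t0': "a \<le> t0" "t0 < b" "g a \<le> g t0" using gb by (auto simp: less_le)
  obtain l where l: "l \<ge> c" "has_dirderiv f t0 1 l" using deriv t0' by blast
  have "\<forall>\<^sub>F t in at_right 0. t \<in> {0<..<b - t0}"
    by (rule eventually_at_right_real) (use t0' in simp)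
  then have "\<forall>\<^sub>F t in at_right 0. (f (t0 + t *\<^sub>R 1) - f t0) /\<^sub>R t \<le> c - e"
  proof eventually_elim
    case (elim t)
    then have "t0 + t \<notin> ?T" using t0(2)[of "t0 + t"] by force
    then have "g (t0 + t) < g a" using elim t0' by auto
    then have "f (t0 + t) - f t0 \<le> (c - e) * t" using t0'(3) by (simp add: g_def algebra_simps)
    then show ?case using elim by (simp add: field_simps)
  qed
  then have "l \<le> c - e"
    using tendsto_upperbound[OF l(2)[unfolded has_dirderiv_def]] trivial_limit_at_right_real by blast
  then show False using l(1) e by simp
qed

lemma dirderiv_mean_value_ge:
  fixes G :: "'a::real_normed_vector \<Rightarrow> 'b::real_inner"
  assumes cont: "continuous_on (closed_segment q (q + k)) G"
    and deriv: "\<And>w. w \<in> closed_segment q (q + k) \<Longrightarrow> \<exists>l. has_dirderiv G w k l \<and> c \<le> e \<bullet> l"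
  shows "c \<le> e \<bullet> (G (q + k) - G q)"
proof -
  have seg: "q + t *\<^sub>R k \<in> closed_segment q (q + k)" if "0 \<le> t" "t \<le> 1" for t
    using that by (auto simp: in_segment algebra_simps intro!: exI[of _ t])
  define f where "f t = e \<bullet> G (q + t *\<^sub>R k)" for t
  have "continuous_on {0..1} (\<lambda>t. G (q + t *\<^sub>R k))"
    by (rule continuous_on_compose2[OF cont]) (auto intro!: continuous_intros seg)
  then have cf: "continuous_on {0..1} f" unfolding f_def by (intro continuous_intros)
  have "c * (1 - 0) \<le> f 1 - f 0"
  proof (rule right_derivative_mean_value_ge[OF _ cf])
    fix t :: real assume "0 \<le> t" "t < 1"
    then obtain l where l: "has_dirderiv G (q + t *\<^sub>R k) k l" "c \<le> e \<bullet> l"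
      using deriv[OF seg, of t] by auto
    have "has_dirderiv (\<lambda>w. e \<bullet> G w) (q + t *\<^sub>R k) k (e \<bullet> l)"
      by (rule has_dirderiv_linear[OF bounded_linear_inner_right l(1)])
    then have "has_dirderiv f t 1 (e \<bullet> l)" by (simp add: has_dirderiv_def f_def algebra_simps)
    then show "\<exists>l\<ge>c. has_dirderiv f t 1 l" using l(2) by blast
  qed simp
  then show ?thesis by (simp add: f_def inner_diff_right)
qed

lemma dirderiv_mean_value_norm:
  fixes G :: "'a::real_normed_vector \<Rightarrow> 'b::real_inner"
  assumes cont: "continuous_on (closed_segment q (q + k)) G"
    and deriv: "\<And>w. w \<in> closed_segment q (q + k) \<Longrightarrow> \<exists>l. has_dirderiv G w k l \<and> norm (l - l0) \<le> e"
  shows "norm (G (q + k) - G q - l0) \<le> e"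
proof -
  define v where "v = G (q + k) - G q - l0"
  have "(- v) \<bullet> l0 - norm v * e \<le> (- v) \<bullet> (G (q + k) - G q)"
  proof (rule dirderiv_mean_value_ge[OF cont])
    fix w assume "w \<in> closed_segment q (q + k)"
    then obtain l where l: "has_dirderiv G w k l" "norm (l - l0) \<le> e" using deriv by blast
    have "v \<bullet> (l - l0) \<le> norm v * norm (l - l0)" by (rule norm_cauchy_schwarz)
    also have "\<dots> \<le> norm v * e" using l(2) by (simp add: mult_left_mono)
    finally show "\<exists>l. has_dirderiv G w k l \<and> (- v) \<bullet> l0 - norm v * e \<le> (- v) \<bullet> l"
      using l(1) by (auto simp: inner_diff_right)
  qed
  then have "v \<bullet> v \<le> norm v * e" by (simp add: v_def inner_diff_right inner_diff_left)
  then have "norm v * norm v \<le> norm v * e" by (simp add: dot_square_norm power2_eq_square)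
  moreover have "0 \<le> e"
    using deriv[of q] order_trans[OF norm_ge_zero] by auto
  ultimately have "norm v \<le> e"
    by (cases "v = 0") auto
  then show ?thesis by (simp add: v_def)
qed


section \<open>Differentiability on a dense set\<close>

lemma interior_frontier_closed_empty:
  fixes S :: "'a::topological_space set"
  assumes "closed S"
  shows "interior (frontier S) = {}"
proof -
  have "interior (frontier S) \<subseteq> interior S"
    by (intro interior_mono) (use assms in \<open>simp add: frontier_subset_closed\<close>)
  moreover have "interior (frontier S) \<inter> interior S = {}"
    using interior_subset by (auto simp: frontier_def)
  ultimately show ?thesis by blast
qed

text \<open>A finite family of pointwise limits of continuous functions has a common point of
  continuity in every ball: the points avoiding the frontiers of the closed sets where the
  sequences have stabilised up to \<open>1 / (k + 1)\<close> form a residual set.\<close>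

lemma pointwise_limits_common_continuity_point:
  fixes f :: "'i \<Rightarrow> nat \<Rightarrow> 'a::euclidean_space \<Rightarrow> 'b::metric_space"
  assumes "r > 0" "finite I"
    and cont: "\<And>i n. i \<in> I \<Longrightarrow> continuous_on (cball q r) (f i n)"
    and lim: "\<And>i z. i \<in> I \<Longrightarrow> z \<in> cball q r \<Longrightarrow> (\<lambda>n. f i n z) \<longlonglongrightarrow> g i z"
  shows "\<exists>z\<in>ball q r. \<forall>i\<in>I. isCont (g i) z"
proof -
  define S where "S = cball q r"
  define A where "A i k N = {z\<in>S. \<forall>m\<ge>N. \<forall>n\<ge>N. dist (f i m z) (f i n z) \<le> 1 / real (Suc k)}"
    for i k N
  have clA: "closed (A i k N)" if "i \<in> I" for i k N
  proof -
    have "closed (S \<inter> (\<lambda>z. dist (f i m z) (f i n z)) -` {..1 / real (Suc k)})" for m n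
      using that by (intro continuous_closed_preimage)
        (auto simp: S_def intro!: continuous_intros cont)
    then have "closed (S \<inter> (\<Inter>m\<in>{N..}. \<Inter>n\<in>{N..}.
        S \<inter> (\<lambda>z. dist (f i m z) (f i n z)) -` {..1 / real (Suc k)}))"
      by (intro closed_Int[OF _ closed_INT] ballI closed_INT) (auto simp: S_def)
    also have "\<dots> = A i k N" by (auto simp: A_def)
    finally show ?thesis .
  qed
  define \<G> where "\<G> = (\<lambda>(i, k, N). S - frontier (A i k N)) ` (I \<times> UNIV \<times> UNIV)"
  have "S \<subseteq> closure (\<Inter>\<G>)"
  proof (rule Baire)
    show "closed S" by (simp add: S_def)
    show "countable \<G>" unfolding \<G>_def using \<open>finite I\<close>
      by (intro countable_image countable_SIGMA) (auto simp: countable_finite)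
    fix T assume "T \<in> \<G>"
    then obtain i k N where i: "i \<in> I" and T: "T = S - frontier (A i k N)"
      by (auto simp: \<G>_def)
    have "openin (top_of_set S) T"
      unfolding T by (auto simp: openin_closedin_eq Diff_Diff_Int intro!: closedin_closed_Int)
    moreover have "S \<subseteq> closure T"
    proof -
      have "closure (- frontier (A i k N)) = UNIV"
        using interior_frontier_closed_empty[OF clA[OF i]] by (simp add: closure_complement)
      then have "ball q r \<subseteq> closure (ball q r \<inter> - frontier (A i k N))"
        using open_Int_closure_subset[OF open_ball, of q r "- frontier (A i k N)"] by simp
      also have "\<dots> \<subseteq> closure T" by (intro closure_mono) (auto simp: T S_def)
      finally have "closure (ball q r) \<subseteq> closure T" by (simp add: closure_minimal)
      then show ?thesis using \<open>r > 0\<close> by (simp add: S_def)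
    qed
    ultimately show "openin (top_of_set S) T \<and> S \<subseteq> closure T" ..
  qed
  then have "q \<in> closure (\<Inter>\<G>)" using \<open>r > 0\<close> by (auto simp: S_def)
  then obtain z where z: "z \<in> \<Inter>\<G>" "dist z q < r"
    using \<open>r > 0\<close> unfolding closure_approachable by blast
  then have zb: "z \<in> ball q r" by (simp add: dist_commute)
  have "isCont (g i) z" if i: "i \<in> I" for i
    unfolding continuous_at_eps_delta
  proof (intro allI impI)
    fix e :: real assume "e > 0"
    obtain k where k: "1 / real (Suc k) < e / 3"
      using nat_approx_posE[of "e / 3"] \<open>e > 0\<close> by auto
    have zS: "z \<in> S" using zb by (auto simp: S_def)
    have "Cauchy (\<lambda>n. f i n z)" using lim[OF i, of z] zS by (auto simp: S_def LIMSEQ_imp_Cauchy)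
    then obtain N where N: "\<And>m n. m \<ge> N \<Longrightarrow> n \<ge> N \<Longrightarrow> dist (f i m z) (f i n z) < 1 / real (Suc k)"
      unfolding Cauchy_def by (metis of_nat_0_less_iff zero_less_Suc zero_less_divide_1_iff)
    then have "z \<in> A i k N" using zS by (force simp: A_def)
    moreover have "z \<notin> frontier (A i k N)" using z(1) i by (auto simp: \<G>_def)
    ultimately have "z \<in> interior (A i k N)" using clA[OF i] by (simp add: frontier_def)
    then obtain d1 where d1: "d1 > 0" "ball z d1 \<subseteq> A i k N" by (auto simp: mem_interior)
    have near: "dist (f i N w) (g i w) \<le> 1 / real (Suc k)" if "w \<in> A i k N" for w
    proof (rule tendsto_upperbound)
      show "(\<lambda>n. dist (f i N w) (f i n w)) \<longlonglongrightarrow> dist (f i N w) (g i w)"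
        using that by (intro tendsto_intros lim[OF i]) (auto simp: A_def S_def)
      show "\<forall>\<^sub>F n in sequentially. dist (f i N w) (f i n w) \<le> 1 / real (Suc k)"
        using that by (auto simp: A_def eventually_sequentially)
    qed simp
    have "continuous_on (ball q r) (f i N)"
      using cont[OF i] continuous_on_subset ball_subset_cball by blast
    then have "isCont (f i N) z" using zb by (simp add: continuous_on_eq_continuous_at)
    then obtain d2 where d2: "d2 > 0" "\<And>w. dist w z < d2 \<Longrightarrow> dist (f i N w) (f i N z) < e / 3"
      unfolding continuous_at_eps_delta using \<open>e > 0\<close> by (metis zero_less_divide_iff zero_less_numeral)
    show "\<exists>d>0. \<forall>w. dist w z < d \<longrightarrow> dist (g i w) (g i z) < e"
    proof (intro exI[of _ "min d1 d2"] conjI allI impI)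
      fix w assume w: "dist w z < min d1 d2"
      then have "w \<in> A i k N" using d1 by (auto simp: dist_commute)
      from near[OF this] near[OF \<open>z \<in> A i k N\<close>] d2(2)[of w] w
      show "dist (g i w) (g i z) < e"
        using k dist_triangle[of "g i w" "g i z" "f i N w"]
          dist_triangle[of "f i N w" "g i z" "f i N z"] by (simp add: dist_commute)
    qed (use d1 d2 in auto)
  qed
  then show ?thesis using zb by blast
qed

text \<open>At a point of continuity of \<open>w \<mapsto> G'(w; i)\<close> the partial derivative in direction \<open>i\<close> is
  two-sided and even strict, by the mean value inequality.\<close>

lemma axis_strict_derivative:
  fixes G :: "'a::euclidean_space \<Rightarrow> 'b::euclidean_space"
  assumes "open U" "z \<in> U" and cont: "continuous_on U G"
    and g: "\<And>w. w \<in> U \<Longrightarrow> has_dirderiv G w i (g w)" and "isCont g z" and i: "i \<in> Basis"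
    and "e > 0"
  shows "\<exists>d>0. \<forall>w t. norm (w - z) < d \<longrightarrow> \<bar>t\<bar> < d \<longrightarrow>
    norm (G (w + t *\<^sub>R i) - G w - t *\<^sub>R g z) \<le> e * \<bar>t\<bar>"
proof -
  obtain r where r: "r > 0" "ball z r \<subseteq> U" using \<open>open U\<close> \<open>z \<in> U\<close> openE by blast
  obtain d0 where d0: "d0 > 0" "\<And>w. dist w z < d0 \<Longrightarrow> dist (g w) (g z) < e"
    using \<open>isCont g z\<close> \<open>e > 0\<close> unfolding continuous_at_eps_delta by blast
  define d where "d = min r d0 / 3"
  have d: "d > 0" using r d0 by (simp add: d_def)
  have pos: "norm (G (w + t *\<^sub>R i) - G w - t *\<^sub>R g z) \<le> e * t"
    if w: "norm (w - z) < 2 * d" and t: "0 \<le> t" "t < d" for w t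
  proof -
    have seg: "dist v z < min r d0" if "v \<in> closed_segment w (w + t *\<^sub>R i)" for v
    proof -
      have "norm (v - w) \<le> norm (t *\<^sub>R i)"
        using segment_bound1[OF that] by (simp add: norm_minus_commute)
      then have "norm (v - w) \<le> t" using t i by simp
      then have "norm (v - z) < 3 * d"
        using w t norm_triangle_ineq[of "v - w" "w - z"] by simp
      then show ?thesis by (simp add: d_def dist_norm)
    qed
    show ?thesis
    proof (rule dirderiv_mean_value_norm)
      show "continuous_on (closed_segment w (w + t *\<^sub>R i)) G"
        using continuous_on_subset[OF cont] seg r(2)
        by (metis dist_commute mem_ball min_less_iff_conj subset_iff)
      fix v assume v: "v \<in> closed_segment w (w + t *\<^sub>R i)"
      then have "v \<in> U" using seg[OF v] r(2) by (auto simp: dist_commute)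
      moreover have "norm (t *\<^sub>R g v - t *\<^sub>R g z) \<le> e * t"
      proof -
        have "norm (t *\<^sub>R g v - t *\<^sub>R g z) = t * norm (g v - g z)"
          using t(1) by (simp add: scaleR_diff_right[symmetric])
        also have "\<dots> \<le> t * e"
          using d0(2)[of v] seg[OF v] t(1) by (intro mult_left_mono) (auto simp: dist_norm)
        finally show ?thesis by (simp add: mult.commute)
      qed
      ultimately show "\<exists>l. has_dirderiv G v (t *\<^sub>R i) l \<and> norm (l - t *\<^sub>R g z) \<le> e * t"
        using has_dirderiv_scale[OF g t(1)] by blast
    qed
  qed
  show ?thesis
  proof (intro exI[of _ d] conjI allI impI d)
    fix w t assume w: "norm (w - z) < d" and t: "\<bar>t\<bar> < d"
    show "norm (G (w + t *\<^sub>R i) - G w - t *\<^sub>R g z) \<le> e * \<bar>t\<bar>"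
    proof (cases "t \<ge> 0")
      case True then show ?thesis using pos[of w t] w t d by simp
    next
      case False
      have "norm (w + t *\<^sub>R i - z) \<le> norm (w - z) + norm (t *\<^sub>R i)"
        by (metis add_diff_eq diff_add_eq norm_triangle_ineq)
      then have "norm (w + t *\<^sub>R i - z) < 2 * d" using w t i by simp
      from pos[OF this, of "- t"] False t
      have "norm (G w - G (w + t *\<^sub>R i) - (- t) *\<^sub>R g z) \<le> e * (- t)" by simp
      moreover have "norm (G w - G (w + t *\<^sub>R i) - (- t) *\<^sub>R g z)
          = norm (G (w + t *\<^sub>R i) - G w - t *\<^sub>R g z)"
        by (subst norm_minus_commute) (simp add: algebra_simps)
      ultimately show ?thesis using False by simp
    qed
  qed
qed

lemma has_derivative_of_continuous_axis_dirderivs: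
  fixes G :: "'a::euclidean_space \<Rightarrow> 'b::euclidean_space"
  assumes "open U" "z \<in> U" and cont: "continuous_on U G"
    and g: "\<And>w i. w \<in> U \<Longrightarrow> i \<in> Basis \<Longrightarrow> has_dirderiv G w i (g i w)"
    and gc: "\<And>i. i \<in> Basis \<Longrightarrow> isCont (g i) z"
  shows "(G has_derivative (\<lambda>v. \<Sum>i\<in>Basis. (v \<bullet> i) *\<^sub>R g i z)) (at z)"
proof -
  have tele: "\<exists>d>0. \<forall>c::'a. norm c < d \<longrightarrow>
      norm (G (z + (\<Sum>i\<in>B. (c \<bullet> i) *\<^sub>R i)) - G z - (\<Sum>i\<in>B. (c \<bullet> i) *\<^sub>R g i z)) \<le> (card B * e) * norm c"
    if "finite B" "B \<subseteq> Basis" "e > 0" for e :: real and B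
    using that
  proof (induction B)
    case empty then show ?case by (intro exI[of _ 1]) auto
  next
    case (insert i B)
    then obtain d where d: "d > 0" "\<And>c::'a. norm c < d \<Longrightarrow>
      norm (G (z + (\<Sum>i\<in>B. (c \<bullet> i) *\<^sub>R i)) - G z - (\<Sum>i\<in>B. (c \<bullet> i) *\<^sub>R g i z)) \<le> (card B * e) * norm c"
      by auto
    have i: "i \<in> Basis" using insert by simp
    obtain d' where d': "d' > 0" "\<And>w t. norm (w - z) < d' \<Longrightarrow> \<bar>t\<bar> < d' \<Longrightarrow>
        norm (G (w + t *\<^sub>R i) - G w - t *\<^sub>R g i z) \<le> e * \<bar>t\<bar>"
      using axis_strict_derivative[OF assms(1-3) g[OF _ i] gc[OF i] i \<open>e > 0\<close>] by blast
    define n where "n = real (Suc (card B))"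
    have n: "n \<ge> 1" by (simp add: n_def)
    show ?case
    proof (intro exI[of _ "min d (d' / n)"] conjI allI impI)
      show "0 < min d (d' / n)" using d d' n by simp
      fix c :: 'a assume c: "norm c < min d (d' / n)"
      then have c': "norm c * n < d'" using n by (simp add: pos_less_divide_eq)
      have comp: "\<bar>c \<bullet> j\<bar> \<le> norm c" if "j \<in> Basis" for j using that by (rule Basis_le_norm)
      have "norm (\<Sum>i\<in>B. (c \<bullet> i) *\<^sub>R i) \<le> (\<Sum>i\<in>B. norm c)"
        using insert.prems by (intro sum_norm_le) (auto intro!: comp)
      also have "\<dots> \<le> norm c * n" by (simp add: n_def algebra_simps)
      finally have 1: "norm (z + (\<Sum>i\<in>B. (c \<bullet> i) *\<^sub>R i) - z) < d'" using c' by simp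
      have "norm c * 1 \<le> norm c * n" using n by (intro mult_left_mono) auto
      then have 2: "\<bar>c \<bullet> i\<bar> < d'" using comp[OF i] c' by simp
      have "norm (G (z + (\<Sum>i\<in>B. (c \<bullet> i) *\<^sub>R i) + (c \<bullet> i) *\<^sub>R i) - G (z + (\<Sum>i\<in>B. (c \<bullet> i) *\<^sub>R i))
          - (c \<bullet> i) *\<^sub>R g i z) \<le> e * \<bar>c \<bullet> i\<bar>" by (rule d'(2)[OF 1 2])
      also have "\<dots> \<le> e * norm c" using comp[OF i] \<open>e > 0\<close> by (intro mult_left_mono) auto
      finally have 3: "norm (G (z + (\<Sum>i\<in>B. (c \<bullet> i) *\<^sub>R i) + (c \<bullet> i) *\<^sub>R i) - G (z + (\<Sum>i\<in>B. (c \<bullet> i) *\<^sub>R i))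
          - (c \<bullet> i) *\<^sub>R g i z) \<le> e * norm c" .
      from norm_triangle_mono[OF 3 d(2)[of c]] c
      show "norm (G (z + (\<Sum>i\<in>insert i B. (c \<bullet> i) *\<^sub>R i)) - G z - (\<Sum>i\<in>insert i B. (c \<bullet> i) *\<^sub>R g i z))
        \<le> (card (insert i B) * e) * norm c"
        using insert.hyps by (simp add: algebra_simps)
    qed
  qed
  show ?thesis
    unfolding has_derivative_at_alt
  proof (intro conjI allI impI)
    show "bounded_linear (\<lambda>v. \<Sum>i\<in>Basis. (v \<bullet> i) *\<^sub>R g i z)"
      by (intro bounded_linear_sum bounded_linear_scaleR_const bounded_linear_inner_left)
    fix e :: real assume "e > 0"
    define e' where "e' = e / DIM('a)"
    have "e' > 0" "DIM('a) * e' = e" using \<open>e > 0\<close> by (auto simp: e'_def)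
    then obtain d where d: "d > 0" "\<And>c::'a. norm c < d \<Longrightarrow>
      norm (G (z + (\<Sum>i\<in>Basis. (c \<bullet> i) *\<^sub>R i)) - G z - (\<Sum>i\<in>Basis. (c \<bullet> i) *\<^sub>R g i z)) \<le> e * norm c"
      using tele[of Basis e'] by auto
    then show "\<exists>d>0. \<forall>y. norm (y - z) < d \<longrightarrow>
        norm (G y - G z - (\<Sum>i\<in>Basis. ((y - z) \<bullet> i) *\<^sub>R g i z)) \<le> e * norm (y - z)"
      unfolding euclidean_representation by (metis add.commute diff_add_cancel)
  qed
qed

text \<open>A substitute for Rademacher's theorem.\<close>

lemma dense_differentiability:
  fixes G :: "'a::euclidean_space \<Rightarrow> 'b::euclidean_space"
  assumes "open U" and cont: "continuous_on U G"
    and dd: "\<And>w. w \<in> U \<Longrightarrow> directionally_differentiable_at G w"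
    and "q \<in> U" "e > 0"
  shows "\<exists>z\<in>U. dist z q < e \<and> (\<exists>D. (G has_derivative blinfun_apply D) (at z))"
proof -
  obtain r0 where r0: "r0 > 0" "ball q r0 \<subseteq> U" using \<open>open U\<close> \<open>q \<in> U\<close> openE by blast
  define r where "r = min e r0 / 3"
  have r: "r > 0" "r \<le> e" "ball q (3 * r) \<subseteq> U"
    using r0 \<open>e > 0\<close> by (auto simp: r_def intro!: subset_trans[OF _ r0(2)] subset_ball)
  have "\<forall>i w. \<exists>l. w \<in> U \<longrightarrow> has_dirderiv G w i l"
    using dd directionally_differentiable_iff by blast
  then obtain g where g: "\<And>i w. w \<in> U \<Longrightarrow> has_dirderiv G w i (g i w)" by metis
  define t where "t n = r / real (Suc n)" for n
  have t: "0 < t n" "t n \<le> r" for n using r(1) by (auto simp: t_def field_simps)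
  have t0: "t \<longlonglongrightarrow> 0" unfolding t_def by (rule lim_const_over_n[THEN LIMSEQ_Suc])
  then have tlim: "filterlim t (at_right 0) sequentially"
    by (simp add: filterlim_at t less_imp_neq[OF t(1), symmetric])
  have inU: "w \<in> U" "w + t n *\<^sub>R i \<in> U" if "w \<in> cball q r" "i \<in> Basis" for w n i
  proof -
    have "norm (t n *\<^sub>R i) \<le> r" using t[of n] that(2) by simp
    then have "dist q (w + t n *\<^sub>R i) \<le> 2 * r"
      using that(1) norm_triangle_ineq[of "w - q" "t n *\<^sub>R i"]
      by (simp add: dist_norm norm_minus_commute algebra_simps)
    then show "w + t n *\<^sub>R i \<in> U" using r by auto
    show "w \<in> U" using that(1) r by auto
  qed
  have "\<exists>z\<in>ball q r. \<forall>i\<in>Basis. isCont (g i) z"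
  proof (rule pointwise_limits_common_continuity_point[OF r(1) finite_Basis])
    fix i :: 'a assume i: "i \<in> Basis"
    show "continuous_on (cball q r) (\<lambda>w. (G (w + t n *\<^sub>R i) - G w) /\<^sub>R t n)" for n
      by (intro continuous_intros continuous_on_compose2[OF cont] continuous_on_subset[OF cont])
        (auto dest: inU[OF _ i])
    fix w assume "w \<in> cball q r"
    then have "has_dirderiv G w i (g i w)" using inU[OF _ i] g by blast
    then show "(\<lambda>n. (G (w + t n *\<^sub>R i) - G w) /\<^sub>R t n) \<longlonglongrightarrow> g i w"
      unfolding has_dirderiv_def using tlim by (rule filterlim_compose)
  qed
  then obtain z where z: "z \<in> ball q r" "\<And>i. i \<in> Basis \<Longrightarrow> isCont (g i) z" by blast
  have "z \<in> U" using z(1) r by auto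
  have der: "(G has_derivative (\<lambda>v. \<Sum>i\<in>Basis. (v \<bullet> i) *\<^sub>R g i z)) (at z)"
    by (rule has_derivative_of_continuous_axis_dirderivs[OF \<open>open U\<close> \<open>z \<in> U\<close> cont g z(2)])
  then have "(G has_derivative blinfun_apply (Blinfun (\<lambda>v. \<Sum>i\<in>Basis. (v \<bullet> i) *\<^sub>R g i z))) (at z)"
    by (simp add: bounded_linear_Blinfun_apply has_derivative_bounded_linear)
  moreover have "dist z q < e" using z(1) r(2) by (simp add: dist_commute)
  ultimately show ?thesis using \<open>z \<in> U\<close> by blast
qed


section \<open>Semismoothness through directional derivatives\<close>

text \<open>
  The directional form of strong semismoothness: the derivative of \<open>G\<close> at a point \<open>q\<close> near \<open>q0\<close>,
  taken along the line through \<open>q0\<close> and \<open>q\<close>, predicts \<open>G q - G q0\<close> up to second order. Both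
  orientations \<open>\<sigma>\<close> of the line are required, since \<open>G'(q; -k)\<close> may differ from \<open>- G'(q; k)\<close>. The
  condition is void at points \<open>q\<close> where the directional derivative does not exist.
\<close>

definition radial_semismooth_at ::
    "('a::real_normed_vector \<Rightarrow> 'b::real_normed_vector) \<Rightarrow> 'a \<Rightarrow> bool"
  where "radial_semismooth_at G q0 \<longleftrightarrow>
    (\<exists>C\<ge>0. \<exists>\<delta>>0. \<forall>q. norm (q - q0) < \<delta> \<longrightarrow>
      (\<forall>\<sigma>\<in>{1, -1}. \<forall>l. has_dirderiv G q (\<sigma> *\<^sub>R (q - q0)) l \<longrightarrow>
        norm (G q - G q0 - \<sigma> *\<^sub>R l) \<le> C * (norm (q - q0))\<^sup>2))"

lemma radial_semismooth_atI:
  assumes "\<delta> > 0" and "\<And>q \<sigma> l. norm (q - q0) < \<delta> \<Longrightarrow> \<sigma> \<in> {1, -1} \<Longrightarrow>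
      has_dirderiv G q (\<sigma> *\<^sub>R (q - q0)) l \<Longrightarrow> norm (G q - G q0 - \<sigma> *\<^sub>R l) \<le> C * (norm (q - q0))\<^sup>2"
  shows "radial_semismooth_at G q0"
  unfolding radial_semismooth_at_def
proof (rule exI[of _ "max C 0"], rule conjI, simp, rule exI[of _ \<delta>], intro conjI allI impI ballI)
  fix q \<sigma> l assume "norm (q - q0) < \<delta>" "\<sigma> \<in> {1, -1}" "has_dirderiv G q (\<sigma> *\<^sub>R (q - q0)) l"
  then have "norm (G q - G q0 - \<sigma> *\<^sub>R l) \<le> C * (norm (q - q0))\<^sup>2" by (rule assms)
  also have "\<dots> \<le> max C 0 * (norm (q - q0))\<^sup>2" by (intro mult_right_mono) auto
  finally show "norm (G q - G q0 - \<sigma> *\<^sub>R l) \<le> max C 0 * (norm (q - q0))\<^sup>2" .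
qed (use assms in auto)

text \<open>If the derivatives near \<open>q\<close> satisfy the semismoothness estimate at \<open>q\<close>, then every
  directional derivative at \<open>q\<close> is a limit of derivatives \<open>D k\<close> at points tending to \<open>q\<close>.\<close>

lemma dirderiv_approx_by_derivative:
  fixes G :: "'a::euclidean_space \<Rightarrow> 'b::euclidean_space"
  assumes U: "open U" "q \<in> U" and Lip: "L-lipschitz_on U G"
    and dd: "\<And>w. w \<in> U \<Longrightarrow> directionally_differentiable_at G w"
    and ss: "\<delta> > 0" "\<And>z D. norm (z - q) < \<delta> \<Longrightarrow> z \<noteq> q \<Longrightarrow> (G has_derivative blinfun_apply D) (at z) \<Longrightarrow>
        norm (G z - G q - D (z - q)) \<le> C * (norm (z - q))\<^sup>2"
    and l: "has_dirderiv G q k l" and "e > 0"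
  shows "\<exists>z\<in>U. \<exists>D. dist z q < e \<and> (G has_derivative blinfun_apply D) (at z) \<and> norm (D k - l) < e"
proof -
  note dense = dense_differentiability[OF U(1) lipschitz_on_continuous_on[OF Lip] dd]
  show ?thesis
  proof (cases "k = 0")
    case True
    then have "l = 0" using l has_dirderiv_unique has_dirderiv_scale[OF l, of 0] by simp
    obtain z D where "z \<in> U" "dist z q < e" "(G has_derivative blinfun_apply D) (at z)"
      using dense[OF _ U(2) \<open>e > 0\<close>] by blast
    then show ?thesis using True \<open>l = 0\<close> \<open>e > 0\<close> by (auto simp: blinfun.zero_right)
  next
    case False
    have L0: "L \<ge> 0" using Lip by (rule lipschitz_on_nonneg)
    define N where "N = norm k + 1"
    have N: "N > 0" by (simp add: N_def add_nonneg_pos)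
    define M where "M = \<bar>C\<bar> * N\<^sup>2 + 2 * L + 1"
    have M: "M > 0" using L0 by (simp add: M_def add_nonneg_pos)
    define \<tau> where "\<tau> = Min {1, norm k, \<delta> / N, e / N, e / (2 * M)}"
    have \<tau>: "\<tau> > 0" using False N M ss(1) \<open>e > 0\<close> by (simp add: \<tau>_def)
    have 1: "\<forall>\<^sub>F t in at_right 0. q + t *\<^sub>R k \<in> U" by (rule eventually_ray_in_open[OF U])
    have 2: "\<forall>\<^sub>F t in at_right 0. norm (G (q + t *\<^sub>R k) - G q - t *\<^sub>R l) \<le> (e / 4) * t"
      using l \<open>e > 0\<close> unfolding has_dirderiv_iff_remainder by (meson divide_pos_pos zero_less_numeral)
    have 3: "\<forall>\<^sub>F t in at_right 0. t \<in> {0<..<\<tau>}" by (rule eventually_at_right_real[OF \<tau>])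
    obtain t where t: "q + t *\<^sub>R k \<in> U" "norm (G (q + t *\<^sub>R k) - G q - t *\<^sub>R l) \<le> (e / 4) * t"
        "t \<in> {0<..<\<tau>}"
      using eventually_happens[OF eventually_conj[OF 1 eventually_conj[OF 2 3]]] by auto
    then have tb: "0 < t" "t < 1" "t < norm k" "t * N < \<delta>" "t * N < e" "t * M < e / 2"
      using N M by (auto simp: \<tau>_def field_simps)
    \<comment> \<open>A point of differentiability within \<open>t\<^sup>2\<close> of \<open>q + t k\<close> sees the same
      difference quotient up to \<open>O(t)\<close>.\<close>
    obtain z D where z: "z \<in> U" "dist z (q + t *\<^sub>R k) < t\<^sup>2" and D: "(G has_derivative blinfun_apply D) (at z)"
      using dense[OF _ t(1), of "t\<^sup>2"] tb by auto
    define v where "v = z - (q + t *\<^sub>R k)"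
    have v: "norm v < t\<^sup>2" using z(2) by (simp add: v_def dist_norm)
    have zq: "z - q = t *\<^sub>R k + v" by (simp add: v_def)
    have "t\<^sup>2 \<le> t" using tb by (simp add: power2_eq_square)
    then have nzq: "norm (z - q) \<le> t * N"
      using v norm_triangle_ineq[of "t *\<^sub>R k" v] tb unfolding zq N_def by (simp add: algebra_simps)
    have "z \<noteq> q"
    proof
      assume "z = q"
      then have "norm v = t * norm k" using tb by (simp add: v_def)
      moreover have "t * norm k > t * t" using tb by (intro mult_strict_left_mono) auto
      ultimately show False using v by (simp add: power2_eq_square)
    qed
    have Dle: "norm (D w) \<le> L * norm w" for w
      using has_dirderiv_norm_le[OF U(1) z(1) Lip has_derivative_imp_has_dirderiv[OF D]] .
    have a: "norm (D (z - q) - (G z - G q)) \<le> \<bar>C\<bar> * (t * N)\<^sup>2"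
    proof -
      have "norm (G z - G q - D (z - q)) \<le> C * (norm (z - q))\<^sup>2"
        using ss(2)[OF _ \<open>z \<noteq> q\<close> D] nzq tb by simp
      also have "\<dots> \<le> \<bar>C\<bar> * (t * N)\<^sup>2" using nzq by (intro mult_mono power_mono) auto
      finally show ?thesis by (simp add: norm_minus_commute)
    qed
    have b: "norm (- D v) \<le> L * t\<^sup>2"
      using Dle[of v] mult_left_mono[OF less_imp_le[OF v] L0] by simp
    have c: "norm (G z - G (q + t *\<^sub>R k)) \<le> L * t\<^sup>2"
      using lipschitz_on_normD[OF Lip z(1) t(1)] mult_left_mono[OF less_imp_le[OF v] L0]
      by (simp add: v_def)
    have "t *\<^sub>R (D k - l) = (D (z - q) - (G z - G q)) + (- D v) + (G z - G (q + t *\<^sub>R k))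
        + (G (q + t *\<^sub>R k) - G q - t *\<^sub>R l)"
      unfolding zq by (simp add: blinfun.bilinear_simps algebra_simps)
    then have "norm (t *\<^sub>R (D k - l)) \<le> \<bar>C\<bar> * (t * N)\<^sup>2 + L * t\<^sup>2 + L * t\<^sup>2 + (e / 4) * t"
      using norm_triangle_mono[OF norm_triangle_mono[OF norm_triangle_mono[OF a b] c] t(2)] by simp
    also have "\<dots> \<le> t * (t * M) + (e / 4) * t"
      unfolding M_def by (simp add: power2_eq_square algebra_simps)
    also have "\<dots> < t * (e / 2) + (e / 4) * t"
      using mult_strict_left_mono[OF tb(6) tb(1)] by linarith
    also have "\<dots> < t * e" using tb \<open>e > 0\<close> by (simp add: field_simps)
    finally have "norm (D k - l) < e" using tb by simp
    moreover have "dist z q < e" using nzq tb by (simp add: dist_norm)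
    ultimately show ?thesis using z(1) D by blast
  qed
qed

lemma derivative_in_clarke_jacobian:
  assumes "(G has_derivative blinfun_apply D) (at z)"
  shows "D \<in> clarke_jacobian G z"
  unfolding clarke_jacobian_def
  by (rule hull_inc) (use assms in \<open>auto intro!: exI[of _ "\<lambda>_. z"] exI[of _ "\<lambda>_. D"]\<close>)

text \<open>For a globally Lipschitz map the Clarke Jacobians at nearby points may be replaced by
  directional derivatives, at the price of assuming strong semismoothness everywhere.\<close>

lemma strongly_semismooth_on_imp_radial:
  fixes F :: "'a::euclidean_space \<Rightarrow> 'b::euclidean_space"
  assumes ssm: "strongly_semismooth_on UNIV F" and Lip: "L-lipschitz_on UNIV F"
  shows "radial_semismooth_at F z0"
proof -
  have L0: "L \<ge> 0" using Lip by (rule lipschitz_on_nonneg)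
  have dd: "directionally_differentiable_at F w" for w
    using ssm by (simp add: strongly_semismooth_on_def strongly_semismooth_at_def)
  have ss: "\<exists>C\<ge>0. \<exists>\<delta>>0. \<forall>z' D. norm (z' - z) < \<delta> \<longrightarrow> z' \<noteq> z \<longrightarrow> (F has_derivative blinfun_apply D) (at z') \<longrightarrow>
      norm (F z' - F z - D (z' - z)) \<le> C * (norm (z' - z))\<^sup>2" for z
  proof -
    obtain C where "\<forall>\<^sub>F d in at 0. \<forall>V\<in>clarke_jacobian F (z + d).
        norm (F (z + d) - F z - blinfun_apply V d) \<le> C * (norm d)\<^sup>2"
      using ssm by (auto simp: strongly_semismooth_on_def strongly_semismooth_at_def)
    then obtain \<delta> where \<delta>: "\<delta> > 0" "\<And>d V. d \<noteq> 0 \<Longrightarrow> norm d < \<delta> \<Longrightarrow> V \<in> clarke_jacobian F (z + d) \<Longrightarrow>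
        norm (F (z + d) - F z - blinfun_apply V d) \<le> C * (norm d)\<^sup>2"
      unfolding eventually_at by (auto simp: dist_norm)
    show ?thesis
    proof (rule exI[of _ "\<bar>C\<bar>"], rule conjI, simp, rule exI[of _ \<delta>], intro conjI allI impI)
      fix z' D assume "norm (z' - z) < \<delta>" "z' \<noteq> z" "(F has_derivative blinfun_apply D) (at z')"
      then have "norm (F z' - F z - D (z' - z)) \<le> C * (norm (z' - z))\<^sup>2"
        using \<delta>(2)[of "z' - z" D] derivative_in_clarke_jacobian[of F D z'] by simp
      also have "\<dots> \<le> \<bar>C\<bar> * (norm (z' - z))\<^sup>2" by (intro mult_right_mono) auto
      finally show "norm (F z' - F z - D (z' - z)) \<le> \<bar>C\<bar> * (norm (z' - z))\<^sup>2" .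
    qed (rule \<delta>(1))
  qed
  obtain C \<delta> where C0: "C \<ge> 0" and C: "\<delta> > 0" "\<And>z D. norm (z - z0) < \<delta> \<Longrightarrow> z \<noteq> z0 \<Longrightarrow> (F has_derivative blinfun_apply D) (at z) \<Longrightarrow>
      norm (F z - F z0 - D (z - z0)) \<le> C * (norm (z - z0))\<^sup>2"
    using ss[of z0] by blast
  show ?thesis
  proof (rule radial_semismooth_atI[OF C(1)])
    fix z l and \<sigma> :: real
    assume z: "norm (z - z0) < \<delta>" and \<sigma>: "\<sigma> \<in> {1, -1}" and l: "has_dirderiv F z (\<sigma> *\<^sub>R (z - z0)) l"
    show "norm (F z - F z0 - \<sigma> *\<^sub>R l) \<le> C * (norm (z - z0))\<^sup>2"
    proof (cases "z = z0")
      case True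
      then have "l = 0" using l has_dirderiv_unique has_dirderiv_scale[OF l, of 0] by simp
      then show ?thesis using True by simp
    next
      case False
      define R where "R = norm (z - z0)"
      have R: "R > 0" "R < \<delta>" using z False by (auto simp: R_def)
      obtain C' \<delta>' where C': "\<delta>' > 0" "\<And>w D. norm (w - z) < \<delta>' \<Longrightarrow> w \<noteq> z \<Longrightarrow> (F has_derivative blinfun_apply D) (at w) \<Longrightarrow>
        norm (F w - F z - D (w - z)) \<le> C' * (norm (w - z))\<^sup>2"
        using ss[of z] by blast
      \<comment> \<open>The estimate at \<open>z0\<close> is available for derivatives at points \<open>w\<close> near \<open>z\<close>; these
        derivatives approximate \<open>l\<close>, and \<open>w\<close> tends to \<open>z\<close> as \<open>\<eta>\<close> tends to \<open>0\<close>.\<close>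
      have main: "norm (F z - F z0 - \<sigma> *\<^sub>R l) \<le> C * (R + \<eta>)\<^sup>2 + (2 * L + 1) * \<eta>"
        if \<eta>: "0 < \<eta>" "\<eta> < min R (\<delta> - R)" for \<eta>
      proof -
        obtain w D where w: "dist w z < \<eta>" and D: "(F has_derivative blinfun_apply D) (at w)"
          and Dl: "norm (D (\<sigma> *\<^sub>R (z - z0)) - l) < \<eta>"
          using dirderiv_approx_by_derivative[OF open_UNIV UNIV_I Lip dd C' l \<eta>(1)] by blast
        have wz: "norm (w - z) < \<eta>" using w by (simp add: dist_norm)
        have wz0: "norm (w - z0) \<le> R + \<eta>"
          using norm_triangle_ineq[of "w - z" "z - z0"] wz by (simp add: R_def)
        have "w \<noteq> z0" using wz \<eta> by (auto simp: R_def norm_minus_commute)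
        moreover have "norm (w - z0) < \<delta>" using wz0 \<eta> norm_triangle_ineq[of "w - z" "z - z0"] wz
          by (simp add: R_def)
        ultimately have "norm (F w - F z0 - D (w - z0)) \<le> C * (norm (w - z0))\<^sup>2"
          using C(2)[OF _ _ D] by blast
        also have "\<dots> \<le> C * (R + \<eta>)\<^sup>2"
          using wz0 C0 by (intro mult_left_mono power_mono) auto
        finally have 1: "norm (F w - F z0 - D (w - z0)) \<le> C * (R + \<eta>)\<^sup>2" .
        have "norm (F z - F w) \<le> L * norm (z - w)"
          using lipschitz_on_normD[OF Lip UNIV_I UNIV_I] .
        also have "\<dots> \<le> L * \<eta>" using wz L0 by (intro mult_left_mono) (auto simp: norm_minus_commute)
        finally have 2: "norm (F z - F w) \<le> L * \<eta>" .
        have "norm (D (w - z)) \<le> L * norm (w - z)"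
          using has_dirderiv_norm_le[OF open_UNIV UNIV_I Lip has_derivative_imp_has_dirderiv[OF D]] .
        also have "\<dots> \<le> L * \<eta>" using wz L0 by (intro mult_left_mono) auto
        finally have 3: "norm (D (w - z)) \<le> L * \<eta>" .
        have "D (z - z0) - \<sigma> *\<^sub>R l = \<sigma> *\<^sub>R (D (\<sigma> *\<^sub>R (z - z0)) - l)"
          using \<sigma> by (auto simp: blinfun.bilinear_simps)
        then have 4: "norm (D (z - z0) - \<sigma> *\<^sub>R l) \<le> \<eta>" using \<sigma> Dl by auto
        have eq: "F z - F z0 - \<sigma> *\<^sub>R l
            = (F w - F z0 - D (w - z0)) + (F z - F w) + D (w - z) + (D (z - z0) - \<sigma> *\<^sub>R l)"
          by (simp add: blinfun.bilinear_simps)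
        have "norm (F z - F z0 - \<sigma> *\<^sub>R l) \<le> C * (R + \<eta>)\<^sup>2 + L * \<eta> + L * \<eta> + \<eta>"
          unfolding eq by (intro norm_triangle_mono 1 2 3 4)
        then show ?thesis by (simp add: algebra_simps)
      qed
      have "((\<lambda>\<eta>. C * (R + \<eta>)\<^sup>2 + (2 * L + 1) * \<eta>) \<longlongrightarrow>
          C * (R + 0)\<^sup>2 + (2 * L + 1) * 0) (at_right 0)"
        by (intro tendsto_intros)
      moreover have "\<forall>\<^sub>F \<eta> in at_right 0. \<eta> \<in> {0<..<min R (\<delta> - R)}"
        by (rule eventually_at_right_real) (use R in simp)
      then have "\<forall>\<^sub>F \<eta> in at_right 0. norm (F z - F z0 - \<sigma> *\<^sub>R l)
          \<le> C * (R + \<eta>)\<^sup>2 + (2 * L + 1) * \<eta>"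
        by eventually_elim (use main in auto)
      ultimately show ?thesis
        using tendsto_lowerbound[of _ _ "at_right 0"] by (fastforce simp: R_def)
    qed
  qed
qed

text \<open>The matrices satisfying the semismoothness estimate form a convex set, and by continuity
  it contains the limits of derivatives, hence the whole generalized Jacobian.\<close>

lemma radial_imp_strongly_semismooth_at:
  fixes G :: "'a::euclidean_space \<Rightarrow> 'b::euclidean_space"
  assumes U: "open U" "q \<in> U" and Lip: "locally_lipschitz_on U G"
    and dd: "directionally_differentiable_at G q" and rad: "radial_semismooth_at G q"
  shows "strongly_semismooth_at U G q"
proof -
  obtain C \<delta> where C: "C \<ge> 0" "\<delta> > 0" "\<And>z \<sigma> l. norm (z - q) < \<delta> \<Longrightarrow> \<sigma> \<in> {1, -1} \<Longrightarrow>
      has_dirderiv G z (\<sigma> *\<^sub>R (z - q)) l \<Longrightarrow> norm (G z - G q - \<sigma> *\<^sub>R l) \<le> C * (norm (z - q))\<^sup>2"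
    using rad unfolding radial_semismooth_at_def by blast
  obtain r where r: "r > 0" "ball q r \<subseteq> U" using U openE by blast
  have contU: "isCont G w" if w: "w \<in> U" for w
  proof -
    obtain e L where "e > 0" "L-lipschitz_on (ball w e \<inter> U) G"
      using Lip w unfolding locally_lipschitz_on_def by blast
    then have "continuous_on (ball w e \<inter> U) G" by (simp add: lipschitz_on_continuous_on)
    then show ?thesis using \<open>e > 0\<close> w U(1)
      by (simp add: continuous_on_eq_continuous_at open_Int)
  qed
  have "norm (G (q + d) - G q - V d) \<le> C * (norm d)\<^sup>2"
    if d: "norm d < min \<delta> r" and V: "V \<in> clarke_jacobian G (q + d)" for d V
  proof -
    define K where "K = {V. norm (G (q + d) - G q - blinfun_apply V d) \<le> C * (norm d)\<^sup>2}"
    have "q + d \<in> U" using d r by (auto simp: dist_norm)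
    have "convex K"
    proof (rule convexI)
      fix V W and u v :: real assume VW: "V \<in> K" "W \<in> K" "0 \<le> u" "0 \<le> v" "u + v = 1"
      have "u *\<^sub>R (G (q + d) - G q) + v *\<^sub>R (G (q + d) - G q) = G (q + d) - G q"
        using VW(5) by (metis scaleR_left_distrib scaleR_one)
      then have "G (q + d) - G q - (u *\<^sub>R V + v *\<^sub>R W) d
          = u *\<^sub>R (G (q + d) - G q - V d) + v *\<^sub>R (G (q + d) - G q - W d)"
        by (simp add: blinfun.bilinear_simps scaleR_diff_right algebra_simps)
      also have "norm \<dots> \<le> u * (C * (norm d)\<^sup>2) + v * (C * (norm d)\<^sup>2)"
        using VW by (intro norm_triangle_mono) (auto simp: K_def intro!: mult_left_mono)
      also have "\<dots> = C * (norm d)\<^sup>2" using VW(5) by (metis distrib_right mult_1)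
      finally show "u *\<^sub>R V + v *\<^sub>R W \<in> K" by (simp add: K_def)
    qed
    moreover have "V \<in> K" if X: "\<And>n. (G has_derivative blinfun_apply (D n)) (at (X n))"
      and lim: "X \<longlonglongrightarrow> q + d" "D \<longlonglongrightarrow> V" for X D V
    proof -
      have "((\<lambda>n. norm (X n - q)) \<longlonglongrightarrow> norm (q + d - q))" by (intro tendsto_intros lim)
      then have "\<forall>\<^sub>F n in sequentially. norm (X n - q) < \<delta>"
        using d by (intro order_tendstoD) auto
      then have ev: "\<forall>\<^sub>F n in sequentially. norm (G (X n) - G q - D n (X n - q)) \<le> C * (norm (X n - q))\<^sup>2"
      proof eventually_elim
        case (elim n)
        then show ?case using C(3)[of "X n" 1] has_derivative_imp_has_dirderiv[OF X] by simp
      qed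
      have G: "(\<lambda>n. G (X n)) \<longlonglongrightarrow> G (q + d)"
        using contU[OF \<open>q + d \<in> U\<close>] lim(1) by (rule isCont_tendsto_compose)
      have "norm (G (q + d) - G q - V (q + d - q)) \<le> C * (norm (q + d - q))\<^sup>2"
        by (rule tendsto_le[OF _ _ _ ev]) (intro tendsto_intros G lim | simp)+
      then show ?thesis by (simp add: K_def)
    qed
    then have "{V. \<exists>X D. (\<forall>k::nat. (G has_derivative blinfun_apply (D k)) (at (X k)))
            \<and> X \<longlonglongrightarrow> q + d \<and> D \<longlonglongrightarrow> V} \<subseteq> K" by blast
    ultimately have "clarke_jacobian G (q + d) \<subseteq> K"
      unfolding clarke_jacobian_def by (intro hull_minimal)
    then show ?thesis using V by (auto simp: K_def)
  qed
  then have "\<forall>\<^sub>F d in at 0. \<forall>V\<in>clarke_jacobian G (q + d). norm (G (q + d) - G q - V d) \<le> C * (norm d)\<^sup>2"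
    unfolding eventually_at using C(2) r(1) by (intro exI[of _ "min \<delta> r"]) (simp add: dist_norm)
  then show ?thesis using U Lip dd by (auto simp: strongly_semismooth_at_def)
qed

lemma radial_semismooth_at_add:
  assumes "open T" "q0 \<in> T" "\<And>q. q \<in> T \<Longrightarrow> directionally_differentiable_at F q"
    and "\<And>q. q \<in> T \<Longrightarrow> directionally_differentiable_at G q"
    and "radial_semismooth_at F q0" "radial_semismooth_at G q0"
  shows "radial_semismooth_at (\<lambda>q. F q + G q) q0"
proof -
  obtain r where r: "r > 0" "ball q0 r \<subseteq> T" using assms(1,2) openE by blast
  obtain C \<delta> where C: "\<delta> > 0" "\<And>z \<sigma> l. norm (z - q0) < \<delta> \<Longrightarrow> \<sigma> \<in> {1, -1} \<Longrightarrow>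
      has_dirderiv F z (\<sigma> *\<^sub>R (z - q0)) l \<Longrightarrow> norm (F z - F q0 - \<sigma> *\<^sub>R l) \<le> C * (norm (z - q0))\<^sup>2"
    using assms(5) unfolding radial_semismooth_at_def by blast
  obtain C' \<delta>' where C': "\<delta>' > 0" "\<And>z \<sigma> l. norm (z - q0) < \<delta>' \<Longrightarrow> \<sigma> \<in> {1, -1} \<Longrightarrow>
      has_dirderiv G z (\<sigma> *\<^sub>R (z - q0)) l \<Longrightarrow> norm (G z - G q0 - \<sigma> *\<^sub>R l) \<le> C' * (norm (z - q0))\<^sup>2"
    using assms(6) unfolding radial_semismooth_at_def by blast
  show ?thesis
  proof (rule radial_semismooth_atI)
    show "min r (min \<delta> \<delta>') > 0" using r C C' by simp
    fix q l and \<sigma> :: real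
    assume q: "norm (q - q0) < min r (min \<delta> \<delta>')" and \<sigma>: "\<sigma> \<in> {1, -1}"
      and l: "has_dirderiv (\<lambda>q. F q + G q) q (\<sigma> *\<^sub>R (q - q0)) l"
    have "q \<in> T" using q r by (auto simp: dist_norm norm_minus_commute)
    then obtain a b where ab: "has_dirderiv F q (\<sigma> *\<^sub>R (q - q0)) a" "has_dirderiv G q (\<sigma> *\<^sub>R (q - q0)) b"
      using assms(3,4) unfolding directionally_differentiable_iff by blast
    then have "l = a + b" using has_dirderiv_unique[OF l has_dirderiv_add] by blast
    then show "norm (F q + G q - (F q0 + G q0) - \<sigma> *\<^sub>R l) \<le> (C + C') * (norm (q - q0))\<^sup>2"
      using norm_triangle_mono[OF C(2)[OF _ \<sigma> ab(1)] C'(2)[OF _ \<sigma> ab(2)]] q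
      by (simp add: algebra_simps)
  qed
qed

lemma directionally_differentiable_compose:
  assumes "open S" "\<gamma> q \<in> S" "L-lipschitz_on S F"
    and "directionally_differentiable_at F (\<gamma> q)" "directionally_differentiable_at \<gamma> q"
  shows "directionally_differentiable_at (\<lambda>q. F (\<gamma> q)) q"
  using assms(4,5) has_dirderiv_compose[where \<gamma> = \<gamma>, OF assms(1-3)]
  unfolding directionally_differentiable_iff by meson

lemma radial_semismooth_at_compose:
  assumes S: "open S" "\<gamma> q0 \<in> S" "L-lipschitz_on S F" "\<And>z. z \<in> S \<Longrightarrow> directionally_differentiable_at F z"
    and F: "radial_semismooth_at F (\<gamma> q0)"
    and T: "open T" "q0 \<in> T" "N-lipschitz_on T \<gamma>" "\<And>q. q \<in> T \<Longrightarrow> directionally_differentiable_at \<gamma> q"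
    and \<gamma>: "radial_semismooth_at \<gamma> q0"
  shows "radial_semismooth_at (\<lambda>q. F (\<gamma> q)) q0"
proof -
  have L0: "L \<ge> 0" and N0: "N \<ge> 0" using S T lipschitz_on_nonneg by blast+
  obtain C \<delta> where C: "C \<ge> 0" "\<delta> > 0" "\<And>z \<sigma> l. norm (z - \<gamma> q0) < \<delta> \<Longrightarrow> \<sigma> \<in> {1, -1} \<Longrightarrow>
      has_dirderiv F z (\<sigma> *\<^sub>R (z - \<gamma> q0)) l \<Longrightarrow> norm (F z - F (\<gamma> q0) - \<sigma> *\<^sub>R l) \<le> C * (norm (z - \<gamma> q0))\<^sup>2"
    using F unfolding radial_semismooth_at_def by blast
  obtain C' \<delta>' where C': "\<delta>' > 0" "\<And>z \<sigma> l. norm (z - q0) < \<delta>' \<Longrightarrow> \<sigma> \<in> {1, -1} \<Longrightarrow>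
      has_dirderiv \<gamma> z (\<sigma> *\<^sub>R (z - q0)) l \<Longrightarrow> norm (\<gamma> z - \<gamma> q0 - \<sigma> *\<^sub>R l) \<le> C' * (norm (z - q0))\<^sup>2"
    using \<gamma> unfolding radial_semismooth_at_def by blast
  obtain s where s: "s > 0" "ball (\<gamma> q0) s \<subseteq> S" using S openE by blast
  obtain r where r: "r > 0" "ball q0 r \<subseteq> T" using T openE by blast
  define \<rho> where "\<rho> = Min {r, \<delta>', s / (N + 1), \<delta> / (N + 1)}"
  show ?thesis
  proof (rule radial_semismooth_atI)
    show "\<rho> > 0" using r s C C' N0 by (simp add: \<rho>_def)
    fix q l and \<sigma> :: real
    assume q: "norm (q - q0) < \<rho>" and \<sigma>: "\<sigma> \<in> {1, -1}"
      and l: "has_dirderiv (\<lambda>q. F (\<gamma> q)) q (\<sigma> *\<^sub>R (q - q0)) l"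
    define R where "R = norm (q - q0)"
    have qT: "q \<in> T" using q r by (auto simp: dist_norm norm_minus_commute \<rho>_def)
    have g: "norm (\<gamma> q - \<gamma> q0) \<le> N * R"
      using lipschitz_on_normD[OF T(3) qT T(2)] by (simp add: R_def)
    also have "\<dots> \<le> (N + 1) * R" by (simp add: R_def distrib_right)
    finally have g': "norm (\<gamma> q - \<gamma> q0) \<le> (N + 1) * R" .
    have "(N + 1) * R < s" "(N + 1) * R < \<delta>" using q N0 by (auto simp: \<rho>_def R_def field_simps)
    then have g2: "norm (\<gamma> q - \<gamma> q0) < \<delta>" "norm (\<gamma> q - \<gamma> q0) < s" using g' by auto
    then have gS: "\<gamma> q \<in> S" using s by (auto simp: dist_norm norm_minus_commute)
    obtain m where m: "has_dirderiv \<gamma> q (\<sigma> *\<^sub>R (q - q0)) m"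
      using T(4)[OF qT] unfolding directionally_differentiable_iff by blast
    obtain a b where a: "has_dirderiv F (\<gamma> q) (\<sigma> *\<^sub>R (\<gamma> q - \<gamma> q0)) a" and b: "has_dirderiv F (\<gamma> q) m b"
      using S(4)[OF gS] unfolding directionally_differentiable_iff by blast
    have "l = b"
      using has_dirderiv_compose[where \<gamma> = \<gamma>, OF S(1) gS S(3) b m] l has_dirderiv_unique by blast
    have "\<sigma> *\<^sub>R m - (\<gamma> q - \<gamma> q0) = \<sigma> *\<^sub>R (m - \<sigma> *\<^sub>R (\<gamma> q - \<gamma> q0))"
      using \<sigma> by (auto simp: algebra_simps)
    then have "norm (m - \<sigma> *\<^sub>R (\<gamma> q - \<gamma> q0)) = norm (\<gamma> q - \<gamma> q0 - \<sigma> *\<^sub>R m)"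
      using \<sigma> by (auto simp: norm_minus_commute)
    also have "\<dots> \<le> C' * R\<^sup>2" using C'(2)[OF _ \<sigma> m] q by (simp add: \<rho>_def R_def)
    finally have "L * norm (m - \<sigma> *\<^sub>R (\<gamma> q - \<gamma> q0)) \<le> L * (C' * R\<^sup>2)" using L0 by (rule mult_left_mono)
    then have 1: "norm (b - a) \<le> L * C' * R\<^sup>2"
      using has_dirderiv_diff_le[OF S(1) gS S(3) b a] by simp
    have "norm (F (\<gamma> q) - F (\<gamma> q0) - \<sigma> *\<^sub>R a) \<le> C * (norm (\<gamma> q - \<gamma> q0))\<^sup>2"
      using C(3)[OF g2(1) \<sigma> a] .
    also have "\<dots> \<le> C * (N * R)\<^sup>2" using g C(1) by (intro mult_left_mono power_mono) auto
    finally have 2: "norm (F (\<gamma> q) - F (\<gamma> q0) - \<sigma> *\<^sub>R a) \<le> C * N\<^sup>2 * R\<^sup>2" by (simp add: power_mult_distrib)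
    have "norm (\<sigma> *\<^sub>R a - \<sigma> *\<^sub>R b) = norm (b - a)" using \<sigma> by (auto simp: norm_minus_commute)
    then have "norm (\<sigma> *\<^sub>R a - \<sigma> *\<^sub>R b) \<le> L * C' * R\<^sup>2" using 1 by simp
    from norm_triangle_mono[OF 2 this]
    show "norm (F (\<gamma> q) - F (\<gamma> q0) - \<sigma> *\<^sub>R l) \<le> (C * N\<^sup>2 + L * C') * (norm (q - q0))\<^sup>2"
      by (simp add: \<open>l = b\<close> R_def algebra_simps)
  qed
qed


section \<open>Nondegenerate generalized Jacobians\<close>

text \<open>The limits of derivatives at points tending to \<open>x\<close>; their convex hull is the Clarke
  generalized Jacobian.\<close>

definition limiting_jacobian ::
    "('a::euclidean_space \<Rightarrow> 'b::euclidean_space) \<Rightarrow> 'a \<Rightarrow> ('a \<Rightarrow>\<^sub>L 'b) set"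
  where "limiting_jacobian F x =
    {V. \<exists>X D. (\<forall>k::nat. (F has_derivative blinfun_apply (D k)) (at (X k)))
            \<and> X \<longlonglongrightarrow> x \<and> D \<longlonglongrightarrow> V}"

lemma limiting_jacobian_iff:
  "V \<in> limiting_jacobian F x \<longleftrightarrow>
    (\<forall>e>0. \<exists>z D. (F has_derivative blinfun_apply D) (at z) \<and> dist z x < e \<and> dist D V < e)"
proof
  assume "V \<in> limiting_jacobian F x"
  then obtain X D where X: "\<And>k. (F has_derivative blinfun_apply (D k)) (at (X k))"
    "X \<longlonglongrightarrow> x" "D \<longlonglongrightarrow> V"
    by (auto simp: limiting_jacobian_def)
  show "\<forall>e>0. \<exists>z D. (F has_derivative blinfun_apply D) (at z) \<and> dist z x < e \<and> dist D V < e"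
  proof (intro allI impI)
    fix e :: real assume "e > 0"
    have "\<forall>\<^sub>F k in sequentially. dist (X k) x < e \<and> dist (D k) V < e"
      using tendstoD[OF X(2) \<open>e > 0\<close>] tendstoD[OF X(3) \<open>e > 0\<close>] by (rule eventually_conj)
    then obtain k where "dist (X k) x < e \<and> dist (D k) V < e"
      using eventually_happens'[OF sequentially_bot] by blast
    then show "\<exists>z D. (F has_derivative blinfun_apply D) (at z) \<and> dist z x < e \<and> dist D V < e"
      using X(1) by blast
  qed
next
  assume *: "\<forall>e>0. \<exists>z D. (F has_derivative blinfun_apply D) (at z) \<and> dist z x < e \<and> dist D V < e"
  have "\<forall>n. \<exists>z D. (F has_derivative blinfun_apply D) (at z) \<and> dist z x < 1 / real (Suc n)
      \<and> dist D V < 1 / real (Suc n)"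
    using * by simp
  then obtain X D where X: "\<And>n. (F has_derivative blinfun_apply (D n)) (at (X n))"
    "\<And>n. dist (X n) x < 1 / real (Suc n)" "\<And>n. dist (D n) V < 1 / real (Suc n)"
    by metis
  have z: "(\<lambda>n. 1 / real (Suc n)) \<longlonglongrightarrow> 0" by (rule lim_const_over_n[THEN LIMSEQ_Suc])
  have "X \<longlonglongrightarrow> x"
    by (rule metric_tendsto_imp_tendsto[OF z]) (use X(2) in \<open>simp add: less_imp_le\<close>)
  moreover have "D \<longlonglongrightarrow> V"
    by (rule metric_tendsto_imp_tendsto[OF z]) (use X(3) in \<open>simp add: less_imp_le\<close>)
  ultimately show "V \<in> limiting_jacobian F x" using X(1) by (auto simp: limiting_jacobian_def)
qed

lemma norm_derivative_le_lipschitz: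
  assumes "open U" "z \<in> U" "L-lipschitz_on U F" "(F has_derivative blinfun_apply D) (at z)"
  shows "norm D \<le> L"
  using has_dirderiv_norm_le[OF assms(1-3) has_derivative_imp_has_dirderiv[OF assms(4)]]
    lipschitz_on_nonneg[OF assms(3)] by (intro norm_blinfun_bound) auto

lemma compact_limiting_jacobian:
  assumes "open U" "q \<in> U" "L-lipschitz_on U F"
  shows "compact (limiting_jacobian F q)"
proof -
  obtain r where r: "r > 0" "ball q r \<subseteq> U" using assms openE by blast
  have "norm V \<le> L" if V: "V \<in> limiting_jacobian F q" for V
  proof (rule field_le_epsilon)
    fix e :: real assume "e > 0"
    then obtain z D where z: "(F has_derivative blinfun_apply D) (at z)" "dist z q < min e r" "dist D V < min e r"
      using V r(1) unfolding limiting_jacobian_iff by (meson min_less_iff_conj)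
    then have "norm D \<le> L"
      using r(2) by (intro norm_derivative_le_lipschitz[OF assms(1) _ assms(3)]) (auto simp: dist_commute)
    then show "norm V \<le> L + e"
      using z(3) norm_triangle_ineq[of D "V - D"] by (simp add: dist_norm norm_minus_commute)
  qed
  then have "bounded (limiting_jacobian F q)" by (rule boundedI)
  moreover have "closed (limiting_jacobian F q)"
    unfolding closed_limpt islimpt_approachable
  proof (intro allI impI)
    fix V assume *: "\<forall>e>0. \<exists>V'\<in>limiting_jacobian F q. V' \<noteq> V \<and> dist V' V < e"
    show "V \<in> limiting_jacobian F q"
      unfolding limiting_jacobian_iff
    proof (intro allI impI)
      fix e :: real assume "e > 0"
      then obtain V' where V': "V' \<in> limiting_jacobian F q" "dist V' V < e / 2"
        using * by (meson half_gt_zero)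
      then obtain z D where "(F has_derivative blinfun_apply D) (at z)" "dist z q < e / 2" "dist D V' < e / 2"
        using \<open>e > 0\<close> unfolding limiting_jacobian_iff by (meson half_gt_zero)
      moreover from this have "dist D V < e"
        using V'(2) dist_triangle[of D V V'] by simp
      ultimately show "\<exists>z D. (F has_derivative blinfun_apply D) (at z) \<and> dist z q < e \<and> dist D V < e"
        using \<open>e > 0\<close> by (intro exI[of _ z] exI[of _ D]) auto
    qed
  qed
  ultimately show ?thesis by (simp add: compact_eq_bounded_closed)
qed

lemma derivatives_near_limiting_jacobian:
  assumes U: "open U" "q \<in> U" "L-lipschitz_on U F" and "e > 0"
  shows "\<exists>r>0. \<forall>z D. dist z q < r \<longrightarrow> (F has_derivative blinfun_apply D) (at z) \<longrightarrow>
    (\<exists>V\<in>limiting_jacobian F q. dist D V < e)"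
proof (rule ccontr)
  assume neg: "\<not> ?thesis"
  obtain r where r: "r > 0" "ball q r \<subseteq> U" using U openE by blast
  have "\<forall>n. \<exists>z D. dist z q < r / real (Suc n) \<and> (F has_derivative blinfun_apply D) (at z) \<and>
    (\<forall>V\<in>limiting_jacobian F q. \<not> dist D V < e)"
    using neg r(1) by (metis divide_pos_pos of_nat_0_less_iff zero_less_Suc)
  then obtain X D where X: "\<And>n. dist (X n) q < r / real (Suc n)"
    "\<And>n. (F has_derivative blinfun_apply (D n)) (at (X n))"
    "\<And>n V. V \<in> limiting_jacobian F q \<Longrightarrow> \<not> dist (D n) V < e"
    by metis
  have z: "(\<lambda>n. r / real (Suc n)) \<longlonglongrightarrow> 0" by (rule lim_const_over_n[THEN LIMSEQ_Suc])
  have Xq: "X \<longlonglongrightarrow> q"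
    by (rule metric_tendsto_imp_tendsto[OF z]) (use X(1) r(1) in \<open>simp add: less_imp_le\<close>)
  have "norm (D n) \<le> L" for n
  proof (rule norm_derivative_le_lipschitz[OF U(1) _ U(3) X(2)])
    have "r / real (Suc n) \<le> r" using r(1) by (simp add: field_simps)
    then show "X n \<in> U" using X(1)[of n] r(2) by (auto simp: dist_commute)
  qed
  then have "bounded (range D)" by (auto intro!: boundedI)
  then obtain V s where s: "strict_mono s" "(D \<circ> s) \<longlonglongrightarrow> V"
    using bounded_imp_convergent_subsequence by blast
  have "V \<in> limiting_jacobian F q"
    unfolding limiting_jacobian_def
    using X(2) LIMSEQ_subseq_LIMSEQ[OF Xq s(1)] s(2)
    by (auto intro!: exI[of _ "X \<circ> s"] exI[of _ "D \<circ> s"])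
  then have "\<not> dist ((D \<circ> s) n) V < e" for n using X(3) by simp
  moreover have "\<forall>\<^sub>F n in sequentially. dist ((D \<circ> s) n) V < e" using s(2) \<open>e > 0\<close> by (rule tendstoD)
  ultimately show False by simp
qed

text \<open>The matrix of the partial derivative with respect to the first component, as a matrix so
  that compactness of convex hulls is available.\<close>

definition fst_block :: "(((real^'n) \<times> real) \<Rightarrow>\<^sub>L (real^'n)) \<Rightarrow> real^'n^'n"
  where "fst_block V = matrix (\<lambda>x. blinfun_apply V (x, 0))"

lemma fst_block_mult: "fst_block V *v h = blinfun_apply V (h, 0)"
proof -
  have "linear (\<lambda>x. blinfun_apply V (x, 0))"
    by (rule linearI) (simp_all flip: blinfun.add_right blinfun.scaleR_right)
  then show ?thesis unfolding fst_block_def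
    using matrix_works[of "\<lambda>x. blinfun_apply V (x, 0)" h] by (simp add: linear_matrix_vector_mul_eq)
qed

lemma linear_fst_block: "linear fst_block"
  by (rule linearI) (simp_all add: fst_block_def matrix_def vec_eq_iff blinfun.bilinear_simps)

lemma continuous_on_fst_block: "continuous_on S fst_block"
  unfolding fst_block_def matrix_def by (intro continuous_intros)

lemma fst_block_in_clarke_jacobian_fst:
  assumes "V \<in> clarke_jacobian H q"
  shows "fst_block V \<in> clarke_jacobian_fst H q"
proof -
  have "blinfun_apply V (h, t) = fst_block V *v h + t *\<^sub>R blinfun_apply V (0, 1)" for h t
    unfolding fst_block_mult by (simp flip: blinfun.add_right blinfun.scaleR_right)
  then show ?thesis using assms unfolding clarke_jacobian_fst_def by blast
qed

text \<open>
  For \<open>h = x' - x\<close>, the vectors \<open>M h\<close> with \<open>M\<close> in the convex compact set of partial Jacobians at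
  \<open>q0\<close> stay away from the origin, so a unit vector \<open>e\<close> satisfies \<open>e \<bullet> M h \<ge> 2 c \<parallel>h\<parallel>\<close> for all of
  them. Derivatives near \<open>q0\<close>, and therefore directional derivatives near \<open>q0\<close>, satisfy this
  with \<open>c\<close> in place of \<open>2 c\<close>; integrate along the segment from \<open>(x, l)\<close> to \<open>(x', l)\<close>.
\<close>

lemma nondegenerate_imp_partially_injective:
  fixes H :: "(real^'n) \<times> real \<Rightarrow> real^'n"
  assumes U: "open U" "q0 \<in> U" and Lip: "L-lipschitz_on U H"
    and dd: "\<And>q. q \<in> U \<Longrightarrow> directionally_differentiable_at H q"
    and rad: "\<And>q. q \<in> U \<Longrightarrow> radial_semismooth_at H q"
    and nd: "nondegenerate (clarke_jacobian_fst H q0)"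
  shows "\<exists>c>0. \<exists>r>0. ball q0 r \<subseteq> U \<and> (\<forall>x x' l. (x, l) \<in> ball q0 r \<longrightarrow> (x', l) \<in> ball q0 r \<longrightarrow>
    c * norm (x - x') \<le> norm (H (x, l) - H (x', l)))"
proof -
  have approx: "\<exists>z\<in>U. \<exists>D. dist z q < e \<and> (H has_derivative blinfun_apply D) (at z) \<and> norm (D k - l) < e"
    if q: "q \<in> U" and l: "has_dirderiv H q k l" and "e > 0" for q k l e
  proof -
    obtain C \<delta> where C: "C \<ge> 0" "\<delta> > 0" "\<And>z \<sigma> l. norm (z - q) < \<delta> \<Longrightarrow> \<sigma> \<in> {1, -1} \<Longrightarrow>
      has_dirderiv H z (\<sigma> *\<^sub>R (z - q)) l \<Longrightarrow> norm (H z - H q - \<sigma> *\<^sub>R l) \<le> C * (norm (z - q))\<^sup>2"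
      using rad[OF q] unfolding radial_semismooth_at_def by blast
    show ?thesis
    proof (rule dirderiv_approx_by_derivative[OF U(1) q Lip dd C(2) _ l \<open>e > 0\<close>])
      fix z D assume "norm (z - q) < \<delta>" "(H has_derivative blinfun_apply D) (at z)"
      then show "norm (H z - H q - D (z - q)) \<le> C * (norm (z - q))\<^sup>2"
        using C(3)[of z 1] has_derivative_imp_has_dirderiv[of H "blinfun_apply D" z] by simp
    qed
  qed
  define S where "S = limiting_jacobian H q0"
  have "compact S" unfolding S_def by (rule compact_limiting_jacobian[OF U Lip])
  have cj: "clarke_jacobian H q0 = convex hull S"
    by (simp add: S_def clarke_jacobian_def limiting_jacobian_def)
  define K where "K = fst_block ` (convex hull S)"
  have "K = convex hull (fst_block ` S)"
    unfolding K_def by (rule convex_hull_linear_image[OF linear_fst_block])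
  then have K: "compact K" "convex K"
    using \<open>compact S\<close> by (auto intro!: compact_convex_hull compact_continuous_image continuous_on_fst_block)
  have "S \<noteq> {}"
  proof -
    obtain r where r: "r > 0" "\<And>z D. dist z q0 < r \<Longrightarrow> (H has_derivative blinfun_apply D) (at z) \<Longrightarrow>
        \<exists>V\<in>limiting_jacobian H q0. dist D V < 1"
      using derivatives_near_limiting_jacobian[OF U Lip, of 1] by auto
    have "has_dirderiv H q0 0 0" by (simp add: has_dirderiv_def)
    from approx[OF U(2) this r(1)] show ?thesis using r(2) unfolding S_def by blast
  qed
  then have "K \<noteq> {}" by (simp add: K_def)
  have inv: "invertible M" if "M \<in> K" for M
    using that nd fst_block_in_clarke_jacobian_fst unfolding nondegenerate_def K_def cj[symmetric] by blast
  \<comment> \<open>The matrices of the compact set \<open>K\<close> are uniformly invertible.\<close>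
  obtain c where c: "c > 0" "\<And>M h. M \<in> K \<Longrightarrow> 2 * c * norm h \<le> norm (M *v h)"
  proof -
    have "continuous_on (K \<times> sphere 0 1) (\<lambda>(M, h). norm (M *v h :: real^'n))"
      unfolding matrix_vector_mult_def case_prod_unfold by (intro continuous_intros)
    moreover have "compact (K \<times> sphere (0::real^'n) 1)" using K(1) by (intro compact_Times) auto
    moreover have "axis undefined 1 \<in> sphere (0::real^'n) 1" by (simp add: norm_axis_1)
    then have "K \<times> sphere (0::real^'n) 1 \<noteq> {}" using \<open>K \<noteq> {}\<close> by blast
    ultimately obtain M0 h0 where M0: "M0 \<in> K" "norm h0 = 1"
      "\<And>M h::real^'n. M \<in> K \<Longrightarrow> norm h = 1 \<Longrightarrow> norm (M0 *v h0) \<le> norm (M *v h)"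
      using continuous_attains_inf[of "K \<times> sphere (0::real^'n) 1" "\<lambda>(M, h). norm (M *v h)"] by force
    have "M0 *v h0 \<noteq> 0"
    proof
      assume "M0 *v h0 = 0"
      then have "h0 = 0" using inv[OF M0(1)]
        by (metis invertible_def matrix_vector_mul_assoc matrix_vector_mul_lid matrix_vector_mult_0_right)
      then show False using M0(2) by simp
    qed
    then have pos: "norm (M0 *v h0) / 2 > 0" by simp
    have "2 * (norm (M0 *v h0) / 2) * norm h \<le> norm (M *v h)" if "M \<in> K" for M h
    proof (cases "h = 0")
      case False
      have "norm (M0 *v h0) \<le> norm (M *v (h /\<^sub>R norm h))" using M0(3)[OF that] False by simp
      also have "\<dots> = norm (M *v h) / norm h"
        by (simp add: matrix_vector_mult_scaleR divide_inverse_commute)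
      finally show ?thesis using False by (simp add: pos_le_divide_eq)
    qed simp
    then show thesis using that pos by blast
  qed
  obtain r1 where r1: "r1 > 0" "\<And>z D. dist z q0 < r1 \<Longrightarrow> (H has_derivative blinfun_apply D) (at z) \<Longrightarrow>
      \<exists>V\<in>S. dist D V < c"
    using derivatives_near_limiting_jacobian[OF U Lip c(1)] unfolding S_def by blast
  obtain r2 where r2: "r2 > 0" "ball q0 r2 \<subseteq> U" using U openE by blast
  define r where "r = min r1 r2"
  have r: "r > 0" "ball q0 r \<subseteq> U" using r1 r2 by (auto simp: r_def)
  have "c * norm (x - x') \<le> norm (H (x, l) - H (x', l))"
    if x: "(x, l) \<in> ball q0 r" "(x', l) \<in> ball q0 r" for x x' l
  proof (cases "x = x'")
    case False
    define h where "h = x' - x"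
    have h: "norm h > 0" using False by (simp add: h_def)
    \<comment> \<open>A direction \<open>e\<close> along which every \<open>M h\<close>, \<open>M \<in> K\<close>, has a component of at least \<open>2 c\<close>.\<close>
    define W where "W = (\<lambda>M. M *v h) ` K"
    have lin: "linear (\<lambda>M::real^'n^'n. M *v h)"
      by (rule linearI) (simp_all add: matrix_vector_mult_add_rdistrib scaleR_matrix_vector_assoc)
    have W: "convex W" "closed W" "W \<noteq> {}"
    proof -
      show "convex W" unfolding W_def by (rule convex_linear_image[OF lin K(2)])
      have "compact W" unfolding W_def
        by (intro compact_continuous_image K linear_continuous_on)
          (use lin in \<open>simp add: linear_conv_bounded_linear\<close>)
      then show "closed W" by (rule compact_imp_closed)
      show "W \<noteq> {}" using \<open>K \<noteq> {}\<close> by (simp add: W_def)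
    qed
    define w where "w = closest_point W 0"
    have "w \<in> W" using W by (simp add: w_def closest_point_in_set)
    then have wn: "2 * c * norm h \<le> norm w" using c(2) by (auto simp: W_def)
    then have "norm w > 0" using mult_pos_pos[OF c(1) h] by linarith
    have wm: "norm w * norm w \<le> w \<bullet> m" if "m \<in> W" for m
    proof -
      have "(0 - w) \<bullet> (m - w) \<le> 0" unfolding w_def by (rule closest_point_dot[OF W(1,2) that])
      then show ?thesis by (simp add: inner_diff_right dot_square_norm power2_eq_square)
    qed
    define e where "e = w /\<^sub>R norm w"
    have e: "norm e = 1" using \<open>norm w > 0\<close> by (simp add: e_def)
    have em: "2 * c * norm h \<le> e \<bullet> m" if "m \<in> W" for m
    proof -
      have "norm w \<le> e \<bullet> m"
        using wm[OF that] \<open>norm w > 0\<close> by (simp add: e_def divide_inverse_commute[symmetric] pos_le_divide_eq)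
      then show ?thesis using wn by simp
    qed
    have xh: "(x, l) + (h, 0) = (x', l)" by (simp add: h_def)
    have seg: "closed_segment (x, l) ((x, l) + (h, 0)) \<subseteq> ball q0 r"
      unfolding xh using x by (rule closed_segment_subset) simp
    have "c * norm h \<le> e \<bullet> (H ((x, l) + (h, 0)) - H (x, l))"
    proof (rule dirderiv_mean_value_ge)
      show "continuous_on (closed_segment (x, l) ((x, l) + (h, 0))) H"
        using seg r(2) by (intro continuous_on_subset[OF lipschitz_on_continuous_on[OF Lip]]) blast
      fix v assume "v \<in> closed_segment (x, l) ((x, l) + (h, 0))"
      then have v: "dist v q0 < r" "v \<in> U" using seg r(2) by (auto simp: dist_commute)
      then obtain b where b: "has_dirderiv H v (h, 0) b"
        using dd unfolding directionally_differentiable_iff by blast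
      have "c * norm h \<le> e \<bullet> b"
      proof (rule field_le_epsilon)
        fix \<eta> :: real assume "\<eta> > 0"
        define \<eta>' where "\<eta>' = min \<eta> (r - dist v q0)"
        have "\<eta>' > 0" using \<open>\<eta> > 0\<close> v by (simp add: \<eta>'_def)
        from approx[OF v(2) b this] obtain z D where z: "dist z v < \<eta>'"
          "(H has_derivative blinfun_apply D) (at z)" "norm (D (h, 0) - b) < \<eta>'" by blast
        have "\<eta>' \<le> r - dist v q0" "r \<le> r1" by (simp_all add: \<eta>'_def r_def)
        then have "dist z q0 < r1" using z(1) dist_triangle[of z q0 v] by linarith
        then obtain V where V: "V \<in> S" "dist D V < c" using r1(2) z(2) by blast
        have "fst_block V *v h \<in> W" using V(1) by (auto simp: W_def K_def intro!: imageI hull_inc)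
        then have 1: "2 * c * norm h \<le> e \<bullet> V (h, 0)" using em by (simp add: fst_block_mult)
        have "\<bar>e \<bullet> (V (h, 0) - D (h, 0))\<bar> \<le> norm e * norm ((V - D) (h, 0))"
          unfolding blinfun.diff_left[symmetric] by (rule Cauchy_Schwarz_ineq2)
        also have "\<dots> \<le> norm (V - D) * norm (h, 0::real)"           unfolding e using norm_blinfun[of "V - D" "(h, 0)"] by simp
        also have "\<dots> \<le> c * norm h"
          using V(2) by (simp add: norm_Pair dist_norm norm_minus_commute mult_right_mono)
        finally have 2: "\<bar>e \<bullet> (V (h, 0) - D (h, 0))\<bar> \<le> c * norm h" .
        have "\<bar>e \<bullet> (D (h, 0) - b)\<bar> \<le> norm e * norm (D (h, 0) - b)" by (rule Cauchy_Schwarz_ineq2)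
        then have "\<bar>e \<bullet> (D (h, 0) - b)\<bar> \<le> \<eta>" using z(3) by (simp add: e \<eta>'_def)
        then show "c * norm h \<le> e \<bullet> b + \<eta>" using 1 2 by (simp add: inner_diff_right)
      qed
      then show "\<exists>b. has_dirderiv H v (h, 0) b \<and> c * norm h \<le> e \<bullet> b" using b by blast
    qed
    also have "\<dots> \<le> norm e * norm (H (x', l) - H (x, l))" unfolding xh by (rule norm_cauchy_schwarz)
    finally show ?thesis by (simp add: e h_def norm_minus_commute)
  qed simp
  then show ?thesis using c(1) r by blast
qed

section \<open>Implicit functions of one real variable\<close>

lemma partially_injective_dirderiv:
  fixes H :: "'a::real_normed_vector \<times> real \<Rightarrow> 'b::real_normed_vector"
  assumes U: "open U" "(x, l) \<in> U"
    and inj: "\<And>x x' l. (x, l) \<in> U \<Longrightarrow> (x', l) \<in> U \<Longrightarrow> c * norm (x - x') \<le> norm (H (x, l) - H (x', l))"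
    and m: "has_dirderiv H (x, l) (a, \<kappa>) m" and m': "has_dirderiv H (x, l) (a', \<kappa>) m'"
  shows "c * norm (a - a') \<le> norm (m - m')"
proof -
  from eventually_ray_in_open[OF U, of "(a, \<kappa>)"] eventually_ray_in_open[OF U, of "(a', \<kappa>)"]
  have ev: "\<forall>\<^sub>F t in at_right 0. c * norm (a - a')
      \<le> norm ((H ((x, l) + t *\<^sub>R (a, \<kappa>)) - H (x, l)) /\<^sub>R t - (H ((x, l) + t *\<^sub>R (a', \<kappa>)) - H (x, l)) /\<^sub>R t)"
    using eventually_at_right_less[of "0::real"]
  proof eventually_elim
    case (elim t)
    have "c * norm (t *\<^sub>R (a - a')) \<le> norm (H ((x, l) + t *\<^sub>R (a, \<kappa>)) - H ((x, l) + t *\<^sub>R (a', \<kappa>)))"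
      using inj[of "x + t *\<^sub>R a" "l + t * \<kappa>" "x + t *\<^sub>R a'"] elim by (simp add: scaleR_diff_right)
    moreover have "(H ((x, l) + t *\<^sub>R (a, \<kappa>)) - H (x, l)) /\<^sub>R t - (H ((x, l) + t *\<^sub>R (a', \<kappa>)) - H (x, l)) /\<^sub>R t
        = (H ((x, l) + t *\<^sub>R (a, \<kappa>)) - H ((x, l) + t *\<^sub>R (a', \<kappa>))) /\<^sub>R t"
      by (simp add: algebra_simps)
    ultimately show ?case using elim(3)
      by (simp add: divide_inverse_commute[symmetric] pos_le_divide_eq ac_simps)
  qed
  show ?thesis
    by (rule tendsto_lowerbound[OF tendsto_norm[OF tendsto_diff[OF
          m[unfolded has_dirderiv_def] m'[unfolded has_dirderiv_def]]] ev]) simp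
qed

text \<open>A selection \<open>X\<close> of zeros of a Lipschitz, directionally differentiable map that is uniformly
  injective in its first argument.\<close>

context
  fixes H :: "'a::euclidean_space \<times> real \<Rightarrow> 'b::euclidean_space" and X :: "real \<Rightarrow> 'a"
    and U :: "('a \<times> real) set" and L c \<rho> l0 :: real
  assumes U: "open U" and Lip: "L-lipschitz_on U H"
    and dd: "\<And>q. q \<in> U \<Longrightarrow> directionally_differentiable_at H q"
    and c: "c > 0"
    and inj: "\<And>x x' l. (x, l) \<in> U \<Longrightarrow> (x', l) \<in> U \<Longrightarrow> c * norm (x - x') \<le> norm (H (x, l) - H (x', l))"
    and X: "\<And>l l'. l \<in> ball l0 \<rho> \<Longrightarrow> l' \<in> ball l0 \<rho> \<Longrightarrow> (X l, l') \<in> U"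
    and HX: "\<And>l. l \<in> ball l0 \<rho> \<Longrightarrow> H (X l, l) = 0"
begin

lemma implicit_function_lipschitz: "(L / c)-lipschitz_on (ball l0 \<rho>) X"
proof (rule lipschitz_onI)
  show "L / c \<ge> 0" using c lipschitz_on_nonneg[OF Lip] by simp
  fix l l' assume l: "l \<in> ball l0 \<rho>" "l' \<in> ball l0 \<rho>"
  have "c * norm (X l - X l') \<le> norm (H (X l, l') - H (X l', l'))" using X l by (intro inj) auto
  also have "\<dots> = norm (H (X l, l') - H (X l, l))" using HX l by simp
  also have "\<dots> \<le> L * norm ((X l, l') - (X l, l))" using X l by (intro lipschitz_on_normD[OF Lip]) auto
  also have "\<dots> = L * \<bar>l - l'\<bar>" by (simp add: norm_Pair abs_minus_commute)
  finally show "dist (X l) (X l') \<le> L / c * dist l l'"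
    using c by (simp add: dist_norm pos_le_divide_eq mult.commute)
qed

lemma implicit_function_dirderiv:
  assumes l: "l \<in> ball l0 \<rho>" and \<xi>: "has_dirderiv X l \<kappa> \<xi>"
  shows "has_dirderiv H (X l, l) (\<xi>, \<kappa>) 0"
proof -
  have q: "(X l, l) \<in> U" using X l by blast
  then obtain m where m: "has_dirderiv H (X l, l) (\<xi>, \<kappa>) m"
    using dd directionally_differentiable_iff by blast
  have "has_dirderiv (\<lambda>s. (X s, s)) l \<kappa> (\<xi>, \<kappa>)"
  proof -
    have "((\<lambda>t. ((X (l + t *\<^sub>R \<kappa>) - X l) /\<^sub>R t, \<kappa>)) \<longlongrightarrow> (\<xi>, \<kappa>)) (at_right 0)"
      using \<xi> unfolding has_dirderiv_def by (intro tendsto_intros)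
    moreover have "\<forall>\<^sub>F t in at_right 0. ((X (l + t *\<^sub>R \<kappa>) - X l) /\<^sub>R t, \<kappa>)
        = ((X (l + t *\<^sub>R \<kappa>), l + t *\<^sub>R \<kappa>) - (X l, l)) /\<^sub>R t"
      using eventually_at_right_less[of "0::real"] by eventually_elim simp
    ultimately show ?thesis unfolding has_dirderiv_def by (rule Lim_transform_eventually)
  qed
  then have "has_dirderiv (\<lambda>s. H (X s, s)) l \<kappa> m"
    using has_dirderiv_compose[where \<gamma> = "\<lambda>s. (X s, s)", OF U q Lip m] by blast
  then have "has_dirderiv (\<lambda>s. 0) l \<kappa> m"
    using has_dirderiv_cong[OF open_ball l, of "\<lambda>s. H (X s, s)" "\<lambda>s. 0"] HX by blast
  then have "m = 0" using has_dirderiv_const has_dirderiv_unique by blast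
  then show ?thesis using m by simp
qed

text \<open>The difference quotients of \<open>X\<close> are bounded. A cluster point \<open>\<xi>\<close> satisfies
  \<open>H'((X l, l); (\<xi>, \<kappa>)) = 0\<close>, and injectivity then forces all quotients to converge to \<open>\<xi>\<close>.\<close>

lemma implicit_function_directionally_differentiable:
  assumes l: "l \<in> ball l0 \<rho>"
  shows "directionally_differentiable_at X l"
  unfolding directionally_differentiable_iff
proof
  fix \<kappa> :: real
  have q: "(X l, l) \<in> U" using X l by blast
  have evb: "\<forall>\<^sub>F t in at_right 0. l + t * \<kappa> \<in> ball l0 \<rho>"
  proof -
    have "((\<lambda>t. l + t * \<kappa>) \<longlongrightarrow> l + 0 * \<kappa>) (at_right 0)" by (intro tendsto_intros)
    then show ?thesis using topological_tendstoD[OF _ open_ball] l by simp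
  qed
  define Q where "Q t = (X (l + t * \<kappa>) - X l) /\<^sub>R t" for t
  obtain \<tau> where \<tau>: "\<tau> > 0" "\<And>t. 0 < t \<Longrightarrow> t < \<tau> \<Longrightarrow> l + t * \<kappa> \<in> ball l0 \<rho>"
    using evb unfolding eventually_at_right_field by auto
  define t where "t n = (\<tau> / 2) / real (Suc n)" for n
  have t: "0 < t n" "t n < \<tau>" for n
  proof -
    have "t n \<le> \<tau> / 2" using \<tau>(1) by (simp add: t_def field_simps)
    then show "t n < \<tau>" using \<tau>(1) by linarith
    show "0 < t n" using \<tau>(1) by (simp add: t_def)
  qed
  have "t \<longlonglongrightarrow> 0" unfolding t_def by (rule lim_const_over_n[THEN LIMSEQ_Suc])
  then have tlim: "filterlim t (at_right 0) sequentially"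
    by (simp add: filterlim_at t less_imp_neq[OF t(1), symmetric])
  have "norm (Q (t n)) \<le> L / c * \<bar>\<kappa>\<bar>" for n
  proof -
    have "norm (X (l + t n * \<kappa>) - X l) \<le> L / c * (t n * \<bar>\<kappa>\<bar>)"
      using lipschitz_on_normD[OF implicit_function_lipschitz \<tau>(2)[OF t] l]
      by (simp add: abs_mult abs_of_pos[OF t(1)])
    then show ?thesis using t(1)[of n]
      by (simp add: Q_def divide_inverse_commute[symmetric] pos_divide_le_eq ac_simps)
  qed
  then have "bounded (range (\<lambda>n. Q (t n)))" by (auto intro!: boundedI)
  then obtain \<xi> s where s: "strict_mono s" "((\<lambda>n. Q (t n)) \<circ> s) \<longlonglongrightarrow> \<xi>"
    using bounded_imp_convergent_subsequence by blast
  obtain m where m: "has_dirderiv H (X l, l) (\<xi>, \<kappa>) m"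
    using dd[OF q] directionally_differentiable_iff by blast
  have evU: "\<forall>\<^sub>F t in at_right 0. (X l, l) + t *\<^sub>R (\<xi>, \<kappa>) \<in> U"
    by (rule eventually_ray_in_open[OF U q])
  have slim: "filterlim (t \<circ> s) (at_right 0) sequentially"
    using filterlim_compose[OF tlim filterlim_subseq[OF s(1)]] by (simp add: o_def)
  \<comment> \<open>Along the subsequence \<open>H\<close> vanishes up to \<open>o(t)\<close> in the direction \<open>(\<xi>, \<kappa>)\<close>.\<close>
  have "m = 0"
  proof -
    have "\<forall>\<^sub>F n in sequentially. (X l, l) + (t \<circ> s) n *\<^sub>R (\<xi>, \<kappa>) \<in> U"
      by (rule eventually_compose_filterlim[OF evU slim])
    then have "\<forall>\<^sub>F n in sequentially. norm ((H ((X l, l) + (t \<circ> s) n *\<^sub>R (\<xi>, \<kappa>)) - H (X l, l)) /\<^sub>R (t \<circ> s) n)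
        \<le> L * norm (\<xi> - ((\<lambda>n. Q (t n)) \<circ> s) n)"
    proof eventually_elim
      case (elim n)
      define u where "u = t (s n)"
      have u: "u > 0" "l + u * \<kappa> \<in> ball l0 \<rho>" using t \<tau>(2) by (auto simp: u_def)
      have XQ: "X (l + u * \<kappa>) = X l + u *\<^sub>R Q u" using u by (simp add: Q_def)
      have "norm (H ((X l, l) + u *\<^sub>R (\<xi>, \<kappa>)) - H (X (l + u * \<kappa>), l + u * \<kappa>))
          \<le> L * norm ((X l, l) + u *\<^sub>R (\<xi>, \<kappa>) - (X (l + u * \<kappa>), l + u * \<kappa>))"
        using elim X[OF u(2) u(2)] by (intro lipschitz_on_normD[OF Lip]) (auto simp: u_def)
      also have "(X l, l) + u *\<^sub>R (\<xi>, \<kappa>) - (X (l + u * \<kappa>), l + u * \<kappa>) = (u *\<^sub>R (\<xi> - Q u), 0)"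
        by (simp add: XQ scaleR_diff_right)
      also have "norm \<dots> = u * norm (\<xi> - Q u)" using u by (simp add: norm_Pair)
      finally have "norm (H ((X l, l) + u *\<^sub>R (\<xi>, \<kappa>)) - H (X l, l)) \<le> L * (u * norm (\<xi> - Q u))"
        using HX u(2) l by simp
      then show ?case using u(1)
        by (simp add: u_def[symmetric] divide_inverse_commute[symmetric] pos_divide_le_eq ac_simps)
    qed
    moreover have "(\<lambda>n. (H ((X l, l) + (t \<circ> s) n *\<^sub>R (\<xi>, \<kappa>)) - H (X l, l)) /\<^sub>R (t \<circ> s) n) \<longlonglongrightarrow> m"
      using m[unfolded has_dirderiv_def] slim by (rule filterlim_compose)
    then have "(\<lambda>n. norm ((H ((X l, l) + (t \<circ> s) n *\<^sub>R (\<xi>, \<kappa>)) - H (X l, l)) /\<^sub>R (t \<circ> s) n)) \<longlonglongrightarrow> norm m"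
      by (rule tendsto_norm)
    moreover have "(\<lambda>n. L * norm (\<xi> - ((\<lambda>n. Q (t n)) \<circ> s) n)) \<longlonglongrightarrow> L * norm (\<xi> - \<xi>)"
      by (intro tendsto_intros s(2))
    ultimately have "norm m \<le> L * norm (\<xi> - \<xi>)" by (intro tendsto_le[OF sequentially_bot])
    then show ?thesis by simp
  qed
  have "has_dirderiv X l \<kappa> \<xi>"
    unfolding has_dirderiv_iff_remainder
  proof (intro allI impI)
    fix e :: real assume "e > 0"
    then have "\<forall>\<^sub>F t in at_right 0. norm (H ((X l, l) + t *\<^sub>R (\<xi>, \<kappa>)) - H (X l, l) - t *\<^sub>R 0) \<le> (c * e) * t"
      using m c unfolding \<open>m = 0\<close> has_dirderiv_iff_remainder by simp
    then show "\<forall>\<^sub>F t in at_right 0. norm (X (l + t *\<^sub>R \<kappa>) - X l - t *\<^sub>R \<xi>) \<le> e * t"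
      using evU evb
    proof eventually_elim
      case (elim t)
      have "c * norm (X (l + t * \<kappa>) - (X l + t *\<^sub>R \<xi>))
          \<le> norm (H (X (l + t * \<kappa>), l + t * \<kappa>) - H (X l + t *\<^sub>R \<xi>, l + t * \<kappa>))"
        using elim X[OF elim(3) elim(3)] by (intro inj) auto
      also have "\<dots> = norm (H ((X l, l) + t *\<^sub>R (\<xi>, \<kappa>)))" using HX[OF elim(3)] by simp
      also have "\<dots> \<le> c * e * t" using elim(1) HX[OF l] by simp
      finally show ?case using c by (simp add: algebra_simps)
    qed
  qed
  then show "\<exists>\<xi>. has_dirderiv X l \<kappa> \<xi>" ..
qed

lemma implicit_function_radial:
  assumes "\<rho> > 0" and rad: "radial_semismooth_at H (X l0, l0)"
  shows "radial_semismooth_at X l0"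
proof -
  have l0: "l0 \<in> ball l0 \<rho>" using \<open>\<rho> > 0\<close> by simp
  obtain C \<delta> where C: "C \<ge> 0" "\<delta> > 0" "\<And>q \<sigma> l. norm (q - (X l0, l0)) < \<delta> \<Longrightarrow> \<sigma> \<in> {1, -1} \<Longrightarrow>
      has_dirderiv H q (\<sigma> *\<^sub>R (q - (X l0, l0))) l \<Longrightarrow>
      norm (H q - H (X l0, l0) - \<sigma> *\<^sub>R l) \<le> C * (norm (q - (X l0, l0)))\<^sup>2"
    using rad unfolding radial_semismooth_at_def by blast
  define N where "N = L / c + 1"
  have N: "N > 0" using c lipschitz_on_nonneg[OF Lip] by (simp add: N_def add_nonneg_pos)
  show ?thesis
  proof (rule radial_semismooth_atI)
    show "min \<rho> (\<delta> / N) > 0" using \<open>\<rho> > 0\<close> C(2) N by simp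
    fix l \<xi> and \<sigma> :: real
    assume l: "norm (l - l0) < min \<rho> (\<delta> / N)" and \<sigma>: "\<sigma> \<in> {1, -1}"
      and \<xi>: "has_dirderiv X l (\<sigma> *\<^sub>R (l - l0)) \<xi>"
    have lb: "l \<in> ball l0 \<rho>" using l by (simp add: dist_norm abs_minus_commute)
    define q where "q = (X l, l)"
    have q: "(X l, l) \<in> U" using X lb by blast
    have dq: "\<sigma> *\<^sub>R (q - (X l0, l0)) = (\<sigma> *\<^sub>R (X l - X l0), \<sigma> *\<^sub>R (l - l0))" by (simp add: q_def)
    have "norm (q - (X l0, l0)) \<le> norm (X l - X l0) + norm (l - l0)"
      using norm_Pair_le[of "X l - X l0" "l - l0"] by (simp add: q_def)
    also have "\<dots> \<le> N * norm (l - l0)"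
      using lipschitz_on_normD[OF implicit_function_lipschitz lb l0] by (simp add: N_def algebra_simps)
    finally have nq: "norm (q - (X l0, l0)) \<le> N * norm (l - l0)" .
    also have "\<dots> < \<delta>" using l N by (simp add: pos_less_divide_eq mult.commute)
    finally have nq': "norm (q - (X l0, l0)) < \<delta>" .
    obtain m where m: "has_dirderiv H q (\<sigma> *\<^sub>R (q - (X l0, l0))) m"
      using dd[OF q] unfolding q_def directionally_differentiable_iff by blast
    have "norm (H q - H (X l0, l0) - \<sigma> *\<^sub>R m) \<le> C * (norm (q - (X l0, l0)))\<^sup>2"
      by (rule C(3)[OF nq' \<sigma> m])
    also have "\<dots> \<le> C * (N * norm (l - l0))\<^sup>2" using nq C(1) by (intro mult_left_mono power_mono) auto
    finally have "norm m \<le> C * (N * norm (l - l0))\<^sup>2"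
      using HX[OF lb] HX[OF l0] \<sigma> by (auto simp: q_def)
    moreover have "c * norm (\<sigma> *\<^sub>R (X l - X l0) - \<xi>) \<le> norm (m - 0)"
      using partially_injective_dirderiv[OF U q inj m[unfolded dq, unfolded q_def]
          implicit_function_dirderiv[OF lb \<xi>]] by simp
    moreover have "X l - X l0 - \<sigma> *\<^sub>R \<xi> = \<sigma> *\<^sub>R (\<sigma> *\<^sub>R (X l - X l0) - \<xi>)"
      using \<sigma> by auto
    then have "norm (X l - X l0 - \<sigma> *\<^sub>R \<xi>) = norm (\<sigma> *\<^sub>R (X l - X l0) - \<xi>)" using \<sigma> by auto
    ultimately have "c * norm (X l - X l0 - \<sigma> *\<^sub>R \<xi>) \<le> C * (N * norm (l - l0))\<^sup>2" by simp
    then show "norm (X l - X l0 - \<sigma> *\<^sub>R \<xi>) \<le> (C * N\<^sup>2 / c) * (norm (l - l0))\<^sup>2"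
      using c by (simp add: pos_le_divide_eq power_mult_distrib ac_simps)
  qed
qed

end


section \<open>Gauge functions as support functions\<close>

text \<open>Products with the transposed matrix are kept as \<open>transpose A *v y\<close> rather than rewritten to \<open>y v* A\<close>.\<close>

declare transpose_matrix_vector [simp del]

lemma gauge_subdifferential_zero:
  assumes "gauge_function p"
  shows "subdifferential p 0 = {u. \<forall>x. ereal (u \<bullet> x) \<le> p x}"
  using assms by (simp add: subdifferential_def gauge_function_def)

lemma gauge_subdifferential_zero_properties:
  assumes g: "gauge_function p"
  shows "convex (subdifferential p 0)" "closed (subdifferential p 0)" "0 \<in> subdifferential p 0"
proof -
  have nonneg: "0 \<le> p x" for x using g by (simp add: gauge_function_def)
  have eq: "subdifferential p 0 = (\<Inter>x. {u. ereal (u \<bullet> x) \<le> p x})"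
    unfolding gauge_subdifferential_zero[OF g] by blast
  have slice: "convex {u. ereal (u \<bullet> x) \<le> p x} \<and> closed {u. ereal (u \<bullet> x) \<le> p x}" for x
    using nonneg[of x] by (cases "p x")
      (auto simp: inner_commute[of _ x] convex_halfspace_le closed_halfspace_le)
  show "convex (subdifferential p 0)" "closed (subdifferential p 0)"
    unfolding eq using slice by (auto intro!: convex_INT closed_INT)
  show "0 \<in> subdifferential p 0"
    unfolding gauge_subdifferential_zero[OF g] using nonneg by (simp add: zero_ereal_def[symmetric])
qed

lemma ext_epigraph_gauge_scale:
  assumes g: "gauge_function p" and "(x, r) \<in> ext_epigraph p" and t: "t > 0"
  shows "(t *\<^sub>R x, t * r) \<in> ext_epigraph p"
proof -
  have "p (t *\<^sub>R x) = ereal t * p x" using g t by (simp add: gauge_function_def)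
  also have "\<dots> \<le> ereal t * ereal r"
    using assms by (intro ereal_mult_left_mono) (auto simp: ext_epigraph_def)
  finally show ?thesis by (simp add: ext_epigraph_def)
qed

text \<open>A closed gauge is the support function of its subdifferential at the origin, by
  separation of a point below the graph from the epigraph, a closed convex cone. A
  separating hyperplane may be vertical; the corresponding direction is then a recession
  direction of the subdifferential.\<close>

lemma gauge_le_support:
  fixes p :: "'a::euclidean_space \<Rightarrow> ereal"
  assumes g: "gauge_function p" and cl: "closed_fun p"
    and le: "\<And>u. u \<in> subdifferential p 0 \<Longrightarrow> u \<bullet> x \<le> r"
  shows "p x \<le> ereal r"
proof (rule ccontr)
  assume neg: "\<not> p x \<le> ereal r"
  let ?E = "ext_epigraph p"
  have nonneg: "0 \<le> p y" for y using g by (simp add: gauge_function_def)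
  have "(x, r) \<notin> ?E" using neg by (simp add: ext_epigraph_def)
  moreover have "convex ?E" "closed ?E"
    using g cl by (auto simp: gauge_function_def convex_fun_def closed_fun_def)
  ultimately obtain ab \<gamma> where sep: "ab \<bullet> (x, r) < \<gamma>" "\<And>z. z \<in> ?E \<Longrightarrow> ab \<bullet> z > \<gamma>"
    using separating_hyperplane_closed_point[of ?E "(x, r)"] by blast
  obtain a \<beta> where ab: "ab = (a, \<beta>)" by (cases ab)
  have "(0, 0) \<in> ?E" using g by (simp add: ext_epigraph_def gauge_function_def zero_ereal_def)
  then have \<gamma>: "\<gamma> < 0" using sep(2) by (force simp: ab)
  have pos: "0 \<le> a \<bullet> y + \<beta> * s" if "(y, s) \<in> ?E" for y s
  proof (rule ccontr)
    assume "\<not> ?thesis"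
    then have n: "a \<bullet> y + \<beta> * s < 0" by simp
    define t where "t = \<gamma> / (a \<bullet> y + \<beta> * s)"
    have "t > 0" using n \<gamma> by (simp add: t_def divide_neg_neg)
    from sep(2)[OF ext_epigraph_gauge_scale[OF g that this]]
    have "\<gamma> < t * (a \<bullet> y + \<beta> * s)" by (simp add: ab algebra_simps)
    then show False using n by (simp add: t_def)
  qed
  have "(0, 1) \<in> ?E" using g by (simp add: ext_epigraph_def gauge_function_def)
  then have "\<beta> \<ge> 0" using pos[of 0 1] by simp
  have neg': "a \<bullet> x + \<beta> * r < 0" using sep(1) \<gamma> by (simp add: ab)
  have inC: "u \<in> subdifferential p 0" if "\<And>y s. p y = ereal s \<Longrightarrow> u \<bullet> y \<le> s" for u
    unfolding gauge_subdifferential_zero[OF g]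
  proof (intro CollectI allI)
    fix y show "ereal (u \<bullet> y) \<le> p y" using that[of y] nonneg[of y] by (cases "p y") auto
  qed
  show False
  proof (cases "\<beta> = 0")
    case True
    define s where "s = (\<bar>r\<bar> + 1) / - (a \<bullet> x)"
    have ax: "a \<bullet> x < 0" using neg' True by simp
    have "(- s *\<^sub>R a) \<in> subdifferential p 0"
    proof (rule inC)
      fix y s' assume y: "p y = ereal s'"
      then have "0 \<le> a \<bullet> y" using pos[of y s'] True by (simp add: ext_epigraph_def)
      moreover have "s \<ge> 0" using ax by (simp add: s_def divide_nonneg_neg)
      moreover have "s' \<ge> 0" using nonneg[of y] y by simp
      ultimately have "- s * (a \<bullet> y) \<le> 0" by (simp add: mult_nonneg_nonneg)
      then show "(- s *\<^sub>R a) \<bullet> y \<le> s'" using \<open>s' \<ge> 0\<close> by simp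
    qed
    from le[OF this] have "- s * (a \<bullet> x) \<le> r" by simp
    moreover have "- s * (a \<bullet> x) = \<bar>r\<bar> + 1" using ax by (simp add: s_def)
    ultimately show False by simp
  next
    case False
    then have \<beta>: "\<beta> > 0" using \<open>\<beta> \<ge> 0\<close> by simp
    have "(- inverse \<beta> *\<^sub>R a) \<in> subdifferential p 0"
    proof (rule inC)
      fix y s assume "p y = ereal s"
      then have "0 \<le> a \<bullet> y + \<beta> * s" using pos by (simp add: ext_epigraph_def)
      then show "(- inverse \<beta> *\<^sub>R a) \<bullet> y \<le> s" using \<beta> by (simp add: field_simps)
    qed
    from le[OF this] have "- (a \<bullet> x) \<le> \<beta> * r" using \<beta> by (simp add: field_simps)
    then show False using neg' by simp
  qed
qed

lemma gauge_eq_support_at_normal: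
  fixes p :: "'a::euclidean_space \<Rightarrow> ereal"
  assumes g: "gauge_function p" and cl: "closed_fun p" and u: "u \<in> subdifferential p 0"
    and N: "\<And>u'. u' \<in> subdifferential p 0 \<Longrightarrow> (u' - u) \<bullet> x \<le> 0"
  shows "p x = ereal (u \<bullet> x)"
proof (rule antisym)
  show "p x \<le> ereal (u \<bullet> x)"
    using N by (intro gauge_le_support[OF g cl]) (simp add: inner_diff_left)
  show "ereal (u \<bullet> x) \<le> p x" using u by (simp add: gauge_subdifferential_zero[OF g])
qed

text \<open>The conjugate of a gauge is the indicator function of \<open>\<partial>p(0)\<close>, so its subdifferential at \<open>u\<close>
  is the normal cone at \<open>u\<close>, empty unless \<open>u \<in> \<partial>p(0)\<close>.\<close>

lemma subdifferential_conjugate_gauge: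
  fixes p :: "'a::euclidean_space \<Rightarrow> ereal"
  assumes g: "gauge_function p" and x: "x \<in> subdifferential (fenchel_conjugate p) u"
  shows "u \<in> subdifferential p 0" "\<And>u'. u' \<in> subdifferential p 0 \<Longrightarrow> (u' - u) \<bullet> x \<le> 0"
proof -
  let ?c = "fenchel_conjugate p"
  have nonneg: "0 \<le> p y" and p0: "p 0 = 0" for y using g by (auto simp: gauge_function_def)
  have c0: "?c v = 0" if "v \<in> subdifferential p 0" for v
    unfolding fenchel_conjugate_def
  proof (rule antisym)
    show "(SUP x. ereal (x \<bullet> v) - p x) \<le> 0"
    proof (rule SUP_least)
      fix y
      have "ereal (v \<bullet> y) \<le> p y" using that by (simp add: gauge_subdifferential_zero[OF g])
      then show "ereal (y \<bullet> v) - p y \<le> 0"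
        using nonneg[of y] by (cases "p y") (auto simp: inner_commute)
    qed
    have "ereal (0 \<bullet> v) - p 0 \<le> (SUP x. ereal (x \<bullet> v) - p x)" by (rule SUP_upper) simp
    then show "0 \<le> (SUP x. ereal (x \<bullet> v) - p x)" by (simp add: p0 zero_ereal_def)
  qed
  have sub: "?c u + ereal (x \<bullet> (v - u)) \<le> ?c v" for v using x by (simp add: subdifferential_def)
  have zC: "0 \<in> subdifferential p 0" by (rule gauge_subdifferential_zero_properties(3)[OF g])
  have bound: "ereal (y \<bullet> u) - p y \<le> ereal (x \<bullet> u)" for y
  proof -
    have "ereal (y \<bullet> u) - p y \<le> ?c u" unfolding fenchel_conjugate_def by (rule SUP_upper) simp
    also have "?c u \<le> ereal (x \<bullet> u)" using sub[of 0] c0[OF zC] by (cases "?c u") auto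
    finally show ?thesis .
  qed
  show uC: "u \<in> subdifferential p 0"
    unfolding gauge_subdifferential_zero[OF g]
  proof (intro CollectI allI)
    fix y
    show "ereal (u \<bullet> y) \<le> p y"
    proof (cases "p y")
      case (real r)
      have "u \<bullet> y \<le> r"
      proof (rule ccontr)
        assume "\<not> u \<bullet> y \<le> r"
        then have d: "y \<bullet> u - r > 0" by (simp add: inner_commute)
        define t where "t = (\<bar>x \<bullet> u\<bar> + 1) / (y \<bullet> u - r)"
        have t: "t > 0" using d by (simp add: t_def add_nonneg_pos)
        have "p (t *\<^sub>R y) = ereal (t * r)" using g t real by (simp add: gauge_function_def)
        then have "t * (y \<bullet> u - r) \<le> x \<bullet> u" using bound[of "t *\<^sub>R y"] by (simp add: right_diff_distrib)
        moreover have "t * (y \<bullet> u - r) = \<bar>x \<bullet> u\<bar> + 1" using d by (simp add: t_def)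
        ultimately show False by simp
      qed
      then show ?thesis using real by simp
    qed (use nonneg[of y] in auto)
  qed
  fix u' assume "u' \<in> subdifferential p 0"
  then show "(u' - u) \<bullet> x \<le> 0" using sub[of u'] c0 uC by (simp add: inner_commute zero_ereal_def)
qed

lemma closest_point_eqI:
  fixes C :: "'a::euclidean_space set"
  assumes "convex C" "closed C" "u \<in> C" and N: "\<And>u'. u' \<in> C \<Longrightarrow> (u' - u) \<bullet> (z - u) \<le> 0"
  shows "closest_point C z = u"
proof (rule closest_point_unique[OF assms(1-3), symmetric], intro ballI)
  fix v assume "v \<in> C"
  have "(norm (z - v))\<^sup>2 = (norm (z - u))\<^sup>2 + (norm (v - u))\<^sup>2 - 2 * ((v - u) \<bullet> (z - u))"
    by (simp add: power2_norm_eq_inner inner_diff_left inner_diff_right inner_commute)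
  then have "(norm (z - u))\<^sup>2 \<le> (norm (z - v))\<^sup>2"
    using N[OF \<open>v \<in> C\<close>] zero_le_power2[of "norm (v - u)"] by linarith
  then show "dist z u \<le> dist z v" by (simp add: dist_norm power2_le_iff_abs_le)
qed

text \<open>Moreau's decomposition for a support function.\<close>

lemma prox_gauge:
  fixes p :: "'a::euclidean_space \<Rightarrow> ereal"
  assumes g: "gauge_function p" and cl: "closed_fun p"
  shows "prox p z = z - closest_point (subdifferential p 0) z"
proof -
  let ?C = "subdifferential p 0"
  let ?f = "\<lambda>x. p x + ereal (1 / 2 * (norm (x - z))\<^sup>2)"
  define \<pi> where "\<pi> = closest_point ?C z"
  define w where "w = z - \<pi>"
  note C = gauge_subdifferential_zero_properties[OF g]
  have \<pi>: "\<pi> \<in> ?C" unfolding \<pi>_def using C by (intro closest_point_in_set) auto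
  have "p w = ereal (\<pi> \<bullet> w)"
  proof (rule gauge_eq_support_at_normal[OF g cl \<pi>])
    fix u' assume "u' \<in> ?C"
    then show "(u' - \<pi>) \<bullet> w \<le> 0"
      using closest_point_dot[OF C(1,2), of u' z] by (simp add: w_def \<pi>_def inner_commute)
  qed
  then have fw: "?f w = ereal (\<pi> \<bullet> w + 1 / 2 * (norm \<pi>)\<^sup>2)" by (simp add: w_def)
  have fy: "?f w < ?f y" if "y \<noteq> w" for y
  proof -
    have "1 / 2 * (norm (y - z))\<^sup>2 + \<pi> \<bullet> y = \<pi> \<bullet> w + 1 / 2 * (norm \<pi>)\<^sup>2 + 1 / 2 * (norm (y - w))\<^sup>2"
      by (simp add: w_def power2_norm_eq_inner inner_diff_left inner_diff_right inner_commute algebra_simps)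
    moreover have "(norm (y - w))\<^sup>2 > 0" using that by simp
    ultimately have "\<pi> \<bullet> w + 1 / 2 * (norm \<pi>)\<^sup>2 < \<pi> \<bullet> y + 1 / 2 * (norm (y - z))\<^sup>2" by linarith
    then have "?f w < ereal (\<pi> \<bullet> y) + ereal (1 / 2 * (norm (y - z))\<^sup>2)" unfolding fw by simp
    also have "\<dots> \<le> ?f y" using \<pi> by (intro add_right_mono) (simp add: gauge_subdifferential_zero[OF g])
    finally show ?thesis .
  qed
  have "?f w \<le> ?f y" for y
  proof (cases "y = w")
    case False
    then show ?thesis by (rule less_imp_le[OF fy])
  qed simp
  then have "is_arg_min ?f (\<lambda>_. True) w" by (simp add: is_arg_min_linorder)
  then have "is_arg_min ?f (\<lambda>_. True) (prox p z)" unfolding prox_def arg_min_def by (rule someI)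
  then have "prox p z = w" unfolding is_arg_min_def using fy by blast
  then show ?thesis by (simp add: w_def \<pi>_def)
qed

section \<open>Optimality conditions\<close>

lemma inner_transpose_mult:
  fixes A :: "real^'n^'m"
  shows "(transpose A *v y) \<bullet> x = y \<bullet> (A *v x)"
  by (simp add: dot_lmul_matrix transpose_matrix_vector)

lemma has_derivative_least_squares:
  fixes A :: "real^'n^'m"
  shows "GDERIV (least_squares A b) x :> transpose A *v (A *v x - b)"
proof -
  have "((\<lambda>x. 1 / 2 * ((A *v x - b) \<bullet> (A *v x - b))) has_derivative
      (\<lambda>h. 1 / 2 * ((A *v x - b) \<bullet> (A *v h) + (A *v h) \<bullet> (A *v x - b)))) (at x)"
    by (auto intro!: derivative_eq_intros bounded_linear.has_derivative[OF matrix_vector_mul_bounded_linear])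
  moreover have "(\<lambda>h. 1 / 2 * ((A *v x - b) \<bullet> (A *v h) + (A *v h) \<bullet> (A *v x - b)))
      = (\<lambda>h. h \<bullet> (transpose A *v (A *v x - b)))"
  proof
    fix h
    show "1 / 2 * ((A *v x - b) \<bullet> (A *v h) + (A *v h) \<bullet> (A *v x - b)) = h \<bullet> (transpose A *v (A *v x - b))"
      using inner_transpose_mult[of A "A *v x - b" h] by (simp add: inner_commute)
  qed
  moreover have "(\<lambda>x. 1 / 2 * ((A *v x - b) \<bullet> (A *v x - b))) = least_squares A b"
    by (simp add: fun_eq_iff least_squares_def power2_norm_eq_inner)
  ultimately show ?thesis unfolding gderiv_def by simp
qed

lemma gradient_least_squares:
  fixes A :: "real^'n^'m"
  shows "gradient (least_squares A b) x = transpose A *v (A *v x - b)"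
  unfolding gradient_def
proof (rule the_equality)
  show "GDERIV (least_squares A b) x :> transpose A *v (A *v x - b)"
    by (rule has_derivative_least_squares)
  fix g assume "GDERIV (least_squares A b) x :> g"
  then have "(\<lambda>h. h \<bullet> g) = (\<lambda>h. h \<bullet> (transpose A *v (A *v x - b)))"
    using has_derivative_least_squares[of A b x] unfolding gderiv_def by (rule has_derivative_unique)
  then have "\<forall>h. h \<bullet> g = h \<bullet> (transpose A *v (A *v x - b))" by (rule fun_cong[THEN allI])
  then show "g = transpose A *v (A *v x - b)" by (simp only: vector_eq_ldot)
qed

text \<open>The dual variable \<open>u = \<lambda>\<^sup>-\<^sup>1 A\<^sup>T (b - A x)\<close> attached to a primal point \<open>x\<close> and a parameter \<open>\<lambda>\<close>.\<close>

definition dual_point :: "real^'n^'m \<Rightarrow> real^'m \<Rightarrow> (real^'n) \<times> real \<Rightarrow> real^'n"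
  where "dual_point A b = (\<lambda>(x, l). inverse l *\<^sub>R (transpose A *v (b - A *v x)))"

lemma prox_residual_eq:
  assumes "gauge_function p" "closed_fun p"
  shows "prox_residual A b p q =
    closest_point (subdifferential p 0) (fst q + dual_point A b q) - dual_point A b q"
proof -
  obtain x l where q: "q = (x, l)" by (cases q)
  have "transpose A *v (A *v x - b) = - (transpose A *v (b - A *v x))"
    by (simp add: matrix_vector_mult_diff_distrib)
  then have "x - inverse l *\<^sub>R gradient (least_squares A b) x = x + dual_point A b (x, l)"
    unfolding gradient_least_squares by (simp add: dual_point_def)
  then have "prox_residual A b p q = x - prox p (x + dual_point A b (x, l))"
    unfolding q prox_residual_def prod.case by (rule arg_cong)
  then show ?thesis by (simp add: q prox_gauge[OF assms])
qed

text \<open>Optimality of \<open>x\<close> at the parameter \<open>l\<close>: the dual point \<open>u\<close> lies in \<open>C\<close> and \<open>x\<close> is normal to \<open>C\<close>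
  at \<open>u\<close>. Used with \<open>C = \<partial>p(0)\<close>.\<close>

definition kkt :: "real^'n^'m \<Rightarrow> real^'m \<Rightarrow> (real^'n) set \<Rightarrow> real^'n \<Rightarrow> real \<Rightarrow> bool"
  where "kkt A b C x l \<longleftrightarrow> dual_point A b (x, l) \<in> C \<and> (\<forall>u\<in>C. (u - dual_point A b (x, l)) \<bullet> x \<le> 0)"

lemma prox_residual_zero_iff_kkt:
  assumes "gauge_function p" "closed_fun p"
  shows "prox_residual A b p (x, l) = 0 \<longleftrightarrow> kkt A b (subdifferential p 0) x l"
proof -
  note C = gauge_subdifferential_zero_properties[OF assms(1)]
  let ?u = "dual_point A b (x, l)"
  have "prox_residual A b p (x, l) = 0 \<longleftrightarrow> closest_point (subdifferential p 0) (x + ?u) = ?u"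
    unfolding prox_residual_eq[OF assms] by simp
  also have "\<dots> \<longleftrightarrow> kkt A b (subdifferential p 0) x l"
  proof
    assume eq: "closest_point (subdifferential p 0) (x + ?u) = ?u"
    have "?u \<in> subdifferential p 0"
      using closest_point_in_set[OF C(2), of "x + ?u"] C(3) eq by auto
    moreover have "(u - ?u) \<bullet> x \<le> 0" if "u \<in> subdifferential p 0" for u
      using closest_point_dot[OF C(1,2) that, of "x + ?u"] unfolding eq by (simp add: inner_commute)
    ultimately show "kkt A b (subdifferential p 0) x l" by (simp add: kkt_def)
  next
    assume "kkt A b (subdifferential p 0) x l"
    then show "closest_point (subdifferential p 0) (x + ?u) = ?u"
      by (intro closest_point_eqI C(1,2)) (auto simp: kkt_def)
  qed
  finally show ?thesis .
qed

lemma standing_assumption_kkt: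
  fixes A :: "real^'n^'m"
  assumes g: "gauge_function p" and "standing_assumption A b p" "l > 0"
  shows "\<exists>x. kkt A b (subdifferential p 0) x l"
proof -
  obtain y u x where x: "x \<in> subdifferential (fenchel_conjugate p) u"
    and y: "y - b + A *v x = 0" "transpose A *v y - l *\<^sub>R u = 0"
    using assms unfolding standing_assumption_def by blast
  have "y = b - A *v x" using y(1) by (simp add: algebra_simps)
  then have "u = dual_point A b (x, l)" using y(2) \<open>l > 0\<close> by (simp add: dual_point_def)
  then show ?thesis using subdifferential_conjugate_gauge[OF g x] by (auto simp: kkt_def)
qed

text \<open>The exact second-order expansion of the quadratic term at any point.\<close>

lemma least_squares_expansion:
  fixes A :: "real^'n^'m"
  assumes "l > 0"
  shows "least_squares A b z = least_squares A b x - l * (dual_point A b (x, l) \<bullet> (z - x))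
    + 1 / 2 * (norm (A *v z - A *v x))\<^sup>2"
proof -
  have "l * (dual_point A b (x, l) \<bullet> (z - x)) = (b - A *v x) \<bullet> (A *v z - A *v x)"
    using assms unfolding dual_point_def prod.case inner_scaleR_left inner_transpose_mult
    by (simp add: matrix_vector_mult_diff_distrib)
  then show ?thesis
    by (simp add: least_squares_def power2_norm_eq_inner inner_diff_left inner_diff_right inner_commute algebra_simps)
qed

lemma y_sol_kkt:
  fixes A :: "real^'n^'m"
  assumes g: "gauge_function p" and cl: "closed_fun p" and l: "l > 0"
    and k: "kkt A b (subdifferential p 0) x l"
  shows "y_sol A b p l = b - A *v x"
proof (rule y_sol_eq[OF g l])
  let ?u = "dual_point A b (x, l)"
  have px: "p x = ereal (?u \<bullet> x)"
    using k by (intro gauge_eq_support_at_normal[OF g cl]) (auto simp: kkt_def)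
  have "ereal (least_squares A b x) + ereal l * p x \<le> ereal (least_squares A b z) + ereal l * p z" for z
  proof -
    have "least_squares A b x + l * (?u \<bullet> x) \<le> least_squares A b z + l * (?u \<bullet> z)"
      unfolding least_squares_expansion[OF l, of A b z x] by (simp add: inner_diff_right right_diff_distrib)
    then have "ereal (least_squares A b x) + ereal l * p x \<le> ereal (least_squares A b z) + ereal l * ereal (?u \<bullet> z)"
      by (simp add: px)
    also have "\<dots> \<le> ereal (least_squares A b z) + ereal l * p z"
      using k l by (intro add_left_mono ereal_mult_left_mono)
        (auto simp: kkt_def gauge_subdifferential_zero[OF g])
    finally show ?thesis .
  qed
  then show "x \<in> solution_set A b p l" by (auto simp: solution_set_def is_arg_min_linorder)
qed

text \<open>The dual description: \<open>y(\<lambda>)\<close> is \<open>\<lambda>\<close> times the projection of \<open>b / \<lambda>\<close> onto the preimage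
  of \<open>\<partial>p(0)\<close> under the transposed matrix.\<close>

lemma y_sol_projection:
  fixes A :: "real^'n^'m"
  assumes g: "gauge_function p" and cl: "closed_fun p" and sa: "standing_assumption A b p"
  defines "D \<equiv> {w. transpose A *v w \<in> subdifferential p 0}"
  shows "convex D" "closed D" "0 \<in> D"
    "\<And>l. l > 0 \<Longrightarrow> y_sol A b p l = l *\<^sub>R closest_point D (inverse l *\<^sub>R b)"
proof -
  note C = gauge_subdifferential_zero_properties[OF g]
  have D: "D = (\<lambda>w. transpose A *v w) -` subdifferential p 0" by (auto simp: D_def)
  show D1: "convex D" unfolding D by (rule convex_linear_vimage[OF matrix_vector_mul_linear C(1)])
  show D2: "closed D" unfolding D
    by (rule continuous_closed_vimage[OF C(2)]) (simp add: linear_continuous_at)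
  show "0 \<in> D" using C(3) by (simp add: D_def)
  fix l :: real assume l: "l > 0"
  obtain x where x: "kkt A b (subdifferential p 0) x l" using standing_assumption_kkt[OF g sa l] by blast
  define w where "w = inverse l *\<^sub>R (b - A *v x)"
  have Aw: "transpose A *v w = dual_point A b (x, l)"
    by (simp add: w_def dual_point_def matrix_vector_mult_scaleR)
  have "closest_point D (inverse l *\<^sub>R b) = w"
  proof (rule closest_point_eqI[OF D1 D2])
    show "w \<in> D" using x by (simp add: D_def Aw kkt_def)
    fix w' assume "w' \<in> D"
    then have "(transpose A *v w' - transpose A *v w) \<bullet> x \<le> 0" using x by (simp add: D_def Aw kkt_def)
    then have "(w' - w) \<bullet> (A *v x) \<le> 0"
      by (simp add: matrix_vector_mult_diff_distrib[symmetric] inner_transpose_mult)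
    then have "inverse l * ((w' - w) \<bullet> (A *v x)) \<le> 0" using l by (simp add: mult_nonneg_nonpos)
    moreover have "inverse l *\<^sub>R b - w = inverse l *\<^sub>R (A *v x)"
      by (simp add: w_def scaleR_diff_right)
    ultimately show "(w' - w) \<bullet> (inverse l *\<^sub>R b - w) \<le> 0" by simp
  qed
  then show "y_sol A b p l = l *\<^sub>R closest_point D (inverse l *\<^sub>R b)"
    using y_sol_kkt[OF g cl l x] l by (simp add: w_def)
qed

lemma scaled_projection_lipschitz:
  fixes D :: "'a::euclidean_space set" and y :: "real \<Rightarrow> 'a"
  assumes D: "convex D" "closed D" "0 \<in> D"
    and y: "\<And>l. l > 0 \<Longrightarrow> y l = l *\<^sub>R closest_point D (inverse l *\<^sub>R b)"
    and "a > 0"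
  shows "(2 * norm b / a)-lipschitz_on {a<..} y"
proof (rule lipschitz_onI)
  fix l m assume lm: "l \<in> {a<..}" "m \<in> {a<..}"
  then have pos: "l > 0" "m > 0" using \<open>a > 0\<close> by auto
  let ?w = "\<lambda>l. closest_point D (inverse l *\<^sub>R b)"
  have nw: "norm (?w l - ?w m) \<le> norm (inverse l *\<^sub>R b - inverse m *\<^sub>R b)"
    using closest_point_lipschitz[of D "inverse l *\<^sub>R b" "inverse m *\<^sub>R b"] D by (auto simp: dist_norm)
  have "closest_point D 0 = 0" using D by (simp add: closest_point_self)
  then have n0: "norm (?w m) \<le> norm (inverse m *\<^sub>R b)"
    using closest_point_lipschitz[of D "inverse m *\<^sub>R b" 0] D by (auto simp: dist_norm)
  have "y l - y m = l *\<^sub>R (?w l - ?w m) + (l - m) *\<^sub>R ?w m"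
    using y pos by (simp add: algebra_simps)
  then have "norm (y l - y m) \<le> norm (l *\<^sub>R (?w l - ?w m)) + norm ((l - m) *\<^sub>R ?w m)"
    by (simp only: norm_triangle_ineq)
  also have "\<dots> \<le> l * norm (inverse l *\<^sub>R b - inverse m *\<^sub>R b) + \<bar>l - m\<bar> * norm (inverse m *\<^sub>R b)"
    using nw n0 pos by (intro add_mono) (auto intro!: mult_left_mono)
  also have "\<dots> = 2 * norm b / m * \<bar>l - m\<bar>"
  proof -
    have "inverse l *\<^sub>R b - inverse m *\<^sub>R b = (inverse l - inverse m) *\<^sub>R b" by (simp add: scaleR_left_diff_distrib)
    moreover have "\<bar>inverse l - inverse m\<bar> = \<bar>l - m\<bar> / (l * m)"
    proof -
      have "inverse l - inverse m = (m - l) / (l * m)" using pos by (simp add: field_simps)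
      then show ?thesis using pos by (simp add: abs_minus_commute)
    qed
    ultimately show ?thesis using pos by (simp add: field_simps)
  qed
  also have "\<dots> \<le> 2 * norm b / a * \<bar>l - m\<bar>"
    using lm \<open>a > 0\<close> by (intro mult_right_mono divide_left_mono) auto
  finally show "dist (y l) (y m) \<le> 2 * norm b / a * dist l m" by (simp add: dist_norm)
qed (use \<open>a > 0\<close> in simp)

text \<open>The condition \<open>\<Pi>\<^sub>D(b / m) = 0\<close> says that \<open>b\<close> is normal to \<open>D\<close> at the origin, independently of \<open>m\<close>.\<close>

lemma scaled_projection_zero:
  fixes D :: "'a::euclidean_space set" and y :: "real \<Rightarrow> 'a"
  assumes D: "convex D" "closed D" "0 \<in> D"
    and y: "\<And>l. l > 0 \<Longrightarrow> y l = l *\<^sub>R closest_point D (inverse l *\<^sub>R b)"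
    and z: "m > 0" "y m = 0" and l: "l > 0"
  shows "y l = 0"
proof -
  have "closest_point D (inverse m *\<^sub>R b) = 0" using y z by auto
  have "w \<bullet> b \<le> 0" if "w \<in> D" for w
    using closest_point_dot[OF D(1,2) that, of "inverse m *\<^sub>R b"] z
    unfolding \<open>closest_point D (inverse m *\<^sub>R b) = 0\<close> by (simp add: inner_commute mult_le_0_iff)
  then have "closest_point D (inverse l *\<^sub>R b) = 0"
    using D l by (intro closest_point_eqI) (auto simp: mult_le_0_iff)
  then show ?thesis using y l by simp
qed


section \<open>Semismoothness of the residual map\<close>

lemma directionally_differentiable_of_derivative:
  "(G has_derivative D) (at q) \<Longrightarrow> directionally_differentiable_at G q"
  unfolding directionally_differentiable_iff by (blast intro: has_derivative_imp_has_dirderiv)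

lemma has_dirderiv_affine:
  assumes "bounded_linear f"
  shows "has_dirderiv (\<lambda>q. c + f q) q k (f k)"
proof (rule has_derivative_imp_has_dirderiv)
  show "((\<lambda>q. c + f q) has_derivative f) (at q)"
    by (auto intro!: derivative_eq_intros bounded_linear_imp_has_derivative assms)
qed

lemma radial_semismooth_at_affine:
  assumes "bounded_linear f"
  shows "radial_semismooth_at (\<lambda>q. c + f q) q0"
proof (rule radial_semismooth_atI[of 1 _ _ 0])
  interpret f: bounded_linear f by fact
  fix q l and \<sigma> :: real
  assume "\<sigma> \<in> {1, -1}" and l: "has_dirderiv (\<lambda>q. c + f q) q (\<sigma> *\<^sub>R (q - q0)) l"
  have "l = \<sigma> *\<^sub>R f (q - q0)"
    using has_dirderiv_unique[OF l has_dirderiv_affine[OF assms]] by (simp add: f.scaleR)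
  then show "norm (c + f q - (c + f q0) - \<sigma> *\<^sub>R l) \<le> 0 * (norm (q - q0))\<^sup>2"
    using \<open>\<sigma> \<in> {1, -1}\<close> by (auto simp: f.diff)
qed simp

lemma directionally_differentiable_affine:
  "bounded_linear f \<Longrightarrow> directionally_differentiable_at (\<lambda>q. c + f q) q"
  unfolding directionally_differentiable_iff by (blast intro: has_dirderiv_affine)

lemma radial_semismooth_at_affine_compose:
  fixes f :: "'b::real_normed_vector \<Rightarrow> 'c::real_normed_vector"
  assumes f: "bounded_linear f"
    and T: "open T" "q0 \<in> T" "N-lipschitz_on T \<gamma>" "\<And>q. q \<in> T \<Longrightarrow> directionally_differentiable_at \<gamma> q"
    and \<gamma>: "radial_semismooth_at \<gamma> q0"
  shows "radial_semismooth_at (\<lambda>q. c + f (\<gamma> q)) q0"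
proof -
  obtain K where K: "\<And>x. norm (f x) \<le> norm x * K" "K \<ge> 0"
    using bounded_linear.nonneg_bounded[OF f] by blast
  have "K-lipschitz_on UNIV (\<lambda>x. c + f x)"
  proof (rule lipschitz_onI)
    fix x y
    have "dist (c + f x) (c + f y) = norm (f (x - y))"
      by (simp add: dist_norm linear_diff[OF bounded_linear.linear[OF f]])
    also have "\<dots> \<le> K * norm (x - y)" using K(1)[of "x - y"] by (simp add: mult.commute)
    finally show "dist (c + f x) (c + f y) \<le> K * dist x y" by (simp add: dist_norm)
  qed (rule K(2))
  then show ?thesis
    by (rule radial_semismooth_at_compose[OF open_UNIV UNIV_I _ directionally_differentiable_affine[OF f]
          radial_semismooth_at_affine[OF f] T \<gamma>])
qed

text \<open>The map \<open>(x, l) \<mapsto> l\<^sup>-\<^sup>1 (v0 - B x)\<close> is smooth for \<open>l > 0\<close>; its Lipschitz and second-order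
  estimates near \<open>(x0, l0)\<close> are written out explicitly.\<close>

context
  fixes B :: "'a::real_normed_vector \<Rightarrow> 'b::real_normed_vector" and v0 :: 'b
  assumes B: "bounded_linear B"
begin

lemma has_derivative_inverse_scaled_affine:
  assumes "l \<noteq> 0"
  shows "((\<lambda>q. inverse (snd q) *\<^sub>R (v0 - B (fst q))) has_derivative
    (\<lambda>(h, t). - (inverse l *\<^sub>R B h) - (t * (inverse l * inverse l)) *\<^sub>R (v0 - B x))) (at (x, l))"
  by (auto intro!: derivative_eq_intros bounded_linear.has_derivative[OF B] simp: assms fun_eq_iff
      algebra_simps)

lemma inverse_scaled_affine_local:
  fixes x0 :: 'a and l0 :: real
  assumes l0: "l0 > 0"
  defines "T \<equiv> ball (x0, l0) (min 1 (l0 / 2))" and "u \<equiv> \<lambda>q. inverse (snd q) *\<^sub>R (v0 - B (fst q))"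
  shows "\<exists>L. L-lipschitz_on T u" "radial_semismooth_at u (x0, l0)"
proof -
  obtain K where K: "\<And>x. norm (B x) \<le> norm x * K" "K \<ge> 0"
    using bounded_linear.nonneg_bounded[OF B] by blast
  note Bdiff = linear_diff[OF bounded_linear.linear[OF B]]
  define V where "V = norm (v0 - B x0) + K"
  have V0: "V \<ge> 0" using K by (simp add: V_def)
  have T: "l > l0 / 2" "norm (v0 - B x) \<le> V" if "(x, l) \<in> T" for x l
  proof -
    have d: "norm ((x, l) - (x0, l0)) < min 1 (l0 / 2)"
      using that unfolding T_def mem_ball dist_norm by (subst norm_minus_commute)
    have "norm (l - l0) \<le> norm ((x, l) - (x0, l0))" using norm_snd_le[of "l - l0" "x - x0"] by simp
    then show "l > l0 / 2" using d by auto
    have "norm (x - x0) \<le> norm ((x, l) - (x0, l0))" using norm_fst_le[of "x - x0" "l - l0"] by simp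
    then have "norm (x - x0) * K \<le> 1 * K" using d K by (intro mult_right_mono) auto
    moreover have "v0 - B x = (v0 - B x0) - B (x - x0)" by (simp add: Bdiff)
    then have "norm (v0 - B x) \<le> norm (v0 - B x0) + norm (B (x - x0))" by (metis norm_triangle_ineq4)
    ultimately show "norm (v0 - B x) \<le> V" using K(1)[of "x - x0"] by (simp add: V_def)
  qed
  define c where "c = 2 / l0"
  have c: "c > 0" "inverse l0 \<le> c" using l0 by (auto simp: c_def field_simps)
  have inv: "0 < l" "0 < inverse l" "inverse l \<le> c" if "(x, l) \<in> T" for x l
    using T(1)[OF that] l0 by (auto simp: c_def field_simps)
  have invd: "\<bar>inverse l - inverse m\<bar> \<le> c * c * \<bar>l - m\<bar>" if "(x, l) \<in> T" "inverse m \<le> c" "m > 0" for x l m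
  proof -
    have "inverse l - inverse m = (m - l) * (inverse l * inverse m)"
      using inv[OF that(1)] that(3) by (simp add: field_simps)
    then have "\<bar>inverse l - inverse m\<bar> = \<bar>l - m\<bar> * (inverse l * inverse m)"
      using inv[OF that(1)] that(3) by (simp add: abs_mult abs_minus_commute)
    also have "\<dots> \<le> \<bar>l - m\<bar> * (c * c)"
      using inv[OF that(1)] that c by (intro mult_left_mono mult_mono) auto
    finally show ?thesis by (simp add: mult.commute)
  qed
  show "\<exists>L. L-lipschitz_on T u"
  proof (rule exI, rule lipschitz_onI)
    show "0 \<le> c * K + c * c * V" using c K V0 by simp
    fix q q' assume q: "q \<in> T" "q' \<in> T"
    obtain x l x' l' where xl: "q = (x, l)" "q' = (x', l')" by (cases q, cases q')
    have "u q - u q' = inverse l *\<^sub>R (- B (x - x')) + (inverse l - inverse l') *\<^sub>R (v0 - B x')"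
      by (simp add: u_def xl Bdiff algebra_simps)
    then have "norm (u q - u q') \<le> norm (inverse l *\<^sub>R (- B (x - x'))) + norm ((inverse l - inverse l') *\<^sub>R (v0 - B x'))"
      by (simp only: norm_triangle_ineq)
    also have "\<dots> \<le> c * (norm (x - x') * K) + (c * c * \<bar>l - l'\<bar>) * V"
      using q inv[of x l] inv[of x' l'] T(2)[of x' l'] invd[of x l l'] K(1)[of "x - x'"] c unfolding xl
      by (intro add_mono) (auto intro!: mult_mono)
    also have "\<dots> \<le> c * (norm (q - q') * K) + (c * c * norm (q - q')) * V"
      using c K V0 norm_fst_le[of "x - x'" "l - l'"] norm_snd_le[of "l - l'" "x - x'"] unfolding xl
      by (intro add_mono mult_left_mono mult_right_mono) auto
    finally show "dist (u q) (u q') \<le> (c * K + c * c * V) * dist q q'"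
      by (simp add: dist_norm algebra_simps)
  qed
  show "radial_semismooth_at u (x0, l0)"
  proof (rule radial_semismooth_atI)
    show "min 1 (l0 / 2) > 0" using l0 by simp
    fix q m and \<sigma> :: real
    assume q: "norm (q - (x0, l0)) < min 1 (l0 / 2)" and \<sigma>: "\<sigma> \<in> {1, -1}"
      and m: "has_dirderiv u q (\<sigma> *\<^sub>R (q - (x0, l0))) m"
    obtain x l where xl: "q = (x, l)" by (cases q)
    have qT: "(x, l) \<in> T" using q unfolding T_def xl mem_ball dist_norm by (subst norm_minus_commute)
    define i i0 where "i = inverse l" and "i0 = inverse l0"
    have i: "0 < l" "0 < i" "i \<le> c" "0 < i0" "i0 \<le> c" "l * i = 1" "l0 * i0 = 1"
      using inv[OF qT] c l0 by (auto simp: i_def i0_def)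
    have "l \<noteq> 0" using i by simp
    have "m = (\<lambda>(h, t). - (inverse l *\<^sub>R B h) - (t * (inverse l * inverse l)) *\<^sub>R (v0 - B x)) (\<sigma> *\<^sub>R (q - (x0, l0)))"
      using has_dirderiv_unique[OF m] has_derivative_imp_has_dirderiv[OF has_derivative_inverse_scaled_affine[OF \<open>l \<noteq> 0\<close>]]
      unfolding u_def xl by blast
    then have sm: "\<sigma> *\<^sub>R m = - (i *\<^sub>R B (x - x0)) - ((l - l0) * (i * i)) *\<^sub>R (v0 - B x)"
      using \<sigma> by (auto simp: xl i_def linear_scale[OF bounded_linear.linear[OF B]]
          linear_neg[OF bounded_linear.linear[OF B]] Bdiff algebra_simps)
    have um: "u q - u (x0, l0) = i *\<^sub>R (v0 - B x) - i0 *\<^sub>R ((v0 - B x) + B (x - x0))"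
      by (simp add: u_def xl i_def i0_def Bdiff)
    have "u q - u (x0, l0) - \<sigma> *\<^sub>R m
        = (i - i0 + (l - l0) * (i * i)) *\<^sub>R (v0 - B x) + (i - i0) *\<^sub>R B (x - x0)"
      unfolding sm um by (simp add: algebra_simps)
    also have "i - i0 + (l - l0) * (i * i) = (l - l0) * (i - i0) * i"
    proof -
      have "(l - l0) * (i * i) - (l - l0) * (i - i0) * i = (l * i) * i0 - (l0 * i0) * i"
        by (simp add: algebra_simps)
      then show ?thesis using i by simp
    qed
    finally have eq: "u q - u (x0, l0) - \<sigma> *\<^sub>R m
        = ((l - l0) * (i - i0) * i) *\<^sub>R (v0 - B x) + (i - i0) *\<^sub>R B (x - x0)" .
    define R where "R = norm (q - (x0, l0))"
    have R: "\<bar>l - l0\<bar> \<le> R" "norm (x - x0) \<le> R"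
      using norm_fst_le[of "x - x0" "l - l0"] norm_snd_le[of "l - l0" "x - x0"] by (auto simp: R_def xl)
    have ii: "\<bar>i - i0\<bar> \<le> c * c * R"
    proof -
      have "\<bar>i - i0\<bar> \<le> c * c * \<bar>l - l0\<bar>" unfolding i_def i0_def by (rule invd[OF qT c(2) l0])
      also have "\<dots> \<le> c * c * R" using R(1) c(1) by (intro mult_left_mono) auto
      finally show ?thesis .
    qed
    have R0: "R \<ge> 0" by (simp add: R_def)
    have "norm (((l - l0) * (i - i0) * i) *\<^sub>R (v0 - B x)) = \<bar>l - l0\<bar> * \<bar>i - i0\<bar> * i * norm (v0 - B x)"
      using i by (simp add: abs_mult)
    also have "\<dots> \<le> R * (c * c * R) * c * V"
      using R ii i c T(2)[OF qT] R0 V0 by (intro mult_mono) auto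
    finally have 1: "norm (((l - l0) * (i - i0) * i) *\<^sub>R (v0 - B x)) \<le> R * (c * c * R) * c * V" .
    have "norm (B (x - x0)) \<le> R * K" using K(1)[of "x - x0"] mult_right_mono[OF R(2) K(2)] by simp
    then have 2: "norm ((i - i0) *\<^sub>R B (x - x0)) \<le> (c * c * R) * (R * K)"
      using ii c R0 by (simp add: mult_mono)
    show "norm (u q - u (x0, l0) - \<sigma> *\<^sub>R m) \<le> (c * c * c * V + c * c * K) * (norm (q - (x0, l0)))\<^sup>2"
      unfolding eq R_def[symmetric] using norm_triangle_mono[OF 1 2] by (simp add: power2_eq_square algebra_simps)
  qed
qed

end

lemma dual_point_alt:
  "dual_point A b = (\<lambda>q. inverse (snd q) *\<^sub>R (transpose A *v b - transpose A *v (A *v fst q)))"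
  by (simp add: fun_eq_iff dual_point_def matrix_vector_mult_diff_distrib)

text \<open>The residual is composed of the projection onto \<open>C\<close> and the smooth map \<open>dual_point A b\<close>.\<close>

lemma projection_residual_regular:
  fixes A :: "real^'n^'m" and C :: "(real^'n) set" and b :: "real^'m"
    and x0 :: "real^'n" and l0 :: real
  assumes C: "convex C" "closed C" "C \<noteq> {}" and ssm: "strongly_semismooth_on UNIV (closest_point C)"
    and l0: "l0 > 0"
  defines "H \<equiv> \<lambda>q. closest_point C (fst q + dual_point A b q) - dual_point A b q"
  shows "\<exists>L. L-lipschitz_on (ball (x0, l0) (min 1 (l0 / 2))) H"
    "radial_semismooth_at H (x0, l0)" "directionally_differentiable_at H (x0, l0)"
proof -
  let ?u = "dual_point A b"
  let ?z = "\<lambda>q. fst q + ?u q"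
  define T where "T = ball (x0, l0) (min 1 (l0 / 2))"
  have T: "open T" "(x0, l0) \<in> T" using l0 by (auto simp: T_def)
  have snd0: "snd q > 0" if "q \<in> T" for q
  proof -
    have "norm (snd (q - (x0, l0))) \<le> norm (q - (x0, l0))" by (metis norm_snd_le prod.collapse)
    moreover have "norm (q - (x0, l0)) < min 1 (l0 / 2)"
      using that unfolding T_def mem_ball dist_norm by (subst norm_minus_commute)
    ultimately show ?thesis using l0 by auto
  qed
  have B: "bounded_linear (\<lambda>x. transpose A *v (A *v x))"
    using bounded_linear_compose[OF matrix_vector_mul_bounded_linear matrix_vector_mul_bounded_linear] .
  have ddu: "directionally_differentiable_at ?u q" if "q \<in> T" for q
  proof -
    have "snd q \<noteq> 0" using snd0[OF that] by simp
    from has_derivative_inverse_scaled_affine[OF B this, of "transpose A *v b" "fst q"]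
    show ?thesis unfolding dual_point_alt using directionally_differentiable_of_derivative by simp blast
  qed
  obtain Lu where Lu: "Lu-lipschitz_on T ?u"
    using inverse_scaled_affine_local(1)[OF B l0, of x0] unfolding dual_point_alt T_def by blast
  have radu: "radial_semismooth_at ?u (x0, l0)"
    using inverse_scaled_affine_local(2)[OF B l0] unfolding dual_point_alt .
  have L1: "1-lipschitz_on UNIV (closest_point C)"
    by (rule lipschitz_onI) (use closest_point_lipschitz[OF C] in auto)
  have ddF: "directionally_differentiable_at (closest_point C) z" for z
    using ssm by (simp add: strongly_semismooth_on_def strongly_semismooth_at_def)
  have radF: "radial_semismooth_at (closest_point C) z" for z
    by (rule strongly_semismooth_on_imp_radial[OF ssm L1])
  have fst1: "directionally_differentiable_at fst q" "radial_semismooth_at fst q" for q :: "(real^'n) \<times> real"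
    using directionally_differentiable_affine[OF bounded_linear_fst, where c = 0 and q = q]
      radial_semismooth_at_affine[OF bounded_linear_fst, where c = 0 and ?q0.0 = q] by simp_all
  have ddadd: "directionally_differentiable_at (\<lambda>q. F q + G q) q"
    if "directionally_differentiable_at F q" "directionally_differentiable_at G q"
    for F G :: "(real^'n) \<times> real \<Rightarrow> real^'n" and q
    using that has_dirderiv_add unfolding directionally_differentiable_iff by metis
  have Lfst: "1-lipschitz_on T (fst :: (real^'n) \<times> real \<Rightarrow> _)"
    by (rule lipschitz_onI) (simp_all add: dist_fst_le)
  have Lz: "(1 + Lu)-lipschitz_on T ?z" by (rule lipschitz_on_add[OF Lfst Lu])
  have ddz: "directionally_differentiable_at ?z q" if "q \<in> T" for q
    by (rule ddadd[OF fst1(1) ddu[OF that]])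
  have radz: "radial_semismooth_at ?z (x0, l0)"
    by (rule radial_semismooth_at_add[OF T fst1(1) ddu fst1(2) radu])
  have LF: "(1 * (1 + Lu))-lipschitz_on T (\<lambda>q. closest_point C (?z q))"
    by (rule lipschitz_on_compose2[OF Lz lipschitz_on_subset[OF L1 subset_UNIV]])
  have ddFz: "directionally_differentiable_at (\<lambda>q. closest_point C (?z q)) q" if "q \<in> T" for q
    by (rule directionally_differentiable_compose[where \<gamma> = ?z, OF open_UNIV UNIV_I L1 ddF ddz[OF that]])
  have radFz: "radial_semismooth_at (\<lambda>q. closest_point C (?z q)) (x0, l0)"
    by (rule radial_semismooth_at_compose[where \<gamma> = ?z, OF open_UNIV UNIV_I L1 ddF radF T Lz ddz radz])
  have neg: "bounded_linear (\<lambda>x::real^'n. - x)" by (simp add: bounded_linear_minus bounded_linear_ident)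
  have ddn: "directionally_differentiable_at (\<lambda>q. - ?u q) q" if "q \<in> T" for q
    using ddu[OF that] has_dirderiv_linear[OF neg] unfolding directionally_differentiable_iff by blast
  have radn: "radial_semismooth_at (\<lambda>q. - ?u q) (x0, l0)"
    using radial_semismooth_at_affine_compose[OF neg T Lu ddu radu, of 0] by simp
  have H: "H = (\<lambda>q. closest_point C (?z q) + - ?u q)" by (simp add: H_def)
  show "radial_semismooth_at H (x0, l0)" unfolding H
    by (rule radial_semismooth_at_add[OF T ddFz ddn radFz radn])
  show "directionally_differentiable_at H (x0, l0)" unfolding H by (rule ddadd[OF ddFz ddn]) (rule T)+
  have "(1 * (1 + Lu) + Lu)-lipschitz_on T H" unfolding H_def by (rule lipschitz_on_diff[OF LF Lu])
  then show "\<exists>L. L-lipschitz_on (ball (x0, l0) (min 1 (l0 / 2))) H" unfolding T_def by blast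
qed

section \<open>Local stability of solutions\<close>

text \<open>If no solution at \<open>l0\<close> has distance exactly \<open>\<delta>\<close> from the solution \<open>x0\<close>, then all solutions at
  nearby parameters are within \<open>\<delta>\<close> of \<open>x0\<close>. Otherwise move along the segment from \<open>x0\<close> to a distant
  solution until the distance to \<open>x0\<close> equals \<open>\<delta>\<close>; convexity bounds the objective there, and any
  limit of such points is a solution at \<open>l0\<close> at distance \<open>\<delta>\<close>.\<close>

lemma kkt_solutions_converge:
  fixes A :: "real^'n^'m" and C :: "(real^'n) set"
  assumes l0: "l0 > 0" and k0: "kkt A b C x0 l0" and \<delta>: "\<delta> > 0"
    and uniq: "\<And>x. kkt A b C x l0 \<Longrightarrow> norm (x - x0) \<noteq> \<delta>"
  shows "\<exists>\<rho>>0. \<rho> \<le> l0 \<and> (\<forall>l x. \<bar>l - l0\<bar> < \<rho> \<longrightarrow> kkt A b C x l \<longrightarrow> norm (x - x0) < \<delta>)"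
proof (rule ccontr)
  assume neg: "\<not> ?thesis"
  let ?f = "least_squares A b"
  define u0 where "u0 = dual_point A b (x0, l0)"
  have u0: "u0 \<in> C" "\<And>u. u \<in> C \<Longrightarrow> u \<bullet> x0 \<le> u0 \<bullet> x0" using k0 by (auto simp: kkt_def u0_def inner_diff_left)
  have "\<exists>l v. \<bar>l - l0\<bar> < \<rho> \<and> norm (v - x0) = \<delta> \<and> (\<forall>u\<in>C. ?f v + l * (u \<bullet> v) \<le> ?f x0 + l * (u0 \<bullet> x0))"
    if \<rho>: "\<rho> > 0" "\<rho> \<le> l0" for \<rho>
  proof -
    obtain l x where lx: "\<bar>l - l0\<bar> < \<rho>" "kkt A b C x l" "norm (x - x0) \<ge> \<delta>"
      using neg \<rho> by (meson not_le)
    have l: "l > 0" using lx(1) \<rho>(2) by auto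
    define w where "w = dual_point A b (x, l)"
    have w: "w \<in> C" "\<And>u. u \<in> C \<Longrightarrow> u \<bullet> x \<le> w \<bullet> x" using lx(2) by (auto simp: kkt_def w_def inner_diff_left)
    define s where "s = \<delta> / norm (x - x0)"
    have "norm (x - x0) > 0" using lx(3) \<delta> by linarith
    then have s: "0 < s" "s \<le> 1" using lx(3) \<delta> by (auto simp: s_def divide_le_eq)
    define v where "v = x0 + s *\<^sub>R (x - x0)"
    have vn: "norm (v - x0) = \<delta>" using \<open>norm (x - x0) > 0\<close> \<delta> by (simp add: v_def s_def)
    \<comment> \<open>Optimality of \<open>x\<close> at the parameter \<open>l\<close>, tested against \<open>x0\<close>.\<close>
    have opt: "?f x + l * (w \<bullet> x) \<le> ?f x0 + l * (u0 \<bullet> x0)"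
    proof -
      have "?f x + l * (w \<bullet> x) \<le> ?f x0 + l * (w \<bullet> x0)"
        unfolding least_squares_expansion[OF l, of A b x0 x] w_def
        by (simp add: inner_diff_right right_diff_distrib)
      moreover have "l * (w \<bullet> x0) \<le> l * (u0 \<bullet> x0)" using u0(2)[OF w(1)] l by simp
      ultimately show ?thesis by linarith
    qed
    have fv: "?f v \<le> (1 - s) * ?f x0 + s * ?f x"
    proof -
      have "A *v v - b = (1 - s) *\<^sub>R (A *v x0 - b) + s *\<^sub>R (A *v x - b)"
        by (simp add: v_def matrix_vector_right_distrib matrix_vector_mult_diff_distrib matrix_vector_mult_scaleR algebra_simps)
      then have "norm (A *v v - b) \<le> (1 - s) * norm (A *v x0 - b) + s * norm (A *v x - b)"
        using norm_triangle_ineq[of "(1 - s) *\<^sub>R (A *v x0 - b)" "s *\<^sub>R (A *v x - b)"] s by simp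
      then have "(norm (A *v v - b))\<^sup>2 \<le> ((1 - s) * norm (A *v x0 - b) + s * norm (A *v x - b))\<^sup>2"
        by (intro power_mono) auto
      also have "\<dots> \<le> (1 - s) * (norm (A *v x0 - b))\<^sup>2 + s * (norm (A *v x - b))\<^sup>2"
      proof -
        have "(1 - s) * a\<^sup>2 + s * c\<^sup>2 - ((1 - s) * a + s * c)\<^sup>2 = (s * (1 - s)) * (a - c)\<^sup>2" for a c :: real
          by (simp add: power2_eq_square algebra_simps)
        moreover have "(s * (1 - s)) * (a - c)\<^sup>2 \<ge> 0" for a c :: real using s by simp
        ultimately show ?thesis by (metis diff_ge_0_iff_ge)
      qed
      finally show ?thesis by (simp add: least_squares_def algebra_simps diff_divide_distrib)
    qed
    have "?f v + l * (u \<bullet> v) \<le> ?f x0 + l * (u0 \<bullet> x0)" if u: "u \<in> C" for u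
    proof -
      have "u \<bullet> v = (1 - s) * (u \<bullet> x0) + s * (u \<bullet> x)"
        by (simp add: v_def inner_add_right inner_diff_right algebra_simps)
      also have "\<dots> \<le> (1 - s) * (u0 \<bullet> x0) + s * (w \<bullet> x)"
        using u0(2)[OF u] w(2)[OF u] s by (intro add_mono mult_left_mono) auto
      finally have "l * (u \<bullet> v) \<le> l * ((1 - s) * (u0 \<bullet> x0) + s * (w \<bullet> x))" using l by simp
      moreover have "s * (?f x + l * (w \<bullet> x)) \<le> s * (?f x0 + l * (u0 \<bullet> x0))" using opt s by simp
      ultimately show ?thesis using fv by (simp add: algebra_simps)
    qed
    then show ?thesis using lx(1) vn by blast
  qed
  then have "\<forall>n. \<exists>l v. \<bar>l - l0\<bar> < l0 / real (Suc n) \<and> norm (v - x0) = \<delta> \<and>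
      (\<forall>u\<in>C. ?f v + l * (u \<bullet> v) \<le> ?f x0 + l * (u0 \<bullet> x0))"
    using l0 by (simp add: divide_le_eq)
  then obtain l v where lv: "\<And>n. \<bar>l n - l0\<bar> < l0 / real (Suc n)" "\<And>n. norm (v n - x0) = \<delta>"
    "\<And>n u. u \<in> C \<Longrightarrow> ?f (v n) + l n * (u \<bullet> v n) \<le> ?f x0 + l n * (u0 \<bullet> x0)"
    by metis
  have z: "(\<lambda>n. l0 / real (Suc n)) \<longlonglongrightarrow> 0" by (rule lim_const_over_n[THEN LIMSEQ_Suc])
  have ll: "l \<longlonglongrightarrow> l0"
    by (rule metric_tendsto_imp_tendsto[OF z]) (use lv(1) l0 in \<open>simp add: less_imp_le dist_real_def\<close>)
  have "v n \<in> sphere x0 \<delta>" for n using lv(2) by (simp add: dist_norm norm_minus_commute)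
  then obtain v' s where s: "v' \<in> sphere x0 \<delta>" "strict_mono s" "(v \<circ> s) \<longlonglongrightarrow> v'"
    using compact_sphere[of x0 \<delta>] unfolding compact_def by metis
  have lls: "(l \<circ> s) \<longlonglongrightarrow> l0" by (rule LIMSEQ_subseq_LIMSEQ[OF ll s(2)])
  have le: "?f v' + l0 * (u \<bullet> v') \<le> ?f x0 + l0 * (u0 \<bullet> x0)" if u: "u \<in> C" for u
  proof (rule tendsto_le[OF sequentially_bot])
    have "(\<lambda>n. A *v (v \<circ> s) n) \<longlonglongrightarrow> A *v v'"
      by (rule bounded_linear.tendsto[OF matrix_vector_mul_bounded_linear s(3)])
    then show "(\<lambda>n. ?f ((v \<circ> s) n) + (l \<circ> s) n * (u \<bullet> (v \<circ> s) n)) \<longlonglongrightarrow> ?f v' + l0 * (u \<bullet> v')"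
      unfolding least_squares_def by (intro tendsto_intros s(3) lls)
    show "(\<lambda>n. ?f x0 + (l \<circ> s) n * (u0 \<bullet> x0)) \<longlonglongrightarrow> ?f x0 + l0 * (u0 \<bullet> x0)"
      by (intro tendsto_intros lls)
    show "\<forall>\<^sub>F n in sequentially. ?f ((v \<circ> s) n) + (l \<circ> s) n * (u \<bullet> (v \<circ> s) n) \<le> ?f x0 + (l \<circ> s) n * (u0 \<bullet> x0)"
      using lv(3)[OF u] by simp
  qed
  \<comment> \<open>The choice \<open>u = u0\<close> forces equal residuals, whence \<open>v'\<close> has the same dual point as \<open>x0\<close>.\<close>
  have exp: "?f v' = ?f x0 - l0 * (u0 \<bullet> (v' - x0)) + 1 / 2 * (norm (A *v v' - A *v x0))\<^sup>2"
    unfolding u0_def by (rule least_squares_expansion[OF l0])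
  have "(norm (A *v v' - A *v x0))\<^sup>2 \<le> 0"
    using le[OF u0(1)] unfolding exp by (simp add: inner_diff_right right_diff_distrib)
  then have Av: "A *v v' = A *v x0" by simp
  then have dual: "dual_point A b (v', l0) = u0" by (simp add: u0_def dual_point_def)
  have "?f v' = ?f x0" by (simp add: least_squares_def Av)
  then have "l0 * (u0 \<bullet> (v' - x0)) = 0" using exp Av by simp
  then have u0v: "u0 \<bullet> v' = u0 \<bullet> x0" using l0 by (simp add: inner_diff_right)
  have "(u - u0) \<bullet> v' \<le> 0" if "u \<in> C" for u
    using le[OF that] \<open>?f v' = ?f x0\<close> l0 u0v by (simp add: inner_diff_left)
  then have "kkt A b C v' l0" using u0(1) by (simp add: kkt_def dual)
  then show False using uniq[of v'] s(1) by (simp add: dist_norm norm_minus_commute)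
qed


section \<open>The norm of the dual solution\<close>

lemma radial_semismooth_at_cong:
  assumes "open S" "q0 \<in> S" and eq: "\<And>q. q \<in> S \<Longrightarrow> G q = G' q" and rad: "radial_semismooth_at G' q0"
  shows "radial_semismooth_at G q0"
proof -
  obtain r where r: "r > 0" "ball q0 r \<subseteq> S" using assms(1,2) openE by blast
  obtain C \<delta> where C: "\<delta> > 0" "\<And>z \<sigma> l. norm (z - q0) < \<delta> \<Longrightarrow> \<sigma> \<in> {1, -1} \<Longrightarrow>
      has_dirderiv G' z (\<sigma> *\<^sub>R (z - q0)) l \<Longrightarrow> norm (G' z - G' q0 - \<sigma> *\<^sub>R l) \<le> C * (norm (z - q0))\<^sup>2"
    using rad unfolding radial_semismooth_at_def by blast
  show ?thesis
  proof (rule radial_semismooth_atI)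
    show "min r \<delta> > 0" using r C by simp
    fix q l and \<sigma> :: real
    assume q: "norm (q - q0) < min r \<delta>" and \<sigma>: "\<sigma> \<in> {1, -1}" and l: "has_dirderiv G q (\<sigma> *\<^sub>R (q - q0)) l"
    have "q \<in> S" using q r by (auto simp: dist_norm norm_minus_commute)
    then have "has_dirderiv G' q (\<sigma> *\<^sub>R (q - q0)) l"       using has_dirderiv_cong[where G = G and G' = G', OF assms(1) \<open>q \<in> S\<close> eq] l by simp
    then show "norm (G q - G q0 - \<sigma> *\<^sub>R l) \<le> C * (norm (q - q0))\<^sup>2"
      using C(2)[OF _ \<sigma>] q eq[OF \<open>q \<in> S\<close>] eq[OF assms(2)] by simp
  qed
qed

lemma directionally_differentiable_cong:
  assumes "open S" "q \<in> S" "\<And>x. x \<in> S \<Longrightarrow> G x = G' x" "directionally_differentiable_at G' q"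
  shows "directionally_differentiable_at G q"
proof -
  have "has_dirderiv G q = has_dirderiv G' q" by (intro ext has_dirderiv_cong[OF assms(1-3)])
  then show ?thesis using assms(4) by (simp add: directionally_differentiable_iff)
qed

lemma radial_semismooth_at_norm:
  fixes y0 :: "'a::real_inner"
  assumes "y0 \<noteq> 0"
  shows "radial_semismooth_at norm y0"
proof (rule radial_semismooth_atI)
  show "norm y0 / 2 > 0" using assms by simp
  fix q :: 'a and l \<sigma> :: real
  assume q: "norm (q - y0) < norm y0 / 2" and \<sigma>: "\<sigma> \<in> {1, -1}" and l: "has_dirderiv norm q (\<sigma> *\<^sub>R (q - y0)) l"
  \<comment> \<open>The gradient of the norm at \<open>q\<close> is \<open>sgn q\<close>, and the linearisation error is controlled by
    \<open>2 (\<parallel>q\<parallel> \<parallel>y0\<parallel> - q \<bullet> y0) = \<parallel>q - y0\<parallel>\<^sup>2 - (\<parallel>q\<parallel> - \<parallel>y0\<parallel>)\<^sup>2\<close>.\<close>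
  have nq: "norm q > norm y0 / 2"
    using norm_triangle_ineq[of q "y0 - q"] q by (simp add: norm_minus_commute)
  then have "q \<noteq> 0" using assms by auto
  then have "l = (\<sigma> *\<^sub>R (q - y0)) \<bullet> sgn q"
    using has_dirderiv_unique[OF l has_derivative_imp_has_dirderiv[OF has_derivative_norm]] by blast
  then have sl: "\<sigma> *\<^sub>R l = (q - y0) \<bullet> sgn q" using \<sigma> by auto
  have "norm q * (norm y0 - y0 \<bullet> sgn q) = norm q * norm y0 - y0 \<bullet> q"
    using \<open>q \<noteq> 0\<close> by (simp add: right_diff_distrib sgn_div_norm)
  also have "\<dots> = ((norm (q - y0))\<^sup>2 - (norm q - norm y0)\<^sup>2) / 2"
    by (simp add: power2_norm_eq_inner inner_diff_left inner_diff_right inner_commute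
        power2_diff field_simps)
  also have "\<dots> \<le> (norm (q - y0))\<^sup>2 / 2" by simp
  finally have up: "norm q * (norm y0 - y0 \<bullet> sgn q) \<le> (norm (q - y0))\<^sup>2 / 2" .
  have lo: "0 \<le> norm y0 - y0 \<bullet> sgn q"
    using norm_cauchy_schwarz[of y0 "sgn q"] \<open>q \<noteq> 0\<close> by (simp add: norm_sgn)
  have "(norm y0 / 2) * (norm y0 - y0 \<bullet> sgn q) \<le> norm q * (norm y0 - y0 \<bullet> sgn q)"
    using nq lo by (intro mult_right_mono) auto
  then have le: "norm y0 - y0 \<bullet> sgn q \<le> (1 / norm y0) * (norm (q - y0))\<^sup>2"
    using up assms by (simp add: field_simps)
  have "q \<bullet> sgn q = norm q" using \<open>q \<noteq> 0\<close>
    by (simp add: sgn_div_norm dot_square_norm power2_eq_square)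
  then have "norm q - norm y0 - \<sigma> *\<^sub>R l = - (norm y0 - y0 \<bullet> sgn q)"
    unfolding sl by (simp add: inner_diff_left)
  then show "norm (norm q - norm y0 - \<sigma> *\<^sub>R l) \<le> (1 / norm y0) * (norm (q - y0))\<^sup>2" using le lo by simp
qed

lemma lipschitz_on_norm: "1-lipschitz_on S norm"
  by (rule lipschitz_onI) (auto simp: dist_norm intro: norm_triangle_ineq3)

lemma locally_lipschitz_on_norm:
  assumes "locally_lipschitz_on U y"
  shows "locally_lipschitz_on U (\<lambda>l. norm (y l))"
  unfolding locally_lipschitz_on_def
proof
  fix x assume "x \<in> U"
  then obtain e L where "e > 0" "L-lipschitz_on (ball x e \<inter> U) y"
    using assms unfolding locally_lipschitz_on_def by blast
  then have "(1 * L)-lipschitz_on (ball x e \<inter> U) (\<lambda>l. norm (y l))"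
    by (intro lipschitz_on_compose2[OF _ lipschitz_on_norm])
  then show "\<exists>e>0. \<exists>L. L-lipschitz_on (ball x e \<inter> U) (\<lambda>l. norm (y l))" using \<open>e > 0\<close> by blast
qed

lemma strongly_semismooth_at_norm:
  fixes y :: "'a::euclidean_space \<Rightarrow> 'b::euclidean_space"
  assumes U: "open U" "l0 \<in> U" and lip: "locally_lipschitz_on U y"
    and T: "open T" "l0 \<in> T" and dd: "\<And>l. l \<in> T \<Longrightarrow> directionally_differentiable_at y l"
    and rad: "radial_semismooth_at y l0" and nz: "y l0 \<noteq> 0"
  shows "strongly_semismooth_at U (\<lambda>l. norm (y l)) l0"
proof (rule radial_imp_strongly_semismooth_at[OF U locally_lipschitz_on_norm[OF lip]])
  obtain e L where e: "e > 0" and L: "L-lipschitz_on (ball l0 e \<inter> U) y"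
    using lip U(2) unfolding locally_lipschitz_on_def by blast
  define T' where "T' = ball l0 e \<inter> U \<inter> T"
  have T': "open T'" "l0 \<in> T'" using e T U by (auto simp: T'_def)
  have L': "L-lipschitz_on T' y" by (rule lipschitz_on_subset[OF L]) (auto simp: T'_def)
  have dd': "directionally_differentiable_at y l" if "l \<in> T'" for l using dd that by (simp add: T'_def)
  have N: "open (- {0::'b})" "y l0 \<in> - {0}" using nz by auto
  have ddn: "directionally_differentiable_at norm z" if "z \<in> - {0}" for z :: 'b
    using directionally_differentiable_of_derivative[OF has_derivative_norm] that by blast
  show "directionally_differentiable_at (\<lambda>l. norm (y l)) l0"
    by (rule directionally_differentiable_compose[where \<gamma> = y, OF N lipschitz_on_norm ddn[OF N(2)] dd'[OF T'(2)]])
  show "radial_semismooth_at (\<lambda>l. norm (y l)) l0"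
    by (rule radial_semismooth_at_compose[where \<gamma> = y, OF N lipschitz_on_norm ddn
          radial_semismooth_at_norm[OF nz] T' L' dd' rad])
qed

section \<open>Regularity of the dual solution\<close>

lemma locally_lipschitz_y_sol:
  assumes "gauge_function p" "closed_fun p" "standing_assumption A b p"
  shows "locally_lipschitz_on {0<..} (y_sol A b p)"
  unfolding locally_lipschitz_on_def
proof
  fix l :: real assume l: "l \<in> {0<..}"
  have "(2 * norm b / (l / 2))-lipschitz_on {l / 2<..} (y_sol A b p)"
    by (rule scaled_projection_lipschitz[OF y_sol_projection[OF assms]]) (use l in auto)
  moreover have "ball l (l / 2) \<inter> {0<..} \<subseteq> {l / 2<..}"
  proof
    fix x assume "x \<in> ball l (l / 2) \<inter> {0<..}"
    then have "\<bar>l - x\<bar> < l / 2" by (simp add: dist_real_def)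
    then have "l / 2 < x" using abs_ge_self[of "l - x"] by linarith
    then show "x \<in> {l / 2<..}" by simp
  qed
  ultimately have "(2 * norm b / (l / 2))-lipschitz_on (ball l (l / 2) \<inter> {0<..}) (y_sol A b p)"
    by (rule lipschitz_on_subset)
  then show "\<exists>e>0. \<exists>L. L-lipschitz_on (ball l e \<inter> {0<..}) (y_sol A b p)"
    using l by (intro exI[of _ "l / 2"]) auto
qed

text \<open>The solution \<open>y\<close> vanishes either nowhere or identically, so the kink of the norm at the
  origin never matters.\<close>

lemma strongly_semismooth_at_y_phi:
  fixes A :: "real^'n^'m"
  assumes g: "gauge_function p" "closed_fun p" "standing_assumption A b p"
    and T: "open T" "l0 \<in> T" "l0 > 0" and dd: "\<And>l. l \<in> T \<Longrightarrow> directionally_differentiable_at (y_sol A b p) l"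
    and rad: "radial_semismooth_at (y_sol A b p) l0"
  shows "strongly_semismooth_at {0<..} (y_sol A b p) l0" "strongly_semismooth_at {0<..} (phi_sol A b p) l0"
proof -
  have U: "open {0::real<..}" "l0 \<in> {0<..}" using T by auto
  note lip = locally_lipschitz_y_sol[OF g]
  show "strongly_semismooth_at {0<..} (y_sol A b p) l0"
    by (rule radial_imp_strongly_semismooth_at[OF U lip dd[OF T(2)] rad])
  have phi: "phi_sol A b p = (\<lambda>l. norm (y_sol A b p l))" by (simp add: fun_eq_iff phi_sol_def)
  show "strongly_semismooth_at {0<..} (phi_sol A b p) l0"
  proof (cases "y_sol A b p l0 = 0")
    case False
    then show ?thesis unfolding phi by (intro strongly_semismooth_at_norm[OF U lip T(1,2) dd rad]) auto
  next
    case True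
    then have z: "phi_sol A b p l = 0 + 0" if "l \<in> {0<..}" for l
      using scaled_projection_zero[OF y_sol_projection[OF g] T(3) True, of l] that by (simp add: phi_sol_def)
    have zero: "bounded_linear (\<lambda>l::real. 0::real)" by (rule bounded_linear_zero)
    show ?thesis
      by (rule radial_imp_strongly_semismooth_at[OF U _
          directionally_differentiable_cong[OF U z directionally_differentiable_affine[OF zero]]
          radial_semismooth_at_cong[OF U z radial_semismooth_at_affine[OF zero]]])
        (simp add: phi locally_lipschitz_on_norm[OF lip])
  qed
qed

theorem strongly_semismooth_of_nondegenerate:
  fixes A :: "real^'n^'m"
  assumes g: "gauge_function p" "closed_fun p" "standing_assumption A b p"
    and ssm: "strongly_semismooth_on UNIV (closest_point (subdifferential p 0))"
    and l0: "l0 > 0" and zero: "prox_residual A b p (x0, l0) = 0"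
    and nd: "nondegenerate (clarke_jacobian_fst (prox_residual A b p) (x0, l0))"
  shows "strongly_semismooth_at {0<..} (y_sol A b p) l0 \<and> strongly_semismooth_at {0<..} (phi_sol A b p) l0"
proof -
  let ?C = "subdifferential p 0" and ?H = "prox_residual A b p"
  note C = gauge_subdifferential_zero_properties[OF g(1)]
  have Cne: "?C \<noteq> {}" using C(3) by blast
  have H: "?H = (\<lambda>q. closest_point ?C (fst q + dual_point A b q) - dual_point A b q)"
    by (rule ext) (rule prox_residual_eq[OF g(1,2)])
  note reg = projection_residual_regular[where A = A and b = b, OF C(1,2) Cne ssm, folded H]
  note kkt = prox_residual_zero_iff_kkt[OF g(1,2)]
  define U where "U = ball (x0, l0) (min 1 (l0 / 2))"
  have U: "open U" "(x0, l0) \<in> U" using l0 by (auto simp: U_def)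
  obtain L where L: "L-lipschitz_on U ?H" using reg(1)[OF l0, of x0] unfolding U_def by blast
  have regU: "radial_semismooth_at ?H q" "directionally_differentiable_at ?H q" if "q \<in> U" for q
  proof -
    have "norm (snd (q - (x0, l0))) \<le> norm (q - (x0, l0))" by (metis norm_snd_le prod.collapse)
    moreover have "norm (q - (x0, l0)) < min 1 (l0 / 2)"
      using that unfolding U_def mem_ball dist_norm by (subst norm_minus_commute)
    ultimately have "snd q > 0" using l0 by auto
    from reg(2,3)[OF this, of "fst q"]
    show "radial_semismooth_at ?H q" "directionally_differentiable_at ?H q" by simp_all
  qed
  obtain c r where c: "c > 0" and r: "r > 0" "ball (x0, l0) r \<subseteq> U"
    and inj: "\<And>x x' l. (x, l) \<in> ball (x0, l0) r \<Longrightarrow> (x', l) \<in> ball (x0, l0) r \<Longrightarrow>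
      c * norm (x - x') \<le> norm (?H (x, l) - ?H (x', l))"
    using nondegenerate_imp_partially_injective[OF U L regU(2) regU(1) nd] by blast
  have inball: "(x, l) \<in> ball (x0, l0) r" if "norm (x - x0) \<le> r / 2" "\<bar>l - l0\<bar> < r / 2" for x l
  proof -
    have "norm ((x, l) - (x0, l0)) \<le> norm (x - x0) + \<bar>l - l0\<bar>"
      using norm_Pair_le[of "x - x0" "l - l0"] by simp
    then have "norm ((x, l) - (x0, l0)) < r" using that by linarith
    then show ?thesis unfolding mem_ball dist_norm by (subst norm_minus_commute)
  qed
  have k0: "kkt A b ?C x0 l0" using zero kkt by blast
  have uniq: "norm (x - x0) \<noteq> r / 2" if "kkt A b ?C x l0" for x
  proof
    assume n: "norm (x - x0) = r / 2"
    have "?H (x, l0) = 0" using that kkt by blast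
    then have "c * r \<le> 0"
      using inj[OF inball inball, of x l0 x0] n r zero by simp
    then show False using r c by (simp add: mult_le_0_iff)
  qed
  have "r / 2 > 0" using r by simp
  then obtain \<rho>0 where \<rho>0: "\<rho>0 > 0" "\<rho>0 \<le> l0"
    "\<And>l x. \<bar>l - l0\<bar> < \<rho>0 \<Longrightarrow> kkt A b ?C x l \<Longrightarrow> norm (x - x0) < r / 2"
    using kkt_solutions_converge[OF l0 k0 _ uniq] by blast
  define \<rho> where "\<rho> = min \<rho>0 (r / 2)"
  have \<rho>: "\<rho> > 0" using \<rho>0 r by (simp add: \<rho>_def)
  \<comment> \<open>A selection of solutions passing through \<open>x0\<close>.\<close>
  define X where "X l = (if l = l0 then x0 else (SOME x. kkt A b ?C x l))" for l
  have near: "\<bar>l - l0\<bar> < \<rho>0" "\<bar>l - l0\<bar> < r / 2" "l > 0" if "l \<in> ball l0 \<rho>" for l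
    using that \<rho>0(2) by (auto simp: \<rho>_def dist_real_def abs_minus_commute)
  have X: "kkt A b ?C (X l) l" if "l \<in> ball l0 \<rho>" for l
    using standing_assumption_kkt[OF g(1,3) near(3)[OF that]] k0 by (auto simp: X_def intro: someI_ex)
  have XU: "(X l, l') \<in> ball (x0, l0) r" if "l \<in> ball l0 \<rho>" "l' \<in> ball l0 \<rho>" for l l'
    using \<rho>0(3)[OF near(1) X] near(2) that by (intro inball) (auto intro: less_imp_le)
  have HX: "?H (X l, l) = 0" if "l \<in> ball l0 \<rho>" for l using X[OF that] kkt by blast
  note Lr = lipschitz_on_subset[OF L r(2)]
  have ddr: "directionally_differentiable_at ?H q" if "q \<in> ball (x0, l0) r" for q
    using regU(2) r(2) that by blast
  have Xl0: "X l0 = x0" by (simp add: X_def)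
  have LX: "(L / c)-lipschitz_on (ball l0 \<rho>) X"
    by (rule implicit_function_lipschitz[OF open_ball Lr ddr c inj XU HX])
  have ddX: "directionally_differentiable_at X l" if "l \<in> ball l0 \<rho>" for l
    by (rule implicit_function_directionally_differentiable[OF open_ball Lr ddr c inj XU HX that])
  have radH: "radial_semismooth_at ?H (X l0, l0)" unfolding Xl0 by (rule regU(1)[OF U(2)])
  have radX: "radial_semismooth_at X l0"
    by (rule implicit_function_radial[OF open_ball Lr ddr c inj XU HX \<rho> radH])
  have lin: "bounded_linear (\<lambda>x. - (A *v x))" by (intro bounded_linear_minus matrix_vector_mul_bounded_linear)
  have y: "y_sol A b p l = b + - (A *v X l)" if "l \<in> ball l0 \<rho>" for l
    using y_sol_kkt[OF g(1,2) near(3)[OF that] X[OF that]] by simp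
  have l0b: "l0 \<in> ball l0 \<rho>" using \<rho> by simp
  have "radial_semismooth_at (y_sol A b p) l0"
    by (rule radial_semismooth_at_cong[OF open_ball l0b y
          radial_semismooth_at_affine_compose[OF lin open_ball l0b LX ddX radX]])
  moreover have "directionally_differentiable_at (y_sol A b p) l" if l: "l \<in> ball l0 \<rho>" for l
  proof (rule directionally_differentiable_cong[OF open_ball l y])
    have "has_dirderiv (\<lambda>l. b + - (A *v X l)) l k (0 + - (A *v \<xi>))" if "has_dirderiv X l k \<xi>" for k \<xi>
      by (rule has_dirderiv_add[OF has_dirderiv_const has_dirderiv_linear[OF lin that]])
    then show "directionally_differentiable_at (\<lambda>l. b + - (A *v X l)) l"
      using ddX[OF l] unfolding directionally_differentiable_iff by blast
  qed
  ultimately show ?thesis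
    using strongly_semismooth_at_y_phi[OF g open_ball l0b l0] by blast
qed


section \<open>The polyhedral case\<close>

text \<open>Intersecting the epigraph with a box gives a polytope whose finitely many vertices
  generate the epigraph as a cone.\<close>

lemma polyhedral_gauge_finite_constraints:
  fixes p :: "'a::euclidean_space \<Rightarrow> ereal"
  assumes g: "gauge_function p" and poly: "polyhedral_fun p"
  shows "\<exists>G. finite G \<and> subdifferential p 0 = {u. \<forall>(x, r)\<in>G. u \<bullet> x \<le> r}"
proof -
  let ?E = "ext_epigraph p"
  let ?box = "cbox (- One) One :: ('a \<times> real) set"
  have "polyhedron (?E \<inter> ?box)"
    using poly by (intro polyhedron_Int polyhedron_interval) (simp add: polyhedral_fun_def)
  moreover have "bounded (?E \<inter> ?box)" using bounded_cbox bounded_subset by blast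
  ultimately have "polytope (?E \<inter> ?box)" by (simp add: polytope_eq_bounded_polyhedron)
  then obtain G where G: "finite G" "?E \<inter> ?box = convex hull G" unfolding polytope_def by blast
  have nonneg: "0 \<le> p x" for x using g by (simp add: gauge_function_def)
  have "subdifferential p 0 = {u. \<forall>(x, r)\<in>G. u \<bullet> x \<le> r}"
  proof (intro set_eqI iffI)
    fix u assume u: "u \<in> subdifferential p 0"
    have "u \<bullet> x \<le> r" if "(x, r) \<in> G" for x r
    proof -
      have "(x, r) \<in> convex hull G" using that by (rule hull_inc)
      then have "(x, r) \<in> ?E" using G(2) by blast
      then have "ereal (u \<bullet> x) \<le> ereal r"
        using u by (auto simp: ext_epigraph_def gauge_subdifferential_zero[OF g] simp del: ereal_less_eq
            intro: order_trans)
      then show ?thesis by simp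
    qed
    then show "u \<in> {u. \<forall>(x, r)\<in>G. u \<bullet> x \<le> r}" by auto
  next
    fix u assume u: "u \<in> {u. \<forall>(x, r)\<in>G. u \<bullet> x \<le> r}"
    have "convex hull G \<subseteq> {z. (u, - 1) \<bullet> z \<le> 0}"
      using u by (intro hull_minimal convex_halfspace_le) auto
    then have hull: "u \<bullet> x \<le> r" if "(x, r) \<in> ?E" "(x, r) \<in> ?box" for x r
      using that unfolding G(2)[symmetric] by fastforce
    have "ereal (u \<bullet> x) \<le> p x" for x
    proof (cases "p x")
      case (real r)
      then have E: "(x, r) \<in> ?E" by (simp add: ext_epigraph_def)
      define t where "t = 1 / (norm (x, r) + 1)"
      have t: "t > 0" by (simp add: t_def add_nonneg_pos)
      have "norm (t *\<^sub>R z) \<le> 1" if "t = 1 / (norm z + 1)" for z :: "'a \<times> real"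
        using that by (simp add: divide_le_eq add_nonneg_pos)
      from this[OF t_def] have "norm (t *\<^sub>R (x, r)) \<le> 1" .
      then have "\<bar>(t *\<^sub>R (x, r)) \<bullet> i\<bar> \<le> 1" if "i \<in> Basis" for i
        using Basis_le_norm[OF that, of "t *\<^sub>R (x, r)"] by linarith
      then have "t *\<^sub>R (x, r) \<in> ?box" by (force simp: mem_box abs_le_iff)
      then have "u \<bullet> (t *\<^sub>R x) \<le> t * r"
        using hull[OF ext_epigraph_gauge_scale[OF g E t]] by simp
      then show ?thesis using t real by simp
    qed (use nonneg[of x] in auto)
    then show "u \<in> subdifferential p 0" by (simp add: gauge_subdifferential_zero[OF g])
  qed
  then show ?thesis using G(1) by blast
qed

text \<open>On the set of parameters with a given set \<open>J\<close> of active constraints, the projection is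
  characterised by the linear system \<open>y \<bullet> a = \<lambda> \<beta>\<close> for \<open>(a, \<beta>) \<in> J\<close> and \<open>b - y \<bottom> {d. \<forall>(a, \<beta>) \<in> J. d \<bullet> a = 0}\<close>,
  which is jointly affine in \<open>(\<lambda>, y)\<close> and has at most one solution \<open>y\<close> for each \<open>\<lambda>\<close>.\<close>

lemma scaled_polyhedral_projection_piecewise:
  fixes D :: "'a::euclidean_space set" and y :: "real \<Rightarrow> 'a"
  assumes D: "convex D" "closed D" "0 \<in> D" and G: "finite G" "D = {w. \<forall>(a, \<beta>)\<in>G. w \<bullet> a \<le> \<beta>}"
    and y: "\<And>l. l > 0 \<Longrightarrow> y l = l *\<^sub>R closest_point D (inverse l *\<^sub>R b)"
  shows "\<exists>P. finite P \<and> (\<forall>l>0. \<exists>(s, c)\<in>P. y l = c + l *\<^sub>R s)"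
proof -
  define J where "J l = {(a, \<beta>)\<in>G. y l \<bullet> a = l * \<beta>}" for l
  have orth: "(b - y l) \<bullet> d = 0" if l: "l > 0" and d: "\<forall>(a, \<beta>)\<in>J l. d \<bullet> a = 0" for l d
  proof -
    define w where "w = closest_point D (inverse l *\<^sub>R b)"
    have yw: "y l = l *\<^sub>R w" using y[OF l] by (simp add: w_def)
    have wD: "w \<in> D" unfolding w_def using D by (intro closest_point_in_set) auto
    \<comment> \<open>A direction annihilating the active constraints is feasible for small steps.\<close>
    have half: "(b - y l) \<bullet> e \<le> 0" if e: "\<forall>(a, \<beta>)\<in>J l. e \<bullet> a = 0" for e
    proof -
      have ev: "\<forall>\<^sub>F t in at_right 0. \<forall>z\<in>G. (w + t *\<^sub>R e) \<bullet> fst z \<le> snd z"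
      proof (intro eventually_ball_finite[OF G(1)] ballI)
        fix z assume "z \<in> G"
        obtain a \<beta> where z: "z = (a, \<beta>)" by (cases z)
        have wa: "w \<bullet> a \<le> \<beta>" using wD \<open>z \<in> G\<close> unfolding z G(2) by blast
        show "\<forall>\<^sub>F t in at_right 0. (w + t *\<^sub>R e) \<bullet> fst z \<le> snd z"
        proof (cases "w \<bullet> a = \<beta>")
          case True
          then have "(a, \<beta>) \<in> J l" using \<open>z \<in> G\<close> z by (simp add: J_def yw)
          then have "e \<bullet> a = 0" using e by blast
          then show ?thesis using True by (simp add: z inner_add_left)
        next
          case False
          have "((\<lambda>t. (w + t *\<^sub>R e) \<bullet> a) \<longlongrightarrow> (w + 0 *\<^sub>R e) \<bullet> a) (at_right 0)" by (intro tendsto_intros)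
          then have "\<forall>\<^sub>F t in at_right 0. (w + t *\<^sub>R e) \<bullet> a < \<beta>"
            using wa False by (intro order_tendstoD) auto
          then show ?thesis by eventually_elim (simp add: z)
        qed
      qed
      obtain t where t: "t > 0" "\<forall>z\<in>G. (w + t *\<^sub>R e) \<bullet> fst z \<le> snd z"
        using eventually_happens'[OF trivial_limit_at_right_real
            eventually_conj[OF eventually_at_right_less[of "0::real"] ev]] by blast
      then have "w + t *\<^sub>R e \<in> D" unfolding G(2) by auto
      from closest_point_dot[OF D(1,2) this, of "inverse l *\<^sub>R b"]
      have "(inverse l *\<^sub>R b - w) \<bullet> (t *\<^sub>R e) \<le> 0" by (simp add: w_def)
      then have "(inverse l *\<^sub>R b - w) \<bullet> e \<le> 0" using t(1) by (simp add: mult_le_0_iff)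
      then have "l * ((inverse l *\<^sub>R b - w) \<bullet> e) \<le> 0" using l by (simp add: mult_le_0_iff)
      moreover have "l * ((inverse l *\<^sub>R b - w) \<bullet> e) = (b - y l) \<bullet> e"
        using l by (simp add: yw inner_diff_left right_diff_distrib)
      ultimately show ?thesis by simp
    qed
    have "\<forall>(a, \<beta>)\<in>J l. (- d) \<bullet> a = 0" using d by auto
    from half[OF d] half[OF this] show ?thesis by simp
  qed
  have "\<exists>s c. \<forall>l>0. J l = K \<longrightarrow> y l = c + l *\<^sub>R s" for K
  proof (cases "\<exists>l1 l2. 0 < l1 \<and> 0 < l2 \<and> l1 \<noteq> l2 \<and> J l1 = K \<and> J l2 = K")
    case False
    show ?thesis
    proof (cases "\<exists>l1>0. J l1 = K")
      case True
      then obtain l1 where "l1 > 0" "J l1 = K" by blast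
      then show ?thesis using False by (intro exI[of _ 0] exI[of _ "y l1"]) auto
    qed blast
  next
    case True
    then obtain l1 l2 where l12: "0 < l1" "0 < l2" "l1 \<noteq> l2" "J l1 = K" "J l2 = K" by blast
    define s where "s = (y l2 - y l1) /\<^sub>R (l2 - l1)"
    define c where "c = y l1 - l1 *\<^sub>R s"
    have "y l = c + l *\<^sub>R s" if l: "l > 0" "J l = K" for l
    proof -
      define \<theta> where "\<theta> = (l - l1) / (l2 - l1)"
      have \<theta>: "\<theta> * (l2 - l1) = l - l1" using l12 by (simp add: \<theta>_def)
      have "c + l *\<^sub>R s = y l1 + (l - l1) *\<^sub>R s" by (simp add: c_def scaleR_left_diff_distrib)
      also have "(l - l1) *\<^sub>R s = \<theta> *\<^sub>R (y l2 - y l1)" by (simp add: s_def \<theta>_def divide_inverse)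
      finally have cs: "c + l *\<^sub>R s = y l1 + \<theta> *\<^sub>R (y l2 - y l1)" .
      define d where "d = y l - (y l1 + \<theta> *\<^sub>R (y l2 - y l1))"
      have dK: "d \<bullet> a = 0" if "(a, \<beta>) \<in> K" for a \<beta>
      proof -
        have "y l \<bullet> a = l * \<beta>" "y l1 \<bullet> a = l1 * \<beta>" "y l2 \<bullet> a = l2 * \<beta>"
          using that l(2) l12(4,5) by (auto simp: J_def)
        then have "d \<bullet> a = l * \<beta> - (l1 * \<beta> + (\<theta> * (l2 - l1)) * \<beta>)"
          by (simp add: d_def inner_diff_left inner_add_left algebra_simps)
        then show ?thesis unfolding \<theta> by (simp add: algebra_simps)
      qed
      have "(b - y l) \<bullet> d = 0" "(b - y l1) \<bullet> d = 0" "(b - y l2) \<bullet> d = 0"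
        using dK l l12 by (auto intro!: orth)
      then have "y l \<bullet> d = b \<bullet> d" "y l1 \<bullet> d = b \<bullet> d" "y l2 \<bullet> d = b \<bullet> d"
        by (simp_all add: inner_diff_left)
      then have "d \<bullet> d = 0"
        by (subst (1) d_def) (simp add: inner_diff_left inner_add_left)
      then show ?thesis unfolding cs by (simp add: d_def)
    qed
    then show ?thesis by blast
  qed
  then obtain s c where sc: "\<And>K l. l > 0 \<Longrightarrow> J l = K \<Longrightarrow> y l = c K + l *\<^sub>R s K" by metis
  show ?thesis
  proof (intro exI[of _ "(\<lambda>K. (s K, c K)) ` Pow G"] conjI allI impI)
    show "finite ((\<lambda>K. (s K, c K)) ` Pow G)" using G(1) by simp
    fix l :: real assume "l > 0"
    moreover have "J l \<in> Pow G" by (auto simp: J_def)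
    ultimately show "\<exists>(s, c)\<in>(\<lambda>K. (s K, c K)) ` Pow G. y l = c + l *\<^sub>R s"
      using sc[of l "J l"] by (intro bexI[of _ "(s (J l), c (J l))"]) auto
  qed
qed

text \<open>A continuous selection of finitely many affine functions of one real variable is affine
  on an interval to the right of each point, since two distinct affine functions agree in at
  most one point.\<close>

lemma piecewise_affine_right:
  fixes f :: "real \<Rightarrow> 'b::real_normed_vector"
  assumes r: "r > 0" and cont: "continuous_on {x0..<x0 + r} f" and P: "finite P"
    and sel: "\<And>x. x0 \<le> x \<Longrightarrow> x < x0 + r \<Longrightarrow> \<exists>(s, c)\<in>P. f x = c + x *\<^sub>R s"
  shows "\<exists>e>0. \<exists>s. \<forall>x. x0 \<le> x \<longrightarrow> x < x0 + e \<longrightarrow> f x = f x0 + (x - x0) *\<^sub>R s"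
proof -
  \<comment> \<open>The finite set of points where two distinct affine pieces meet.\<close>
  define Z where "Z = (\<Union>(s, c)\<in>P. \<Union>(s', c')\<in>P. {x. (s, c) \<noteq> (s', c') \<and> c + x *\<^sub>R s = c' + x *\<^sub>R s'})"
  have fin: "finite {x. (s, c) \<noteq> (s', c') \<and> c + x *\<^sub>R s = c' + x *\<^sub>R s'}" for s c s' c' :: 'b
  proof -
    have "x = z" if "(s, c) \<noteq> (s', c')" "c + x *\<^sub>R s = c' + x *\<^sub>R s'" "c + z *\<^sub>R s = c' + z *\<^sub>R s'" for x z
    proof -
      have "(x - z) *\<^sub>R (s - s') = 0"
        using arg_cong2[OF that(2,3), of "(-)"] by (simp add: algebra_simps)
      moreover have "s \<noteq> s'" using that by auto
      ultimately show ?thesis by simp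
    qed
    then have "{x. (s, c) \<noteq> (s', c') \<and> c + x *\<^sub>R s = c' + x *\<^sub>R s'} \<subseteq> {z}"
      if "z \<in> {x. (s, c) \<noteq> (s', c') \<and> c + x *\<^sub>R s = c' + x *\<^sub>R s'}" for z
      using that by blast
    then show ?thesis by (metis (lifting) finite.emptyI finite.insertI finite_subset equals0I)
  qed
  have "finite Z" unfolding Z_def using P fin by (auto intro!: finite_UN_I)
  then obtain e0 where e0: "e0 > 0" "\<And>x. x \<in> Z \<Longrightarrow> x \<noteq> x0 \<Longrightarrow> e0 \<le> dist x0 x"
    using finite_set_avoid[of Z x0] by blast
  define e where "e = min e0 r"
  have e: "e > 0" using e0 r by (simp add: e_def)
  define I where "I = {x0<..<x0 + e}"
  have IZ: "x \<notin> Z" if "x \<in> I" for x using e0(2)[of x] that by (auto simp: I_def e_def dist_real_def)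
  have contI: "continuous_on I f" by (rule continuous_on_subset[OF cont]) (auto simp: I_def e_def)
  have selI: "\<exists>(s, c)\<in>P. f x = c + x *\<^sub>R s" if "x \<in> I" for x using sel that by (auto simp: I_def e_def)
  define x1 where "x1 = x0 + e / 2"
  have x1: "x1 \<in> I" using e by (auto simp: I_def x1_def)
  obtain s c where sc: "(s, c) \<in> P" "f x1 = c + x1 *\<^sub>R s" using selI[OF x1] by blast
  have cl: "closedin (top_of_set I) {x\<in>I. f x = c + x *\<^sub>R s}" for s c
  proof -
    have "closedin (top_of_set I) (I \<inter> (\<lambda>x. f x - (c + x *\<^sub>R s)) -` {0})"
      by (intro continuous_closedin_preimage continuous_intros contI)
    moreover have "I \<inter> (\<lambda>x. f x - (c + x *\<^sub>R s)) -` {0} = {x\<in>I. f x = c + x *\<^sub>R s}" by auto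
    ultimately show ?thesis by simp
  qed
  let ?S = "{x\<in>I. f x = c + x *\<^sub>R s}"
  let ?R = "\<Union>(s', c')\<in>P - {(s, c)}. {x\<in>I. f x = c' + x *\<^sub>R s'}"
  have "closedin (top_of_set I) ?R"
    using P by (intro closedin_Union) (auto intro: cl)
  moreover have "?R = I - ?S"
  proof (intro set_eqI iffI)
    fix x assume "x \<in> ?R"
    then obtain s' c' where "(s', c') \<in> P" "(s', c') \<noteq> (s, c)" "x \<in> I" "f x = c' + x *\<^sub>R s'" by auto
    moreover from this have "\<not> f x = c + x *\<^sub>R s"
      using IZ[OF \<open>x \<in> I\<close>] sc(1) unfolding Z_def by force
    ultimately show "x \<in> I - ?S" by blast
  next
    fix x assume x: "x \<in> I - ?S"
    then obtain s' c' where "(s', c') \<in> P" "f x = c' + x *\<^sub>R s'" using selI by blast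
    then show "x \<in> ?R" using x by (intro UN_I[of "(s', c')"]) auto
  qed
  ultimately have "openin (top_of_set I) ?S"
    by (simp add: openin_closedin_eq)
  moreover have "connected I" by (simp add: I_def)
  ultimately have "?S = {} \<or> ?S = I" using cl connected_clopen by blast
  then have SI: "?S = I" using x1 sc by blast
  have aff: "f x = c + x *\<^sub>R s" if "x \<in> I" for x using that SI by blast
  have "f x0 = c + x0 *\<^sub>R s"
  proof (rule tendsto_unique[OF trivial_limit_at_right_real])
    have "(f \<longlongrightarrow> f x0) (at x0 within {x0..<x0 + r})" using cont r by (simp add: continuous_on_def)
    then have "(f \<longlongrightarrow> f x0) (at x0 within {x0..x0 + r / 2})"
      by (rule tendsto_within_subset) (use r in auto)
    moreover have "at x0 within {x0..x0 + r / 2} = at_right x0" using r by (intro at_within_Icc_at_right) simp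
    ultimately show "(f \<longlongrightarrow> f x0) (at_right x0)" by simp
    have "\<forall>\<^sub>F x in at_right x0. x \<in> {x0<..<x0 + e}" by (rule eventually_at_right_real) (use e in simp)
    then have "\<forall>\<^sub>F x in at_right x0. c + x *\<^sub>R s = f x"
      by eventually_elim (use aff in \<open>simp add: I_def\<close>)
    moreover have "((\<lambda>x. c + x *\<^sub>R s) \<longlongrightarrow> c + x0 *\<^sub>R s) (at_right x0)" by (intro tendsto_intros)
    ultimately show "(f \<longlongrightarrow> c + x0 *\<^sub>R s) (at_right x0)" by (rule Lim_transform_eventually[rotated])
  qed
  then have "f x = f x0 + (x - x0) *\<^sub>R s" if "x0 \<le> x" "x < x0 + e" for x
    using aff[of x] that by (cases "x = x0") (auto simp: I_def algebra_simps)
  then show ?thesis using e by blast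
qed

lemma piecewise_affine_both_sides:
  fixes f :: "real \<Rightarrow> 'b::real_normed_vector"
  assumes "open U" "x0 \<in> U" and cont: "continuous_on U f" and P: "finite P"
    and sel: "\<And>x. x \<in> U \<Longrightarrow> \<exists>(s, c)\<in>P. f x = c + x *\<^sub>R s"
  shows "\<exists>e>0. \<exists>s t. ball x0 e \<subseteq> U \<and> (\<forall>x\<in>ball x0 e. f x = f x0 + (x - x0) *\<^sub>R (if x \<ge> x0 then s else t))"
proof -
  obtain r where r: "r > 0" "ball x0 r \<subseteq> U" using assms(1,2) openE by blast
  have inU: "x \<in> U" if "\<bar>x - x0\<bar> < r" for x
    using that r(2) by (auto simp: dist_real_def abs_minus_commute)
  have "\<exists>e>0. \<exists>s. \<forall>x. x0 \<le> x \<longrightarrow> x < x0 + e \<longrightarrow> f x = f x0 + (x - x0) *\<^sub>R s"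
    by (rule piecewise_affine_right[OF r(1) _ P]) (auto intro!: continuous_on_subset[OF cont] sel inU)
  then obtain e s where e: "e > 0" "\<And>x. x0 \<le> x \<Longrightarrow> x < x0 + e \<Longrightarrow> f x = f x0 + (x - x0) *\<^sub>R s" by blast
  have "\<exists>e>0. \<exists>s. \<forall>x. - x0 \<le> x \<longrightarrow> x < - x0 + e \<longrightarrow> f (- x) = f (- (- x0)) + (x - - x0) *\<^sub>R s"
  proof (rule piecewise_affine_right[OF r(1)])
    show "continuous_on {- x0..<- x0 + r} (\<lambda>x. f (- x))"
      by (rule continuous_on_compose2[OF cont]) (auto intro!: continuous_intros inU)
    show "finite ((\<lambda>(s, c). (- s, c)) ` P)" using P by simp
    fix x assume "- x0 \<le> x" "x < - x0 + r"
    then have "- x \<in> U" by (intro inU) auto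
    then obtain s c where "(s, c) \<in> P" "f (- x) = c + (- x) *\<^sub>R s" using sel by blast
    then show "\<exists>(s, c)\<in>(\<lambda>(s, c). (- s, c)) ` P. f (- x) = c + x *\<^sub>R s"
      by (intro bexI[of _ "(- s, c)"]) auto
  qed
  then obtain e' t where e': "e' > 0" "\<And>x. - x0 \<le> x \<Longrightarrow> x < - x0 + e' \<Longrightarrow> f (- x) = f x0 + (x + x0) *\<^sub>R t" by auto
  show ?thesis
  proof (rule exI[of _ "min r (min e e')"], rule conjI)
    show "min r (min e e') > 0" using r(1) e(1) e'(1) by simp
    have "f x = f x0 + (x - x0) *\<^sub>R (if x \<ge> x0 then s else - t)" if x: "x \<in> ball x0 (min r (min e e'))" for x
    proof (cases "x \<ge> x0")
      case True
      then show ?thesis using e(2)[of x] x by (auto simp: dist_real_def)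
    next
      case False
      then show ?thesis using e'(2)[of "- x"] x by (auto simp: dist_real_def algebra_simps)
    qed
    moreover have "ball x0 (min r (min e e')) \<subseteq> U" using r(2) by auto
    ultimately show "\<exists>s t. ball x0 (min r (min e e')) \<subseteq> U \<and>
        (\<forall>x\<in>ball x0 (min r (min e e')). f x = f x0 + (x - x0) *\<^sub>R (if x \<ge> x0 then s else t))" by blast
  qed
qed

text \<open>A function of one variable that is affine on each side of \<open>x0\<close>.\<close>

lemma broken_line_regular:
  fixes f :: "real \<Rightarrow> 'b::real_normed_vector"
  assumes e: "e > 0" and f: "\<And>x. x \<in> ball x0 e \<Longrightarrow> f x = f x0 + (x - x0) *\<^sub>R (if x \<ge> x0 then s else t)"
  shows "directionally_differentiable_at f x0" "radial_semismooth_at f x0"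
proof -
  have ev: "\<forall>\<^sub>F u in at_right 0. x0 + u *\<^sub>R k \<in> ball x0 e" for k :: real
    by (rule eventually_ray_in_open) (use e in auto)
  show "directionally_differentiable_at f x0"
    unfolding directionally_differentiable_iff
  proof
    fix k :: real
    define m where "m = k *\<^sub>R (if k \<ge> 0 then s else t)"
    have "\<forall>\<^sub>F u in at_right 0. m = (f (x0 + u *\<^sub>R k) - f x0) /\<^sub>R u"
      using ev[of k] eventually_at_right_less[of "0::real"]
      by eventually_elim (auto simp: f m_def zero_le_mult_iff mult_le_0_iff)
    then have "has_dirderiv f x0 k m" unfolding has_dirderiv_def
      by (rule Lim_transform_eventually[OF tendsto_const])
    then show "\<exists>l. has_dirderiv f x0 k l" ..
  qed
  have side: "l = k *\<^sub>R (if x \<ge> x0 then s else t)"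
    if x: "x \<in> ball x0 e" "x \<noteq> x0" and l: "has_dirderiv f x k l" for x k l
  proof -
    define v where "v = (if x \<ge> x0 then s else t)"
    define S where "S = (if x \<ge> x0 then {x0<..<x0 + e} else {x0 - e<..<x0})"
    have S: "open S" "x \<in> S" using x by (auto simp: S_def dist_real_def split: if_splits)
    have lin: "bounded_linear (\<lambda>x. x *\<^sub>R v)" by (rule bounded_linear_scaleR_left)
    have fS: "f z = (f x0 - x0 *\<^sub>R v) + z *\<^sub>R v" if "z \<in> S" for z
      using f[of z] that by (auto simp: S_def v_def dist_real_def algebra_simps split: if_splits)
    have "has_dirderiv f x k (k *\<^sub>R v)"
      using has_dirderiv_cong[where G = f, OF S fS] has_dirderiv_affine[OF lin] by blast
    then show ?thesis using l has_dirderiv_unique unfolding v_def by blast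
  qed
  show "radial_semismooth_at f x0"
  proof (rule radial_semismooth_atI[OF e, where C = 0])
    fix x l and \<sigma> :: real
    assume x: "norm (x - x0) < e" and \<sigma>: "\<sigma> \<in> {1, -1}" and l: "has_dirderiv f x (\<sigma> *\<^sub>R (x - x0)) l"
    have xb: "x \<in> ball x0 e" using x by (simp add: dist_real_def abs_minus_commute)
    show "norm (f x - f x0 - \<sigma> *\<^sub>R l) \<le> 0 * (norm (x - x0))\<^sup>2"
    proof (cases "x = x0")
      case True
      then have "l = 0" using l has_dirderiv_unique has_dirderiv_scale[OF l, of 0] by simp
      then show ?thesis using True by simp
    next
      case False
      have "l = (\<sigma> * (x - x0)) *\<^sub>R (if x \<ge> x0 then s else t)"
        using side[OF xb False l] by simp
      then have "\<sigma> *\<^sub>R l = (x - x0) *\<^sub>R (if x \<ge> x0 then s else t)" using \<sigma> by auto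
      then show ?thesis using f[OF xb] by simp
    qed
  qed
qed

theorem polyhedral_solution_path:
  fixes A :: "real^'n^'m"
  assumes g: "gauge_function p" "closed_fun p" "standing_assumption A b p" and poly: "polyhedral_fun p"
  shows "piecewise_affine_on {0<..} (y_sol A b p) \<and> strongly_semismooth_on {0<..} (phi_sol A b p)"
proof -
  let ?y = "y_sol A b p"
  define D where "D = {w. transpose A *v w \<in> subdifferential p 0}"
  note D = y_sol_projection[OF g, folded D_def]
  obtain G0 where G0: "finite G0" "subdifferential p 0 = {u. \<forall>(x, r)\<in>G0. u \<bullet> x \<le> r}"
    using polyhedral_gauge_finite_constraints[OF g(1) poly] by blast
  define G where "G = (\<lambda>(x, r). (A *v x, r)) ` G0"
  have "finite G" using G0(1) by (simp add: G_def)
  moreover have "D = {w. \<forall>(a, \<beta>)\<in>G. w \<bullet> a \<le> \<beta>}"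
    unfolding D_def G0(2) G_def by (auto simp: inner_transpose_mult)
  ultimately obtain P where P: "finite P" "\<And>l. l > 0 \<Longrightarrow> \<exists>(s, c)\<in>P. ?y l = c + l *\<^sub>R s"
    using scaled_polyhedral_projection_piecewise[OF D(1-3) _ _ D(4)] by blast
  have cont: "continuous_on {0<..} ?y"
  proof (rule continuous_on_eq)
    have "D \<noteq> {}" using D(3) by blast
    have "continuous_on {0<..} (\<lambda>l. closest_point D (inverse l *\<^sub>R b))"
      by (rule continuous_on_compose2[OF continuous_on_closest_point[OF D(1,2) \<open>D \<noteq> {}\<close>, of UNIV]])
        (auto intro!: continuous_intros)
    then show "continuous_on {0<..} (\<lambda>l. l *\<^sub>R closest_point D (inverse l *\<^sub>R b))"
      by (intro continuous_intros)
    fix l :: real assume "l \<in> {0<..}"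
    then show "l *\<^sub>R closest_point D (inverse l *\<^sub>R b) = ?y l" using D(4) by simp
  qed
  have "piecewise_affine_on {0<..} ?y"
    unfolding piecewise_affine_on_def
  proof (intro conjI cont exI[of _ "(\<lambda>(s, c) l. l *\<^sub>R s + c) ` P"] ballI)
    show "finite ((\<lambda>(s, c) l. l *\<^sub>R s + c) ` P)" using P(1) by simp
    fix h assume "h \<in> (\<lambda>(s, c) l. l *\<^sub>R s + c) ` P"
    then obtain s c where "h = (\<lambda>l. l *\<^sub>R s + c)" by auto
    moreover have "linear (\<lambda>l::real. l *\<^sub>R s)"
      by (rule linearI) (simp_all add: scaleR_left_distrib)
    ultimately show "\<exists>L c. linear L \<and> h = (\<lambda>x. L x + c)" by blast
  next
    fix l :: real assume "l \<in> {0<..}"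
    then obtain s c where "(s, c) \<in> P" "?y l = c + l *\<^sub>R s" using P(2)[of l] by auto
    then show "\<exists>h\<in>(\<lambda>(s, c) l. l *\<^sub>R s + c) ` P. ?y l = h l"
      by (intro bexI[of _ "\<lambda>l. l *\<^sub>R s + c"]) (auto simp: add.commute)
  qed
  moreover have "strongly_semismooth_on {0<..} (phi_sol A b p)"
    unfolding strongly_semismooth_on_def
  proof
    fix l0 :: real assume l0: "l0 \<in> {0<..}"
    have reg: "directionally_differentiable_at ?y l \<and> radial_semismooth_at ?y l" if l: "l \<in> {0<..}" for l
    proof -
      obtain e s t where "e > 0" "\<And>x. x \<in> ball l e \<Longrightarrow> ?y x = ?y l + (x - l) *\<^sub>R (if x \<ge> l then s else t)"
        using piecewise_affine_both_sides[OF open_greaterThan l cont P(1)] P(2) by (metis greaterThan_iff)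
      then show ?thesis using broken_line_regular by blast
    qed
    show "strongly_semismooth_at {0<..} (phi_sol A b p) l0"
      using strongly_semismooth_at_y_phi(2)[OF g open_greaterThan l0 _ _] reg l0 by simp
  qed
  ultimately show ?thesis ..
qed

section \<open>Strong semismoothness of the solution path\<close>

theorem proposition3p5:
  fixes A :: "real^'n^'m" and b :: "real^'m" and p :: "real^'n \<Rightarrow> ereal"
  assumes "gauge_function p" and "proper_fun p" and "closed_fun p"
    and "standing_assumption A b p"
  shows "(strongly_semismooth_on UNIV (closest_point (subdifferential p 0)) \<longrightarrow>
            (\<forall>x l. l > 0 \<and> prox_residual A b p (x, l) = 0 \<and>
               nondegenerate (clarke_jacobian_fst (prox_residual A b p) (x, l)) \<longrightarrow>
               strongly_semismooth_at {0<..} (y_sol A b p) l \<and>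
               strongly_semismooth_at {0<..} (phi_sol A b p) l)) \<and>
         (polyhedral_fun p \<longrightarrow>
            piecewise_affine_on {0<..} (y_sol A b p) \<and>
            strongly_semismooth_on {0<..} (phi_sol A b p))"
  using strongly_semismooth_of_nondegenerate[OF assms(1,3,4)]
    polyhedral_solution_path[OF assms(1,3,4)] by blast

end
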